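(* Assume that for some $T>0$, $$u\in C([-T,T]:H^1(\mathbb R))\cap L^\infty([-T,T]:W^{1,\infty}(\mathbb R))\cap C^1((-T,T):L^2(\mathbb R))$$ is a solution of the initial value problem for the reduced Camassa--Holm equation $$\partial_tu+3u\,\partial_xu-\partial_t\partial_x^2u=2\,\partial_xu\,\partial_x^2u+u\,\partial_x^3u,$$ with initial data $u_0(x)=u(x,0)$ in $H^1(\mathbb R)\cap W^{1,\infty}(\mathbb R)$. If for some $\theta\in(0,1)$ $$|u_0(x)|,\ |\partial_xu_0(x)|=O(e^{-\theta x})\qquad\text{as }x\uparrow\infty,$$ then $$|u(x,t)|,\ |\partial_xu(x,t)|=O(e^{-\theta x})\qquad\text{as }x\uparrow\infty,$$ uniformly in the time interval $[0,T]$.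
   Context: $W^{1,\infty}(\mathbb R)=\{f\in L^\infty(\mathbb R): f'\in L^\infty(\mathbb R)\}$ (distributional derivative). For functions in the stated class the reduced Camassa--Holm equation is understood in the form $\partial_tu+u\,\partial_xu=-\partial_x(1-\partial_x^2)^{-1}\bigl(u^2+\tfrac12(\partial_xu)^2\bigr)$, as an identity in $L^2(\mathbb R)$, where $(1-\partial_x^2)^{-1}$ is convolution with $\tfrac12e^{-|x|}$. Pointwise bounds on $x$-derivatives are understood almost everywhere in $x$. *)

theory Defs
  imports "HOL-Analysis.Analysis" "HOL-Probability.Essential_Supremum"
    "HOL-Library.Landau_Symbols"
begin

text \<open>
  Elements of the function spaces are represented by functions \<open>real \<Rightarrow> real\<close>; all notions
  below depend only on the almost-everywhere class. A function of time and space is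
  written \<open>u t x\<close>, time first.
\<close>

definition test_function :: "(real \<Rightarrow> real) \<Rightarrow> bool" where
  "test_function \<phi> \<longleftrightarrow>
     (\<forall>n x. (deriv ^^ n) \<phi> field_differentiable at x) \<and> compact (closure {x. \<phi> x \<noteq> 0})"

definition locally_integrable :: "(real \<Rightarrow> real) \<Rightarrow> bool" where
  "locally_integrable f \<longleftrightarrow> (\<forall>K. compact K \<longrightarrow> set_integrable lebesgue K f)"

definition has_weak_deriv :: "(real \<Rightarrow> real) \<Rightarrow> (real \<Rightarrow> real) \<Rightarrow> bool" where
  "has_weak_deriv f g \<longleftrightarrow> locally_integrable f \<and> locally_integrable g \<and>
     (\<forall>\<phi>. test_function \<phi> \<longrightarrow>
        (LINT x|lebesgue. f x * deriv \<phi> x) = - (LINT x|lebesgue. g x * \<phi> x))"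

text \<open>
  A representative of the distributional derivative. It is determined only almost
  everywhere, and only when the distributional derivative is a locally integrable function.
\<close>

definition weak_deriv :: "(real \<Rightarrow> real) \<Rightarrow> real \<Rightarrow> real" where
  "weak_deriv f = (SOME g. has_weak_deriv f g)"

definition L2 :: "(real \<Rightarrow> real) set" where
  "L2 = {f. f \<in> borel_measurable lebesgue \<and> integrable lebesgue (\<lambda>x. (f x)\<^sup>2)}"

definition L2_norm :: "(real \<Rightarrow> real) \<Rightarrow> real" where
  "L2_norm f = sqrt (LINT x|lebesgue. (f x)\<^sup>2)"

definition H1 :: "(real \<Rightarrow> real) set" where
  "H1 = {f. f \<in> L2 \<and> (\<exists>g. has_weak_deriv f g \<and> g \<in> L2)}"

definition H1_norm :: "(real \<Rightarrow> real) \<Rightarrow> real" where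
  "H1_norm f = sqrt ((L2_norm f)\<^sup>2 + (L2_norm (weak_deriv f))\<^sup>2)"

definition Linf_norm :: "(real \<Rightarrow> real) \<Rightarrow> ereal" where
  "Linf_norm f = esssup lebesgue (\<lambda>x. ereal \<bar>f x\<bar>)"

definition Linf :: "(real \<Rightarrow> real) set" where
  "Linf = {f. f \<in> borel_measurable lebesgue \<and> Linf_norm f < \<infinity>}"

definition W1inf :: "(real \<Rightarrow> real) set" where
  "W1inf = {f. f \<in> Linf \<and> (\<exists>g. has_weak_deriv f g \<and> g \<in> Linf)}"

definition W1inf_norm :: "(real \<Rightarrow> real) \<Rightarrow> ereal" where
  "W1inf_norm f = Linf_norm f + Linf_norm (weak_deriv f)"

definition C_H1 :: "real set \<Rightarrow> (real \<Rightarrow> real \<Rightarrow> real) \<Rightarrow> bool" where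
  "C_H1 S u \<longleftrightarrow> (\<forall>t\<in>S. u t \<in> H1) \<and>
     (\<forall>t\<in>S. ((\<lambda>s. H1_norm (\<lambda>x. u s x - u t x)) \<longlongrightarrow> 0) (at t within S))"

definition C_L2 :: "real set \<Rightarrow> (real \<Rightarrow> real \<Rightarrow> real) \<Rightarrow> bool" where
  "C_L2 S u \<longleftrightarrow> (\<forall>t\<in>S. u t \<in> L2) \<and>
     (\<forall>t\<in>S. ((\<lambda>s. L2_norm (\<lambda>x. u s x - u t x)) \<longlongrightarrow> 0) (at t within S))"

text \<open>
  Essential boundedness in time. No measurability in time is demanded: the space \<open>W1inf\<close>
  is not separable, and together with \<open>C_H1\<close> weak-star measurability is automatic.
\<close>

definition Linf_W1inf :: "real set \<Rightarrow> (real \<Rightarrow> real \<Rightarrow> real) \<Rightarrow> bool" where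
  "Linf_W1inf S u \<longleftrightarrow>
     (\<exists>M::real. AE t in lebesgue. t \<in> S \<longrightarrow> u t \<in> W1inf \<and> W1inf_norm (u t) \<le> ereal M)"

text \<open>\<open>C1_L2 S u v\<close>: \<open>u\<close> is continuously differentiable from the open set \<open>S\<close>
  into \<open>L2\<close>, with time derivative \<open>v\<close>.\<close>

definition C1_L2 :: "real set \<Rightarrow> (real \<Rightarrow> real \<Rightarrow> real) \<Rightarrow> (real \<Rightarrow> real \<Rightarrow> real) \<Rightarrow> bool" where
  "C1_L2 S u v \<longleftrightarrow> C_L2 S u \<and> C_L2 S v \<and>
     (\<forall>t\<in>S. ((\<lambda>h. L2_norm (\<lambda>x. (u (t + h) x - u t x) / h - v t x)) \<longlongrightarrow> 0) (at 0))"

text \<open>The operator \<open>(1 - \<partial>\<^sub>x\<^sup>2)\<^sup>-\<^sup>1\<close>, as convolution with its Green function.\<close>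

definition inv_Helmholtz :: "(real \<Rightarrow> real) \<Rightarrow> real \<Rightarrow> real" where
  "inv_Helmholtz f x = (LINT y|lebesgue. (1/2) * exp (- \<bar>x - y\<bar>) * f y)"

text \<open>The reduced Camassa--Holm equation on \<open>S\<close> in its nonlocal form, where \<open>v\<close> is the
  time derivative of \<open>u\<close>; the identity is between elements of \<open>L2\<close>, for each time.\<close>

definition Camassa_Holm ::
    "real set \<Rightarrow> (real \<Rightarrow> real \<Rightarrow> real) \<Rightarrow> (real \<Rightarrow> real \<Rightarrow> real) \<Rightarrow> bool" where
  "Camassa_Holm S u v \<longleftrightarrow>
     (\<forall>t\<in>S. AE x in lebesgue.
        v t x + u t x * weak_deriv (u t) x =
        - weak_deriv (inv_Helmholtz (\<lambda>y. (u t y)\<^sup>2 + (1/2) * (weak_deriv (u t) y)\<^sup>2)) x)"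

end

theory Submission
  imports Defs
begin

text \<open>
  Put \<open>P = (1 - \<partial>\<^sub>x\<^sup>2)\<^sup>-\<^sup>1 (u\<^sup>2 + u\<^sub>x\<^sup>2 / 2)\<close>. The equation says that \<open>u\<close> is
  transported with velocity \<open>u\<close> up to the forcing \<open>- P\<^sub>x\<close>, and formally \<open>u\<^sub>x\<close> is transported
  with the same velocity up to the forcing \<open>u\<^sup>2 - u\<^sub>x\<^sup>2 / 2 - P\<close>. Let \<open>M\<close> bound \<open>\<bar>u\<bar>\<close> and
  \<open>\<bar>u\<^sub>x\<bar>\<close>. Three facts make the decay persist. The forcings are quadratic, so one factor can be
  estimated by \<open>M\<close> and the other by its decay. The Green function \<open>exp (- \<bar>x\<bar>) / 2\<close> decays
  faster than \<open>exp (- \<theta> * x)\<close> because \<open>\<theta> < 1\<close>, so the nonlocal term inherits the decay of its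
  source (\<open>weighted_inv_Helmholtz_bounds\<close>). Transport at speed at most \<open>M\<close> changes
  the weight \<open>exp (\<theta> * x)\<close> at a relative rate of at most \<open>M * \<theta>\<close>. Hence the weighted suprema of
  \<open>u\<close> and \<open>u\<^sub>x\<close> grow at most exponentially in time.

  The solution is too rough for this computation: \<open>u\<^sub>x\<close> is only bounded. Therefore \<open>u\<close> is replaced
  by its moving averages \<open>u\<^sup>k(x) = (1/k) \<integral> u\<close> over \<open>{x..x+k}\<close>, and \<open>u\<^sub>x\<close> by the quotients
  \<open>(u\<^sup>k(x + h) - u\<^sup>k(x)) / h\<close>. Both are differentiable in \<open>x\<close> and in \<open>t\<close>, since the time
  derivative in \<open>L2\<close> becomes a classical one after integration over an interval. Averaging commutes
  with the transport term up to \<open>M\<^sup>2 * k\<close>, because \<open>u\<close> is Lipschitz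
  (\<open>averaged_equation\<close>); this error vanishes as \<open>k\<close> tends to 0 with \<open>h\<close> fixed. Pointwise
  decay of \<open>u\<^sub>x\<close> is equivalent to decay of all quotients with step at most 1, by the fundamental
  theorem of calculus and Lebesgue differentiation.

  The suprema are controlled without following characteristics. At a maximum point of
  \<open>exp (- \<mu> * t) * w(x) * \<bar>v(t, x)\<bar>\<close> the \<open>x\<close>-derivative vanishes, which trades \<open>v\<^sub>x\<close> for
  \<open>- w' v / w\<close>, and the left-sided \<open>t\<close>-derivative is nonnegative; together they
  bound the maximum by the forcing (\<open>transport_maximum_principle\<close>). The weight
  \<open>w = 1 / (exp (- \<theta> * x) + \<epsilon> * exp (\<theta> * x))\<close> has logarithmic derivative at most \<open>\<theta>\<close>, vanishes at
  both ends, so that a maximum exists, and increases to \<open>exp (\<theta> * x)\<close> as \<open>\<epsilon>\<close> tends to 0. For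
  \<open>\<mu>\<close> large the maximum principle turns any weighted bound \<open>S\<close> into \<open>max K (S / 2)\<close>, where \<open>K\<close>
  comes from the initial data (\<open>weighted_bound_improve\<close>). Iterating this replaces Gronwall's
  inequality and requires no measurability of suprema in time; it yields the bound \<open>K\<close>,
  independent of \<open>\<epsilon>\<close>.
\<close>

section \<open>A smooth bump and plateau test functions\<close>

text \<open>
  The family of functions \<open>p(x) r\<^sup>n exp (- r)\<close> on \<open>(0, 1)\<close> with \<open>r = 1 / (x (1 - x))\<close>, extended by 0.
  It is closed under differentiation (\<open>bump_term_has_derivative\<close>), so all its members are smooth; the
  classical bump is the member with \<open>p = 1\<close> and \<open>n = 0\<close>.
\<close>

definition bump_term :: "real poly \<Rightarrow> nat \<Rightarrow> real \<Rightarrow> real" where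
  "bump_term p n x =
     (if 0 < x \<and> x < 1 then poly p x * inverse (x * (1 - x)) ^ n * exp (- inverse (x * (1 - x))) else 0)"

lemma power_mult_exp_minus_le_fact:
  fixes r :: real
  assumes "0 \<le> r"
  shows "r ^ n * exp (- r) \<le> fact n"
proof -
  have "(\<lambda>n. r ^ n /\<^sub>R fact n) sums exp r"
    by (rule exp_converges)
  then have "r ^ n /\<^sub>R fact n \<le> exp r"
    using assms sum_le_suminf[of "\<lambda>n. r ^ n /\<^sub>R fact n" "{n}"] by (simp add: sums_iff)
  then have "r ^ n \<le> fact n * exp r"
    by (simp add: divide_simps mult.commute)
  then show ?thesis
    by (simp add: exp_minus divide_simps)
qed

text \<open>
  The factor \<open>exp (- r)\<close> beats every power of \<open>r\<close>, in particular \<open>r\<^sup>n\<^sup>+\<^sup>2\<close>. Vanishing to second order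
  at both end points is what makes the extension by 0 differentiable there.
\<close>

lemma bump_term_quadratic_bound:
  "\<exists>C. \<forall>x. \<bar>bump_term p n x\<bar> \<le> C * x\<^sup>2 \<and> \<bar>bump_term p n x\<bar> \<le> C * (x - 1)\<^sup>2"
proof -
  have "bounded (poly p ` {0..1::real})"
    by (intro compact_imp_bounded compact_continuous_image continuous_intros) auto
  then obtain B where B: "\<And>x. x \<in> {0..1} \<Longrightarrow> \<bar>poly p x\<bar> \<le> B"
    unfolding bounded_iff real_norm_def by blast
  have B0: "0 \<le> B" using B[of 0] by auto
  define C where "C = B * fact (n + 2)"
  have C0: "0 \<le> C" unfolding C_def using B0 by simp
  have "\<bar>bump_term p n x\<bar> \<le> C * (x * (1 - x))\<^sup>2" if "0 < x" "x < 1" for x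
  proof -
    define r where "r = inverse (x * (1 - x))"
    have r: "0 < r" "(x * (1 - x)) * r = 1" using that by (simp_all add: r_def del: inverse_mult_distrib)
    have "\<bar>bump_term p n x\<bar> = \<bar>poly p x\<bar> * (r ^ n * exp (- r))"
      using that r unfolding bump_term_def r_def[symmetric] by (simp add: abs_mult)
    also have "r ^ n * exp (-r) = (r ^ (n+2) * exp (-r)) * (x * (1 - x))\<^sup>2"
    proof -
      have "(r ^ (n+2) * exp (-r)) * (x * (1 - x))\<^sup>2 = r ^ n * exp (-r) * ((x * (1 - x)) * r)\<^sup>2"
        by (simp only: power_add power_mult_distrib ac_simps)
      then show ?thesis using r by simp
    qed
    also have "\<bar>poly p x\<bar> * ((r ^ (n+2) * exp (-r)) * (x * (1 - x))\<^sup>2) \<le> B * (fact (n+2) * (x * (1 - x))\<^sup>2)"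
      using B[of x] that r B0 power_mult_exp_minus_le_fact[of r "n+2"]
      by (intro mult_mono mult_right_mono) auto
    finally show ?thesis by (simp add: C_def mult.assoc)
  qed
  moreover have "(x * (1 - x))\<^sup>2 \<le> x\<^sup>2" "(x * (1 - x))\<^sup>2 \<le> (x-1)\<^sup>2" if "0 < x" "x < 1" for x :: real
    using that by (auto simp: power2_commute[of x 1] intro!: power_mono mult_left_le mult_left_le_one_le)
  ultimately have "\<bar>bump_term p n x\<bar> \<le> C * x\<^sup>2 \<and> \<bar>bump_term p n x\<bar> \<le> C * (x - 1)\<^sup>2" for x
  proof (cases "0 < x \<and> x < 1")
    case True
    then show ?thesis
      using \<open>\<And>x. \<lbrakk>0 < x; x < 1\<rbrakk> \<Longrightarrow> \<bar>bump_term p n x\<bar> \<le> C * (x * (1 - x))\<^sup>2\<close>[of x]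
        mult_left_mono[OF _ C0] \<open>\<And>x. \<lbrakk>0 < x; x < 1\<rbrakk> \<Longrightarrow> (x * (1 - x))\<^sup>2 \<le> x\<^sup>2\<close>[of x]
         \<open>\<And>x. \<lbrakk>0 < x; x < 1\<rbrakk> \<Longrightarrow> (x * (1 - x))\<^sup>2 \<le> (x-1)\<^sup>2\<close>[of x]
      by (meson order_trans)
  next
    case False
    then show ?thesis using C0 by (auto simp: bump_term_def)
  qed
  then show ?thesis by blast
qed

lemma has_derivative_zero_of_quadratic_bound:
  fixes f :: "real \<Rightarrow> real"
  assumes "\<And>x. \<bar>f x\<bar> \<le> C * (x - a)\<^sup>2"
  shows "(f has_real_derivative 0) (at a)"
proof -
  have fa: "f a = 0" using assms[of a] by simp
  have "((\<lambda>h. f (a + h) / h) \<longlongrightarrow> 0) (at 0)"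
  proof (rule Lim_null_comparison)
    show "\<forall>\<^sub>F h in at 0. norm (f (a + h) / h) \<le> C * \<bar>h\<bar>"
      using assms[of "a + _"]
      by (auto simp: eventually_at_filter divide_simps power2_eq_square abs_mult mult.assoc intro!: always_eventually)
    show "((\<lambda>h. C * \<bar>h\<bar>) \<longlongrightarrow> 0) (at 0)"
      by (auto intro!: tendsto_eq_intros)
  qed
  then show ?thesis using fa by (simp add: DERIV_def)
qed

text \<open>
  The polynomial coefficient after one differentiation. Since \<open>r' = - (1 - 2x) r\<^sup>2\<close>, the exponent of
  \<open>r\<close> is raised by 2, and the missing powers of \<open>r\<close> are paid for by powers of \<open>x (1 - x)\<close>.
\<close>

definition bump_deriv_poly :: "real poly \<Rightarrow> nat \<Rightarrow> real poly" where
  "bump_deriv_poly p n =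
     pderiv p * [:0,1,-1:]^2 - smult (real n) (p * [:1,-2:] * [:0,1,-1:]) + p * [:1,-2:]"

lemma bump_term_has_derivative:
  "(bump_term p n has_real_derivative bump_term (bump_deriv_poly p n) (n + 2) x) (at x)"
proof -
  consider "x < 0" | "x = 0" | "0 < x \<and> x < 1" | "x = 1" | "1 < x" by linarith
  then show ?thesis
  proof cases
    case 1
    have "((\<lambda>x. 0) has_real_derivative 0) (at x)" by simp
    then have "(bump_term p n has_real_derivative 0) (at x)"
      by (rule has_field_derivative_transform_within_open[where S = "{..<0}"])
         (use 1 in \<open>auto simp: bump_term_def\<close>)
    then show ?thesis using 1 by (simp add: bump_term_def)
  next
    case 5
    have "((\<lambda>x. 0) has_real_derivative 0) (at x)" by simp
    then have "(bump_term p n has_real_derivative 0) (at x)"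
      by (rule has_field_derivative_transform_within_open[where S = "{1<..}"])
         (use 5 in \<open>auto simp: bump_term_def\<close>)
    then show ?thesis using 5 by (simp add: bump_term_def)
  next
    case 2
    obtain C where "\<And>x. \<bar>bump_term p n x\<bar> \<le> C * (x - 0)\<^sup>2"
      using bump_term_quadratic_bound[of p n] by auto
    from has_derivative_zero_of_quadratic_bound[OF this] have "(bump_term p n has_real_derivative 0) (at x)"
      using 2 by simp
    moreover have "bump_term (bump_deriv_poly p n) (n + 2) x = 0" using 2 by (simp add: bump_term_def)
    ultimately show ?thesis by simp
  next
    case 4
    obtain C where "\<And>x. \<bar>bump_term p n x\<bar> \<le> C * (x - 1)\<^sup>2"
      using bump_term_quadratic_bound[of p n] by auto
    from has_derivative_zero_of_quadratic_bound[OF this] have "(bump_term p n has_real_derivative 0) (at x)"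
      using 4 by simp
    moreover have "bump_term (bump_deriv_poly p n) (n + 2) x = 0" using 4 by (simp add: bump_term_def)
    ultimately show ?thesis by simp
  next
    case 3
    define s where "s = x * (1 - x)"
    define E where "E = exp (- inverse s)"
    have s: "s > 0" "s \<noteq> 0" using 3 by (auto simp: s_def)
    have ds: "((\<lambda>x. x * (1 - x)) has_real_derivative (1 - 2 * x)) (at x)"
      by (auto intro!: derivative_eq_intros)
    have dr: "((\<lambda>x. inverse (x * (1 - x))) has_real_derivative (- (1 - 2 * x) * inverse s ^ 2)) (at x)"
      by (rule DERIV_cong[OF DERIV_inverse_fun[OF ds]])
        (use s in \<open>simp_all add: s_def[symmetric] power2_eq_square left_diff_distrib\<close>)
    have "((\<lambda>x. poly p x * inverse (x * (1 - x)) ^ n * exp (- inverse (x * (1 - x)))) has_real_derivative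
        ((poly (pderiv p) x * inverse s ^ n + real n * (- (1 - 2 * x) * inverse s ^ 2 * inverse s ^ (n - Suc 0)) * poly p x) * E
         + (E * (- (- (1 - 2 * x) * inverse s ^ 2))) * (poly p x * inverse s ^ n))) (at x)"
      unfolding E_def s_def
      by (intro DERIV_mult poly_DERIV DERIV_power[OF dr[unfolded s_def]] DERIV_fun_exp DERIV_minus dr[unfolded s_def])
    moreover have "((poly (pderiv p) x * inverse s ^ n + real n * (- (1 - 2 * x) * inverse s ^ 2 * inverse s ^ (n - Suc 0)) * poly p x) * E
         + (E * (- (- (1 - 2 * x) * inverse s ^ 2))) * (poly p x * inverse s ^ n))
      = bump_term (bump_deriv_poly p n) (n + 2) x"
    proof -
      have pw: "inverse s ^ (n+2) * s\<^sup>2 = inverse s ^ n"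
        using s by (simp add: field_simps power2_eq_square)
      have pw2: "real n * (inverse s ^ (n+2) * s) = real n * (inverse s ^ 2 * inverse s ^ (n - Suc 0))"
        using s by (cases n) (simp_all add: field_simps power2_eq_square)
      have ps: "poly [:0,1,-1:] x = s" "poly [:1,-2:] x = 1 - 2 * x" by (simp_all add: s_def algebra_simps)
      have "bump_term (bump_deriv_poly p n) (n + 2) x
        = (poly (pderiv p) x * s\<^sup>2 - real n * (poly p x * (1 - 2 * x) * s) + poly p x * (1 - 2 * x)) * inverse s ^ (n+2) * E"
        using 3 unfolding bump_term_def bump_deriv_poly_def poly_add poly_diff poly_mult poly_power poly_smult ps
        by (simp add: s_def E_def)
      also have "\<dots> = poly (pderiv p) x * E * (inverse s ^ (n+2) * s\<^sup>2)
           - (poly p x * (1 - 2 * x)) * E * (real n * (inverse s ^ (n+2) * s)) + poly p x * (1 - 2 * x) * E * inverse s ^ (n + 2)"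
        by (simp add: algebra_simps)
      finally show ?thesis unfolding pw pw2 by (simp add: power_add power2_eq_square algebra_simps)
    qed
    ultimately have "((\<lambda>x. poly p x * inverse (x * (1 - x)) ^ n * exp (- inverse (x * (1 - x)))) has_real_derivative
      bump_term (bump_deriv_poly p n) (n + 2) x) (at x)" by simp
    then show ?thesis
      by (rule has_field_derivative_transform_within_open[where S = "{0<..<1}"])
         (use 3 in \<open>auto simp: bump_term_def\<close>)
  qed
qed

text \<open>
  Membership in a class of differentiable functions closed under differentiation passes to all
  iterated derivatives. This gives smoothness without rules for iterated derivatives of sums and
  compositions.
\<close>

lemma iterated_deriv_differentiable_of_closed_class:
  fixes f :: "real \<Rightarrow> real"
  assumes "f \<in> \<C>"
    and "\<And>f. f \<in> \<C> \<Longrightarrow> \<exists>g\<in>\<C>. \<forall>x. (f has_real_derivative g x) (at x)"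
  shows "(deriv ^^ n) f field_differentiable at x"
proof -
  have "(deriv ^^ n) f \<in> \<C>"
  proof (induction n)
    case (Suc n)
    then obtain g where g: "g \<in> \<C>" "\<And>x. ((deriv ^^ n) f has_real_derivative g x) (at x)"
      using assms(2) by blast
    then have "(deriv ^^ Suc n) f = g" by (auto simp: DERIV_imp_deriv)
    then show ?case using g by simp
  qed (use assms in simp)
  then show ?thesis using assms(2) field_differentiable_def by blast
qed

definition bump :: "real \<Rightarrow> real" where "bump = bump_term 1 0"
definition bump_mass :: real where "bump_mass = integral {0..1} bump"

lemma continuous_bump_term: "continuous_on S (bump_term p n)"
  using bump_term_has_derivative by (meson DERIV_continuous_on has_field_derivative_at_within)

lemma bump_nonneg: "0 \<le> bump x" by (simp add: bump_def bump_term_def)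

lemma bump_eq_0: "x \<le> 0 \<or> 1 \<le> x \<Longrightarrow> bump x = 0" by (auto simp: bump_def bump_term_def)

lemma bump_mass_pos: "0 < bump_mass"
proof -
  have c: "continuous_on {0..1} bump" unfolding bump_def by (rule continuous_bump_term)
  have "bump_mass \<noteq> 0"
  proof
    assume "bump_mass = 0"
    then have "(bump has_integral 0) (cbox 0 1)"
      using integrable_integral[OF integrable_continuous_interval[OF c]] by (simp add: bump_mass_def)
    then have "bump (1/2) = 0"
      using has_integral_0_cbox_imp_0[of 0 1 bump "1/2"] c bump_nonneg by auto
    then show False by (simp add: bump_def bump_term_def)
  qed
  moreover have "0 \<le> bump_mass" unfolding bump_mass_def
    using bump_nonneg integrable_continuous_interval[OF c] by (intro integral_nonneg) auto
  ultimately show ?thesis by simp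
qed

definition smooth_step :: "real \<Rightarrow> real" where
  "smooth_step x = integral {0..x} bump / bump_mass"

lemma smooth_step_eq_0: "x \<le> 0 \<Longrightarrow> smooth_step x = 0"
  by (cases "x = 0") (auto simp: smooth_step_def)

lemma bump_integrable: "bump integrable_on {a..b}"
  unfolding bump_def by (intro integrable_continuous_interval continuous_bump_term)

lemma smooth_step_eq_1: assumes "1 \<le> x" shows "smooth_step x = 1"
proof -
  have "integral {0..x} bump = integral {0..1} bump + integral {1..x} bump"
    using assms by (intro Henstock_Kurzweil_Integration.integral_combine[symmetric] bump_integrable) auto
  also have "integral {1..x} bump = integral {1..x} (\<lambda>x. 0)"
    by (intro Henstock_Kurzweil_Integration.integral_cong bump_eq_0) auto
  finally show ?thesis using bump_mass_pos by (simp add: smooth_step_def bump_mass_def)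
qed

lemma smooth_step_has_derivative:
  "(smooth_step has_real_derivative bump x / bump_mass) (at x)"
proof -
  \<comment> \<open>A base point to the left of both 0 and \<open>x\<close> turns \<open>smooth_step\<close> into an integral with fixed lower limit near \<open>x\<close>.\<close>
  define a where "a = min 0 x - 1"
  have "((\<lambda>y. integral {a..y} bump) has_real_derivative bump x) (at x within {a..x+1})"
    by (rule integral_has_real_derivative)
       (auto simp: bump_def continuous_bump_term a_def)
  moreover have "x \<in> interior {a..x+1}" by (auto simp: a_def)
  ultimately have "((\<lambda>y. integral {a..y} bump) has_real_derivative bump x) (at x)"
    by (metis at_within_interior)
  then have "((\<lambda>y. integral {a..y} bump / bump_mass) has_real_derivative bump x / bump_mass) (at x)"
    by (rule DERIV_cdivide)
  then show ?thesis
  proof (rule has_field_derivative_transform_within_open[where S = "{a<..}"])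
    fix y assume "y \<in> {a<..}"
    show "integral {a..y} bump / bump_mass = smooth_step y"
    proof (cases "0 \<le> y")
      case True
      have "integral {a..y} bump = integral {a..0} bump + integral {0..y} bump"
        using True by (intro Henstock_Kurzweil_Integration.integral_combine[symmetric] bump_integrable) (auto simp: a_def)
      also have "integral {a..0} bump = integral {a..0} (\<lambda>x. 0)"
        by (intro Henstock_Kurzweil_Integration.integral_cong bump_eq_0) auto
      finally show ?thesis by (simp add: smooth_step_def)
    next
      case False
      have "integral {a..y} bump = integral {a..y} (\<lambda>x. 0)"
        using False by (intro Henstock_Kurzweil_Integration.integral_cong bump_eq_0) auto
      then show ?thesis using False smooth_step_eq_0 by simp
    qed
  qed (auto simp: a_def)
qed

lemma smooth_step_bounds: "0 \<le> smooth_step x" "smooth_step x \<le> 1"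
proof -
  have mono: "smooth_step x \<le> smooth_step y" if "x \<le> y" for x y
    by (rule DERIV_nonneg_imp_nondecreasing[OF that])
       (use smooth_step_has_derivative bump_nonneg bump_mass_pos in \<open>meson divide_nonneg_pos\<close>)
  show "0 \<le> smooth_step x" using mono[of "min 0 x" x] smooth_step_eq_0[of "min 0 x"] by simp
  show "smooth_step x \<le> 1" using mono[of x "max 1 x"] smooth_step_eq_1[of "max 1 x"] by simp
qed

text \<open>
  A smooth approximation, from inside the space of test functions, of the indicator of \<open>{a<..b}\<close>.
\<close>

definition plateau :: "real \<Rightarrow> real \<Rightarrow> real \<Rightarrow> real \<Rightarrow> real" where
  "plateau \<epsilon> a b x = smooth_step ((x - a) / \<epsilon>) - smooth_step ((x - b) / \<epsilon>)"

lemma plateau_has_derivative: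
  assumes "\<epsilon> > 0"
  shows "(plateau \<epsilon> a b has_real_derivative
    (bump ((x - a) / \<epsilon>) - bump ((x - b) / \<epsilon>)) / (\<epsilon> * bump_mass)) (at x)"
proof -
  have d: "((\<lambda>x. (x - c) / \<epsilon>) has_real_derivative 1 / \<epsilon>) (at x)" for c
    using assms by (auto intro!: derivative_eq_intros)
  show ?thesis unfolding plateau_def[abs_def]
    using DERIV_diff[OF DERIV_chain2[OF smooth_step_has_derivative d[of a]] DERIV_chain2[OF smooth_step_has_derivative d[of b]]]
    by (rule DERIV_cong) (use assms bump_mass_pos in \<open>simp add: field_simps\<close>)
qed

lemma plateau_eq_0:
  assumes "\<epsilon> > 0" "a \<le> b" "x \<notin> {a..b+\<epsilon>}"
  shows "plateau \<epsilon> a b x = 0"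
proof (cases "x < a")
  case True
  then show ?thesis using assms by (simp add: plateau_def smooth_step_eq_0 divide_le_0_iff)
next
  case False
  then have "b + \<epsilon> < x" using assms by auto
  then show ?thesis using assms by (simp add: plateau_def smooth_step_eq_1 le_divide_eq)
qed

lemma test_function_plateau:
  assumes "\<epsilon> > 0" "a \<le> b"
  shows "test_function (plateau \<epsilon> a b)"
proof -
  \<comment> \<open>One class contains all derivatives of the plateau; the two translates always share the same coefficient.\<close>
  define \<C> where "\<C> = {\<lambda>x. c * (bump_term p n ((x - a) / \<epsilon>) - bump_term p n ((x - b) / \<epsilon>)) | c p n. True}"
  have closed: "\<exists>g\<in>\<C>. \<forall>x. (f has_real_derivative g x) (at x)" if fC: "f \<in> \<C>" for f
  proof -
    obtain c p n where f: "f = (\<lambda>x. c * (bump_term p n ((x - a) / \<epsilon>) - bump_term p n ((x - b) / \<epsilon>)))"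
      using fC unfolding \<C>_def by blast
    let ?q = "bump_term (bump_deriv_poly p n) (n + 2)"
    have d: "((\<lambda>x. (x - c) / \<epsilon>) has_real_derivative 1 / \<epsilon>) (at x)" for c x
      using assms by (auto intro!: derivative_eq_intros)
    have "(f has_real_derivative c / \<epsilon> * (?q ((x - a) / \<epsilon>) - ?q ((x - b) / \<epsilon>))) (at x)" for x
      unfolding f
      using DERIV_cmult[OF DERIV_diff[OF DERIV_chain2[OF bump_term_has_derivative d[of a]] DERIV_chain2[OF bump_term_has_derivative d[of b]]]]
      by (rule DERIV_cong) (simp add: field_simps diff_divide_distrib)
    moreover have "(\<lambda>x. c / \<epsilon> * (?q ((x - a) / \<epsilon>) - ?q ((x - b) / \<epsilon>))) \<in> \<C>"
      unfolding \<C>_def by blast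
    ultimately show ?thesis
      by (intro bexI[of _ "\<lambda>x. c / \<epsilon> * (?q ((x - a) / \<epsilon>) - ?q ((x - b) / \<epsilon>))"] allI)
  qed
  let ?g = "\<lambda>x. 1 / (\<epsilon> * bump_mass) * (bump_term 1 0 ((x - a) / \<epsilon>) - bump_term 1 0 ((x - b) / \<epsilon>))"
  have "?g \<in> \<C>" unfolding \<C>_def by blast
  moreover have "(plateau \<epsilon> a b has_real_derivative ?g x) (at x)" for x
    using plateau_has_derivative[OF assms(1), of a b x] by (simp add: bump_def)
  ultimately have "\<exists>g\<in>\<C>. \<forall>x. (plateau \<epsilon> a b has_real_derivative g x) (at x)"
    by (intro bexI[of _ ?g] allI)
  then have "(deriv ^^ n) (plateau \<epsilon> a b) field_differentiable at x" for n x
    by (intro iterated_deriv_differentiable_of_closed_class[where \<C> = "insert (plateau \<epsilon> a b) \<C>"])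
       (use closed in blast)+
  moreover have "{x. plateau \<epsilon> a b x \<noteq> 0} \<subseteq> {a..b+\<epsilon>}"
    using plateau_eq_0[OF assms] by blast
  then have "compact (closure {x. plateau \<epsilon> a b x \<noteq> 0})"
    using bounded_subset[OF bounded_closed_interval] by (auto simp: compact_closure)
  ultimately show ?thesis unfolding test_function_def by blast
qed


section \<open>Weak derivatives of continuous functions\<close>

lemma borel_measurable_lebesgue_of_continuous:
  "continuous_on UNIV f \<Longrightarrow> f \<in> borel_measurable lebesgue" for f :: "real \<Rightarrow> real"
  by (intro measurable_completion) (simp add: borel_measurable_continuous_onI)

lemma lebesgue_integral_of_interval_support:
  fixes h :: "real \<Rightarrow> real"
  assumes "continuous_on {c..d} h" "\<And>x. x \<notin> {c..d} \<Longrightarrow> h x = 0"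
  shows "integrable lebesgue h" "(LINT x|lebesgue. h x) = integral {c..d} h"
proof -
  have s: "set_integrable lebesgue {c..d} h"
    using assms(1) by (rule absolutely_integrable_continuous_real)
  have eq: "(\<lambda>x. indicator {c..d} x *\<^sub>R h x) = h"
  proof
    fix x show "indicator {c..d} x *\<^sub>R h x = h x"
      using assms(2)[of x] by (cases "x \<in> {c..d}") simp_all
  qed
  show "integrable lebesgue h" using s unfolding set_integrable_def eq .
  show "(LINT x|lebesgue. h x) = integral {c..d} h"
    using set_lebesgue_integral_eq_integral(2)[OF s] by (simp only: set_lebesgue_integral_def eq)
qed

text \<open>
  The approximate identity supported in \<open>{0..\<epsilon>}\<close>; the derivative of \<open>plateau \<epsilon> a b\<close> is its
  translate to \<open>a\<close> minus its translate to \<open>b\<close>.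
\<close>

definition mollifier :: "real \<Rightarrow> real \<Rightarrow> real" where
  "mollifier \<epsilon> x = bump (x / \<epsilon>) / (\<epsilon> * bump_mass)"

lemma mollifier_nonneg: "0 < \<epsilon> \<Longrightarrow> 0 \<le> mollifier \<epsilon> x"
  using bump_mass_pos by (simp add: mollifier_def bump_nonneg)

lemma mollifier_eq_0: "0 < \<epsilon> \<Longrightarrow> x \<notin> {0..\<epsilon>} \<Longrightarrow> mollifier \<epsilon> x = 0"
  using bump_eq_0[of "x / \<epsilon>"] by (auto simp: mollifier_def divide_le_0_iff le_divide_eq)

lemma continuous_mollifier: "0 < \<epsilon> \<Longrightarrow> continuous_on S (\<lambda>x. mollifier \<epsilon> (x - a))"
  unfolding mollifier_def bump_def using bump_mass_pos
  by (intro continuous_intros continuous_on_compose2[OF continuous_bump_term[of UNIV]]) auto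

lemma mollifier_has_integral_1:
  assumes "0 < \<epsilon>"
  shows "((\<lambda>x. mollifier \<epsilon> (x - a)) has_integral 1) {a..a+\<epsilon>}"
proof -
  have d: "((\<lambda>x. (x - a) / \<epsilon>) has_real_derivative 1 / \<epsilon>) (at x)" for x
    using assms by (auto intro!: derivative_eq_intros)
  have "((\<lambda>x. smooth_step ((x - a) / \<epsilon>)) has_real_derivative mollifier \<epsilon> (x - a)) (at x)" for x
    by (rule DERIV_cong[OF DERIV_chain2[OF smooth_step_has_derivative d]])
       (use assms bump_mass_pos in \<open>simp add: mollifier_def field_simps\<close>)
  then have "((\<lambda>x. mollifier \<epsilon> (x - a)) has_integral smooth_step ((a + \<epsilon> - a) / \<epsilon>) - smooth_step ((a - a) / \<epsilon>)) {a..a+\<epsilon>}"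
    using assms
    by (intro fundamental_theorem_of_calculus)
       (auto simp: has_real_derivative_iff_has_vector_derivative[symmetric] intro: has_field_derivative_at_within)
  then show ?thesis using assms by (simp add: smooth_step_eq_0 smooth_step_eq_1)
qed

lemma mollifier_integral_tendsto:
  assumes f: "continuous_on UNIV (f :: real \<Rightarrow> real)"
  shows "\<And>\<epsilon>. 0 < \<epsilon> \<Longrightarrow> integrable lebesgue (\<lambda>x. f x * mollifier \<epsilon> (x - a))"
    and "((\<lambda>\<epsilon>. LINT x|lebesgue. f x * mollifier \<epsilon> (x - a)) \<longlongrightarrow> f a) (at_right 0)"
proof -
  have c: "continuous_on {a..a+\<epsilon>} (\<lambda>x. f x * mollifier \<epsilon> (x - a))" if "0 < \<epsilon>" for \<epsilon>
    using continuous_mollifier[OF that] continuous_on_subset[OF f] by (intro continuous_on_mult) auto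
  have z: "f x * mollifier \<epsilon> (x - a) = 0" if "0 < \<epsilon>" "x \<notin> {a..a+\<epsilon>}" for x \<epsilon>
    using mollifier_eq_0[of \<epsilon> "x - a"] that by auto
  show "integrable lebesgue (\<lambda>x. f x * mollifier \<epsilon> (x - a))" if "0 < \<epsilon>" for \<epsilon>
    by (rule lebesgue_integral_of_interval_support(1)[OF c z]) (use that in auto)
  show "((\<lambda>\<epsilon>. LINT x|lebesgue. f x * mollifier \<epsilon> (x - a)) \<longlongrightarrow> f a) (at_right 0)"
  proof (rule tendstoI)
    fix e :: real assume "0 < e"
    then have "0 < e / 2" by simp
    with f obtain d where "d > 0" and d': "\<forall>x. dist x a < d \<longrightarrow> dist (f x) (f a) < e / 2"
      unfolding continuous_on_iff by (meson UNIV_I)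
    then have d: "d > 0" "\<And>x. \<bar>x - a\<bar> < d \<Longrightarrow> \<bar>f x - f a\<bar> < e / 2"
      by (auto simp: dist_real_def)
    have "dist (LINT x|lebesgue. f x * mollifier \<epsilon> (x - a)) (f a) < e" if eps: "0 < \<epsilon>" "\<epsilon> < d" for \<epsilon>
    proof -
      note m = mollifier_has_integral_1[OF eps(1), of a]
      have i: "(\<lambda>x. f x * mollifier \<epsilon> (x - a)) integrable_on {a..a+\<epsilon>}"
        by (rule integrable_continuous_interval[OF c[OF eps(1)]])
      have "(LINT x|lebesgue. f x * mollifier \<epsilon> (x - a)) - f a
         = integral {a..a+\<epsilon>} (\<lambda>x. f x * mollifier \<epsilon> (x - a)) - integral {a..a+\<epsilon>} (\<lambda>x. f a * mollifier \<epsilon> (x - a))"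
        using integral_unique[OF has_integral_mult_right[OF m, of "f a"]]
          lebesgue_integral_of_interval_support(2)[OF c z] eps by simp
      also have "\<dots> = integral {a..a+\<epsilon>} (\<lambda>x. f x * mollifier \<epsilon> (x - a) - f a * mollifier \<epsilon> (x - a))"
        using has_integral_integrable[OF has_integral_mult_right[OF m, of "f a"]]
        by (intro Henstock_Kurzweil_Integration.integral_diff[symmetric] i) auto
      also have "\<bar>\<dots>\<bar> \<le> integral {a..a+\<epsilon>} (\<lambda>x. (e / 2) * mollifier \<epsilon> (x - a))"
      proof (rule integral_norm_bound_integral[where 'a = real, unfolded real_norm_def])
        show "\<bar>f x * mollifier \<epsilon> (x - a) - f a * mollifier \<epsilon> (x - a)\<bar> \<le> e / 2 * mollifier \<epsilon> (x - a)"
          if "x \<in> {a..a+\<epsilon>}" for x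
        proof -
          have "\<bar>f x - f a\<bar> \<le> e / 2" using d(2)[of x] that eps by auto
          then have "\<bar>f x - f a\<bar> * mollifier \<epsilon> (x - a) \<le> e / 2 * mollifier \<epsilon> (x - a)"
            using mollifier_nonneg[OF eps(1)] by (rule mult_right_mono)
          then show ?thesis
            using mollifier_nonneg[OF eps(1), of "x - a"] by (simp add: left_diff_distrib[symmetric] abs_mult)
        qed
      qed (use has_integral_integrable[OF has_integral_mult_right[OF m]] i in \<open>auto intro!: Henstock_Kurzweil_Integration.integrable_diff\<close>)
      also have "\<dots> = e / 2" using integral_unique[OF has_integral_mult_right[OF m, of "e/2"]] by simp
      finally show ?thesis using \<open>0 < e\<close> by (simp add: dist_real_def)
    qed
    then show "\<forall>\<^sub>F \<epsilon> in at_right 0. dist (LINT x|lebesgue. f x * mollifier \<epsilon> (x - a)) (f a) < e"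
      using d(1) by (auto simp: eventually_at_right_field)
  qed
qed

lemma plateau_abs_le_1: "\<bar>plateau \<epsilon> a b x\<bar> \<le> 1"
  using smooth_step_bounds[of "(x - a) / \<epsilon>"] smooth_step_bounds[of "(x - b) / \<epsilon>"]
  by (simp add: plateau_def)

lemma plateau_tendsto_indicator:
  assumes "a \<le> b"
  shows "((\<lambda>\<epsilon>. plateau \<epsilon> a b x) \<longlongrightarrow> indicator {a<..b} x) (at_right 0)"
proof -
  have step: "((\<lambda>\<epsilon>. smooth_step ((x - c) / \<epsilon>)) \<longlongrightarrow> (if c < x then 1 else 0)) (at_right 0)" for c
  proof (rule tendsto_eventually)
    show "\<forall>\<^sub>F \<epsilon> in at_right 0. smooth_step ((x - c) / \<epsilon>) = (if c < x then 1 else 0)"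
      unfolding eventually_at_right_field
      by (intro exI[of _ "if c < x then x - c else 1"])
         (auto simp: smooth_step_eq_1 smooth_step_eq_0 le_divide_eq divide_le_0_iff)
  qed
  show ?thesis unfolding plateau_def
    by (rule tendsto_eq_rhs[OF tendsto_diff[OF step[of a] step[of b]]]) (use assms in \<open>auto simp: indicator_def\<close>)
qed

text \<open>
  The fundamental theorem of calculus for weak derivatives. Testing with \<open>plateau \<epsilon> a b\<close> and letting
  \<open>\<epsilon>\<close> tend to 0 sends the left-hand side of the definition to \<open>f a - f b\<close>, by continuity of \<open>f\<close>, and
  the right-hand side to minus the integral of \<open>g\<close>, by dominated convergence.
\<close>

theorem weak_deriv_has_integral:
  assumes w: "has_weak_deriv f g" and f: "continuous_on UNIV f" and ab: "a \<le> b"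
  shows "(g has_integral (f b - f a)) {a..b}"
proof -
  have gi: "set_integrable lebesgue {a..b+1} g"
    using w unfolding has_weak_deriv_def locally_integrable_def by blast
  have g1: "set_integrable lebesgue {a..b} g" "set_integrable lebesgue {a<..b} g"
    using gi by (auto intro: set_integrable_subset)
  define eps where "eps n = inverse (real (Suc n))" for n
  have eps: "0 < eps n" "eps n \<le> 1" for n by (auto simp: eps_def inverse_le_1_iff)
  have lim: "filterlim eps (at_right 0) sequentially"
    using LIMSEQ_inverse_real_of_nat eps(1)
    by (auto simp: filterlim_at eps_def[abs_def])
  have eq: "(LINT x|lebesgue. f x * mollifier (eps n) (x - a)) - (LINT x|lebesgue. f x * mollifier (eps n) (x - b))
      = - (LINT x|lebesgue. g x * plateau (eps n) a b x)" for n
  proof -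
    have "deriv (plateau (eps n) a b) x = mollifier (eps n) (x - a) - mollifier (eps n) (x - b)" for x
      using DERIV_imp_deriv[OF plateau_has_derivative[OF eps(1)]]
      by (simp add: mollifier_def diff_divide_distrib)
    then have "(LINT x|lebesgue. f x * mollifier (eps n) (x - a) - f x * mollifier (eps n) (x - b))
       = - (LINT x|lebesgue. g x * plateau (eps n) a b x)"
      using w[unfolded has_weak_deriv_def, THEN conjunct2, THEN conjunct2, rule_format,
          OF test_function_plateau[OF eps(1)[of n] ab]]
      by (simp add: right_diff_distrib)
    then show ?thesis
      using mollifier_integral_tendsto(1)[OF f eps(1)] by simp
  qed
  have L1: "(\<lambda>n. (LINT x|lebesgue. f x * mollifier (eps n) (x - a)) - (LINT x|lebesgue. f x * mollifier (eps n) (x - b)))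
     \<longlonglongrightarrow> f a - f b"
    by (intro tendsto_diff filterlim_compose[OF mollifier_integral_tendsto(2)[OF f] lim])
  have gm: "(\<lambda>x. indicator {a..b+1} x * g x) \<in> borel_measurable lebesgue"
    using borel_measurable_integrable[OF gi[unfolded set_integrable_def]] by simp
  have L2: "(\<lambda>n. LINT x|lebesgue. g x * plateau (eps n) a b x) \<longlonglongrightarrow> (LINT x|lebesgue. indicator {a<..b} x * g x)"
  proof (rule integral_dominated_convergence)
    show "integrable lebesgue (\<lambda>x. \<bar>indicator {a..b+1} x * g x\<bar>)"
      using gi unfolding set_integrable_def by (intro integrable_abs) simp
    show "(\<lambda>x. indicator {a<..b} x * g x) \<in> borel_measurable lebesgue"
      using g1(2) unfolding set_integrable_def by (simp add: borel_measurable_integrable)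
    have e: "g x * plateau (eps n) a b x = (indicator {a..b+1} x * g x) * plateau (eps n) a b x" for n x
    proof (cases "x \<in> {a..b+1}")
      case False
      then have "x \<notin> {a..b+eps n}" using eps(2)[of n] by auto
      then show ?thesis using plateau_eq_0[OF eps(1) ab] by simp
    qed simp
    have pm: "plateau (eps n) a b \<in> borel_measurable lebesgue" for n
      by (intro borel_measurable_lebesgue_of_continuous DERIV_continuous_on[OF has_field_derivative_at_within[OF plateau_has_derivative[OF eps(1)]]])
    show "(\<lambda>x. g x * plateau (eps n) a b x) \<in> borel_measurable lebesgue" for n
      unfolding e using gm pm by (rule borel_measurable_times)
    show "AE x in lebesgue. norm (g x * plateau (eps n) a b x) \<le> \<bar>indicator {a..b+1} x * g x\<bar>" for n
      unfolding e using plateau_abs_le_1[of "eps n" a b]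
      by (intro AE_I2) (simp add: abs_mult mult_left_le)
    show "AE x in lebesgue. (\<lambda>n. g x * plateau (eps n) a b x) \<longlonglongrightarrow> indicator {a<..b} x * g x"
      by (intro AE_I2 tendsto_eq_rhs[OF tendsto_mult[OF tendsto_const filterlim_compose[OF plateau_tendsto_indicator[OF ab] lim]]])
        (rule mult.commute)
  qed
  have "f a - f b = - (LINT x|lebesgue. indicator {a<..b} x * g x)"
    using LIMSEQ_unique[OF L1] tendsto_minus[OF L2] unfolding eq by blast
  also have "(LINT x|lebesgue. indicator {a<..b} x * g x) = integral {a<..b} g"
    using set_lebesgue_integral_eq_integral(2)[OF g1(2)] by (simp add: set_lebesgue_integral_def)
  also have "\<dots> = integral {a..b} g"
    by (rule integral_spike_set) (auto intro: negligible_subset[of "{a}"])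
  finally have "integral {a..b} g = f b - f a" by simp
  moreover have "g integrable_on {a..b}" using set_lebesgue_integral_eq_integral(1)[OF g1(1)] .
  ultimately show ?thesis using integrable_integral by metis
qed

text \<open>
  Lebesgue's differentiation theorem: almost every \<open>g x\<close> is the limit of its means over
  \<open>{x..x+h}\<close>. The bound \<open>c\<close> is compared only at the left end point and may be any function.
\<close>

lemma AE_bound_of_interval_means:
  fixes g :: "real \<Rightarrow> real"
  assumes g: "\<And>a b. g integrable_on {a..b}"
    and le: "\<And>x h. 0 < h \<Longrightarrow> h \<le> 1 \<Longrightarrow> \<bar>integral {x..x+h} g\<bar> \<le> h * c x"
  shows "AE x in lebesgue. \<bar>g x\<bar> \<le> c x"
proof -
  obtain N where N: "negligible N"
    "\<And>x e. \<lbrakk>x \<notin> N; 0 < e\<rbrakk> \<Longrightarrow> \<exists>d>0. \<forall>h. 0 < h \<and> h < d \<longrightarrow>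
       norm (integral (cbox x (x + h *\<^sub>R One)) g /\<^sub>R h ^ DIM(real) - g x) < e"
    using integrable_ccontinuous_explicit[of g] g by (metis cbox_interval)
  have "\<bar>g x\<bar> \<le> c x" if "x \<notin> N" for x
  proof (rule field_le_epsilon)
    fix e :: real assume "0 < e"
    from N(2)[OF that this] obtain d where d: "d > 0"
        "\<And>h. 0 < h \<Longrightarrow> h < d \<Longrightarrow> norm (integral (cbox x (x + h *\<^sub>R One)) g /\<^sub>R h ^ DIM(real) - g x) < e"
      by blast
    have d2: "\<bar>integral {x..x + h} g / h - g x\<bar> < e" if "0 < h" "h < d" for h
      using d(2)[OF that] by (simp add: divide_inverse mult.commute)
    define h where "h = min (d / 2) 1"
    have h: "0 < h" "h < d" "h \<le> 1" using d by (auto simp: h_def)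
    have "\<bar>integral {x..x + h} g / h\<bar> \<le> c x"
      using le[of h x] h by (simp add: field_simps)
    then show "\<bar>g x\<bar> \<le> c x + e" using d2[OF h(1,2)] by linarith
  qed
  moreover have "N \<in> null_sets lebesgue" using N(1) by (simp add: negligible_iff_null_sets)
  ultimately show ?thesis by (intro AE_I'[of N]) auto
qed

text \<open>
  Integration by parts on an interval that contains the support of the test function in its
  interior, so that the boundary terms vanish.
\<close>

lemma has_weak_deriv_of_C1:
  assumes F: "\<And>x. (F has_real_derivative F' x) (at x)" and F': "continuous_on UNIV F'"
  shows "has_weak_deriv F F'"
proof -
  have loc: "locally_integrable h" if "continuous_on UNIV h" for h :: "real \<Rightarrow> real"
    unfolding locally_integrable_def
  proof (intro allI impI)
    fix K :: "real set" assume "compact K"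
    then have "bounded K" by (rule compact_imp_bounded)
    then obtain a where "K \<subseteq> cbox (-a) a" by (rule bounded_subset_cbox_symmetric)
    moreover have "set_integrable lebesgue (cbox (-a) a) h"
      unfolding cbox_interval by (intro absolutely_integrable_continuous_real continuous_on_subset[OF that] subset_UNIV)
    ultimately show "set_integrable lebesgue K h"
      using fmeasurableD[OF lmeasurable_compact[OF \<open>compact K\<close>]] by (rule_tac set_integrable_subset)
  qed
  have cF: "continuous_on UNIV F" using F by (meson DERIV_continuous_on has_field_derivative_at_within)
  have "(LINT x|lebesgue. F x * deriv \<phi> x) = - (LINT x|lebesgue. F' x * \<phi> x)" if t: "test_function \<phi>" for \<phi>
  proof -
    have d0: "((deriv ^^ n) \<phi> has_real_derivative (deriv ^^ Suc n) \<phi> x) (at x)" for n x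
      using t unfolding test_function_def by (auto intro: field_differentiable_derivI)
    have d: "(\<phi> has_real_derivative deriv \<phi> x) (at x)" "(deriv \<phi> has_real_derivative (deriv ^^ 2) \<phi> x) (at x)" for x
      using d0[of 0 x] d0[of 1 x] by (simp_all add: numeral_2_eq_2)
    have c: "continuous_on UNIV \<phi>" "continuous_on UNIV (deriv \<phi>)"
      using d by (meson DERIV_continuous_on has_field_derivative_at_within)+
    have "bounded (closure {x. \<phi> x \<noteq> 0})"
      using t unfolding test_function_def by (intro compact_imp_bounded) blast
    then obtain R where "closure {x. \<phi> x \<noteq> 0} \<subseteq> cbox (-R) R" by (rule bounded_subset_cbox_symmetric)
    then have R: "\<phi> x = 0" if "x \<notin> {-R..R}" for x
      using that closure_subset[of "{x. \<phi> x \<noteq> 0}"] by auto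
    have R': "deriv \<phi> x = 0" if "x \<notin> {-R..R}" for x
    proof (rule DERIV_imp_deriv)
      have "((\<lambda>x. 0) has_real_derivative 0) (at x)" by simp
      then show "(\<phi> has_real_derivative 0) (at x)"
        by (rule has_field_derivative_transform_within_open[where S = "- {-R..R}"])
           (use that R in \<open>auto simp: open_Compl\<close>)
    qed
    define S where "S = \<bar>R\<bar> + 1"
    have S: "-S \<le> S" "\<And>x. x \<notin> {-S..S} \<Longrightarrow> x \<notin> {-R..R}" "S \<notin> {-R..R}" "-S \<notin> {-R..R}"
      by (auto simp: S_def)
    have 1: "(LINT x|lebesgue. F x * deriv \<phi> x) = integral {-S..S} (\<lambda>x. F x * deriv \<phi> x)"
      by (rule lebesgue_integral_of_interval_support(2))
         (use R' S(2) continuous_on_subset[OF c(2)] continuous_on_subset[OF cF] in \<open>auto intro!: continuous_on_mult\<close>)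
    have 2: "(LINT x|lebesgue. F' x * \<phi> x) = integral {-S..S} (\<lambda>x. F' x * \<phi> x)"
      by (rule lebesgue_integral_of_interval_support(2))
         (use R S(2) continuous_on_subset[OF c(1)] continuous_on_subset[OF F'] in \<open>auto intro!: continuous_on_mult\<close>)
    have "((\<lambda>x. F' x * \<phi> x + F x * deriv \<phi> x) has_integral (F S * \<phi> S - F (-S) * \<phi> (-S))) {-S..S}"
    proof (rule fundamental_theorem_of_calculus[OF S(1)])
      fix x
      show "((\<lambda>x. F x * \<phi> x) has_vector_derivative F' x * \<phi> x + F x * deriv \<phi> x) (at x within {- S..S})"
        unfolding has_real_derivative_iff_has_vector_derivative[symmetric]
        by (rule has_field_derivative_at_within, rule DERIV_cong[OF DERIV_mult[OF F d(1)]]) (simp add: algebra_simps)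
    qed
    then have "integral {-S..S} (\<lambda>x. F' x * \<phi> x + F x * deriv \<phi> x) = 0"
      using R[OF S(3)] R[OF S(4)] by (simp add: integral_unique)
    moreover have "integral {-S..S} (\<lambda>x. F' x * \<phi> x + F x * deriv \<phi> x)
       = integral {-S..S} (\<lambda>x. F' x * \<phi> x) + integral {-S..S} (\<lambda>x. F x * deriv \<phi> x)"
      by (intro Henstock_Kurzweil_Integration.integral_add integrable_continuous_interval continuous_on_mult)
         (use continuous_on_subset[OF c(1)] continuous_on_subset[OF c(2)] continuous_on_subset[OF F'] continuous_on_subset[OF cF] in auto)
    ultimately show ?thesis using 1 2 by simp
  qed
  then show ?thesis unfolding has_weak_deriv_def using loc[OF cF] loc[OF F'] by blast
qed


section \<open>The Green function of the Helmholtz operator\<close>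

lemma has_bochner_integral_exp_abs:
  fixes x c :: real
  assumes "0 < c"
  shows "has_bochner_integral lebesgue (\<lambda>y. exp (- c * \<bar>x - y\<bar>)) (2 / c)"
proof -
  have nn: "(\<integral>\<^sup>+y. ennreal (exp (- c * y)) * indicator {0..} y \<partial>lborel) = 0 - (- exp (- c * 0) / c)"
  proof (rule nn_integral_FTC_atLeast)
    show "((\<lambda>y. - exp (- c * y) / c) has_real_derivative exp (- c * y)) (at y)" for y
      using assms by (auto intro!: derivative_eq_intros)
    have "filterlim (\<lambda>y. - c * y) at_bot at_top"
      using assms by (intro filterlim_tendsto_neg_mult_at_bot[OF tendsto_const]) (auto simp: filterlim_ident)
    then have "((\<lambda>y. exp (- c * y)) \<longlongrightarrow> 0) at_top"
      by (rule filterlim_compose[OF exp_at_bot])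
    from tendsto_divide[OF tendsto_minus[OF this] tendsto_const[of c]]
    show "((\<lambda>y. - exp (- c * y) / c) \<longlongrightarrow> 0) at_top" using assms by simp
  qed auto
  have "has_bochner_integral lborel (\<lambda>y. indicator {0..} y *\<^sub>R exp (- c * \<bar>y\<bar>)) (1 / c)"
  proof (rule has_bochner_integral_nn_integral)
    have "(\<integral>\<^sup>+y. ennreal (indicator {0..} y *\<^sub>R exp (- c * \<bar>y\<bar>)) \<partial>lborel)
       = (\<integral>\<^sup>+y. ennreal (exp (- c * y)) * indicator {0..} y \<partial>lborel)"
      by (intro nn_integral_cong) (auto simp: indicator_def)
    then show "(\<integral>\<^sup>+y. ennreal (indicator {0..} y *\<^sub>R exp (- c * \<bar>y\<bar>)) \<partial>lborel) = ennreal (1 / c)"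
      using nn by simp
  qed (use assms in auto)
  then have "has_bochner_integral lborel (\<lambda>y. exp (- c * \<bar>y\<bar>)) (2 *\<^sub>R (1 / c))"
    by (rule has_bochner_integral_even_function) simp
  then have "has_bochner_integral lborel (\<lambda>y. exp (- c * \<bar>x + (-1) * y\<bar>)) (2 / c)"
    by (subst (asm) lborel_has_bochner_integral_real_affine_iff[where c = "-1" and t = x]) simp_all
  then show ?thesis
    by (auto simp: has_bochner_integral_iff integrable_completion integral_completion)
qed

lemma exp_minus_abs_shift:
  fixes a k :: real
  assumes "0 \<le> k"
  shows "\<bar>exp (- \<bar>a + k\<bar>) - exp (- \<bar>a\<bar>)\<bar> \<le> k * exp k * exp (- \<bar>a\<bar>)"
proof -
  have 1: "exp (- \<bar>a + k\<bar>) \<le> exp k * exp (- \<bar>a\<bar>)"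
    using assms by (simp add: exp_add[symmetric])
  have 2: "exp (- \<bar>a\<bar>) \<le> exp k * exp (- \<bar>a + k\<bar>)"
    using assms by (simp add: exp_add[symmetric])
  have e: "exp k - 1 \<le> k * exp k"
    using exp_ge_add_one_self[of "- k"] by (simp add: exp_minus field_simps)
  have "exp (- \<bar>a + k\<bar>) - exp (- \<bar>a\<bar>) \<le> (exp k - 1) * exp (- \<bar>a\<bar>)"
    using 1 by (simp add: algebra_simps)
  also have "\<dots> \<le> k * exp k * exp (- \<bar>a\<bar>)" using e by (intro mult_right_mono) auto
  finally have A: "exp (- \<bar>a + k\<bar>) - exp (- \<bar>a\<bar>) \<le> k * exp k * exp (- \<bar>a\<bar>)" .
  have "exp (- \<bar>a\<bar>) - exp (- \<bar>a + k\<bar>) \<le> (1 - exp (-k)) * exp (- \<bar>a\<bar>)"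
    using 2 by (simp add: exp_minus field_simps)
  also have "\<dots> \<le> k * exp k * exp (- \<bar>a\<bar>)"
  proof (rule mult_right_mono)
    have "1 - exp (-k) \<le> k" using exp_ge_add_one_self[of "- k"] by simp
    also have "k \<le> k * exp k" using assms by (simp add: mult_le_cancel_left1)
    finally show "1 - exp (-k) \<le> k * exp k" .
  qed simp
  finally show ?thesis using A by (simp add: abs_le_iff)
qed

text \<open>
  Away from 0 the kernel solves \<open>G'' = G\<close>, which makes the second difference of size \<open>h * k\<close>. When
  the kink at 0 lies between \<open>z\<close> and \<open>z + h + k\<close> only a first difference of size \<open>k\<close> is gained, but
  this happens on a set of length at most \<open>2 * h\<close>, so that the integral over \<open>z\<close> is of size \<open>h * k\<close>
  again.
\<close>

lemma exp_minus_abs_second_difference: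
  fixes z h k :: real
  assumes "0 < k" "k \<le> h" "h \<le> 1"
  shows "\<bar>exp (- \<bar>z + h + k\<bar>) - exp (- \<bar>z + h\<bar>) - exp (- \<bar>z + k\<bar>) + exp (- \<bar>z\<bar>)\<bar>
     \<le> exp 2 * (h * k + 2 * k * indicator {-2*h..0} z) * exp (- \<bar>z\<bar>)" (is "\<bar>?D\<bar> \<le> _")
proof -
  have e: "exp t - 1 \<le> t * exp t" "1 - exp (-t) \<le> t" for t :: real
    using exp_ge_add_one_self[of "- t"] by (simp_all add: exp_minus field_simps)
  have ex1: "exp h * exp k \<le> exp (2::real)" using assms by (simp add: exp_add[symmetric])
  have "1 * 1 \<le> exp h * exp k" using assms by (intro mult_mono) auto
  then have ex0: "1 \<le> exp (2::real)" using ex1 by linarith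
  have base: "h * k * exp (- \<bar>z\<bar>) \<le> exp 2 * (h * k) * exp (- \<bar>z\<bar>)"
    using assms mult_right_mono[OF ex0, of "h * k"] by (intro mult_right_mono) auto
  consider "0 \<le> z" | "z \<le> - h - k" | "- h - k < z" "z < 0" by linarith
  then show ?thesis
  proof cases
    case 1
    have "?D = exp (- z) * ((1 - exp (-h)) * (1 - exp (-k)))"
      using 1 assms by (simp add: exp_add exp_diff exp_minus field_simps)
    moreover have "0 \<le> (1 - exp (-h)) * (1 - exp (-k))" "(1 - exp (-h)) * (1 - exp (-k)) \<le> h * k"
      using assms e by (auto intro!: mult_mono mult_nonneg_nonneg)
    ultimately have "\<bar>?D\<bar> \<le> h * k * exp (- \<bar>z\<bar>)"
      using 1 by (simp add: abs_mult mult.commute mult_right_mono)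
    also note base
    also have "exp 2 * (h * k) * exp (- \<bar>z\<bar>) \<le> exp 2 * (h * k + 2 * k * indicator {-2*h..0} z) * exp (- \<bar>z\<bar>)"
      using assms by (intro mult_right_mono mult_left_mono) auto
    finally show ?thesis .
  next
    case 2
    have "?D = exp z * ((exp h - 1) * (exp k - 1))"
      using 2 assms by (simp add: exp_add exp_diff exp_minus field_simps)
    moreover have "0 \<le> (exp h - 1) * (exp k - 1)" using assms by (intro mult_nonneg_nonneg) auto
    moreover have "(exp h - 1) * (exp k - 1) \<le> (h * exp h) * (k * exp k)"
      using assms e by (intro mult_mono) auto
    moreover have "(h * exp h) * (k * exp k) \<le> exp 2 * (h * k)"
      using mult_right_mono[OF ex1, of "h * k"] assms by (simp add: ac_simps)
    ultimately have "0 \<le> (exp h - 1) * (exp k - 1)" "(exp h - 1) * (exp k - 1) \<le> exp 2 * (h * k)"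
      and "\<bar>?D\<bar> = \<bar>(exp h - 1) * (exp k - 1)\<bar> * exp z" by (linarith, linarith, simp add: abs_mult mult.commute)
    moreover have "\<bar>z\<bar> = - z" using 2 assms by simp
    ultimately have "\<bar>?D\<bar> \<le> exp 2 * (h * k) * exp (- \<bar>z\<bar>)" by simp
    also have "exp 2 * (h * k) * exp (- \<bar>z\<bar>) \<le> exp 2 * (h * k + 2 * k * indicator {-2*h..0} z) * exp (- \<bar>z\<bar>)"
      using assms by (intro mult_right_mono mult_left_mono) auto
    finally show ?thesis .
  next
    case 3
    \<comment> \<open>Here \<open>z\<close> and \<open>z + h + k\<close> lie on different sides of the kink: use two first differences of step \<open>k\<close>.\<close>
    have sh: "\<bar>exp (- \<bar>a + k\<bar>) - exp (- \<bar>a\<bar>)\<bar> \<le> k * exp k * exp (- \<bar>a\<bar>)" for a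
      using exp_minus_abs_shift[of k a] assms by simp
    have up: "exp (- \<bar>z + h\<bar>) \<le> exp h * exp (- \<bar>z\<bar>)" using assms by (simp add: exp_add[symmetric])
    have "\<bar>?D\<bar> \<le> k * exp k * exp (- \<bar>z + h\<bar>) + k * exp k * exp (- \<bar>z\<bar>)"
      using sh[of "z + h"] sh[of z] by linarith
    also have "\<dots> \<le> k * exp k * (exp h * exp (- \<bar>z\<bar>)) + k * exp k * (exp h * exp (- \<bar>z\<bar>))"
      using up assms by (intro add_mono mult_left_mono) auto
    also have "\<dots> = 2 * k * (exp h * exp k) * exp (- \<bar>z\<bar>)" by simp
    also have "\<dots> \<le> 2 * k * exp 2 * exp (- \<bar>z\<bar>)"
      using ex1 assms by (intro mult_right_mono mult_left_mono) auto
    also have "\<dots> \<le> exp 2 * (h * k + 2 * k * indicator {-2*h..0} z) * exp (- \<bar>z\<bar>)"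
      using assms 3 by (intro mult_right_mono) (auto simp: algebra_simps)
    finally show ?thesis .
  qed
qed


lemma exp_minus_abs_shift':
  fixes a s :: real
  shows "\<bar>exp (- \<bar>a + s\<bar>) - exp (- \<bar>a\<bar>)\<bar> \<le> \<bar>s\<bar> * exp (2 * \<bar>s\<bar>) * exp (- \<bar>a\<bar>)"
proof (cases "0 \<le> s")
  case True
  have "\<bar>exp (- \<bar>a + s\<bar>) - exp (- \<bar>a\<bar>)\<bar> \<le> s * exp s * exp (- \<bar>a\<bar>)"
    by (rule exp_minus_abs_shift[OF True])
  also have "\<dots> \<le> \<bar>s\<bar> * exp (2 * \<bar>s\<bar>) * exp (- \<bar>a\<bar>)"
    using True by (intro mult_right_mono mult_mono) auto
  finally show ?thesis .
next
  case False
  then have "\<bar>exp (- \<bar>a\<bar>) - exp (- \<bar>a + s\<bar>)\<bar> \<le> (-s) * exp (-s) * exp (- \<bar>a + s\<bar>)"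
    using exp_minus_abs_shift[of "-s" "a + s"] by simp
  also have "\<dots> \<le> (-s) * exp (-s) * (exp (-s) * exp (- \<bar>a\<bar>))"
    using False by (intro mult_left_mono) (auto simp: exp_add[symmetric] mult_nonpos_nonneg)
  also have "\<dots> = \<bar>s\<bar> * exp (2 * \<bar>s\<bar>) * exp (- \<bar>a\<bar>)"
    using False by (simp add: exp_add[symmetric] mult.assoc)
  finally show ?thesis by linarith
qed

lemma exp_minus_abs_has_derivative:
  assumes "a \<noteq> (0::real)"
  shows "((\<lambda>z. exp (- \<bar>z\<bar>)) has_real_derivative - sgn a * exp (- \<bar>a\<bar>)) (at a)"
proof (cases "0 < a")
  case True
  have "((\<lambda>z. exp (- z)) has_real_derivative - sgn a * exp (- \<bar>a\<bar>)) (at a)"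
    using True by (auto intro!: derivative_eq_intros)
  then show ?thesis
    by (rule has_field_derivative_transform_within_open[where S = "{0<..}"]) (use True in auto)
next
  case False
  have "((\<lambda>z. exp z) has_real_derivative - sgn a * exp (- \<bar>a\<bar>)) (at a)"
    using False assms by (auto intro!: derivative_eq_intros)
  then show ?thesis
    by (rule has_field_derivative_transform_within_open[where S = "{..<0}"]) (use False assms in auto)
qed

lemma integrable_exp_kernel:
  fixes f \<kappa> :: "real \<Rightarrow> real"
  assumes [measurable]: "f \<in> borel_measurable lebesgue" "\<kappa> \<in> borel_measurable lebesgue"
    and f: "AE y in lebesgue. \<bar>f y\<bar> \<le> K"
    and \<kappa>: "\<And>y. \<bar>\<kappa> y\<bar> \<le> B * exp (- \<bar>x - y\<bar>)"
  shows "integrable lebesgue (\<lambda>y. \<kappa> y * f y)"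
proof (rule Bochner_Integration.integrable_bound)
  show "integrable lebesgue (\<lambda>y. B * K * exp (- 1 * \<bar>x - y\<bar>))"
    using has_bochner_integral_exp_abs[of 1 x] by (intro integrable_mult_right) (simp add: has_bochner_integral_iff)
  show "AE y in lebesgue. norm (\<kappa> y * f y) \<le> norm (B * K * exp (- 1 * \<bar>x - y\<bar>))"
    using f
  proof eventually_elim
    case (elim y)
    have "\<bar>\<kappa> y\<bar> * \<bar>f y\<bar> \<le> (B * exp (- \<bar>x - y\<bar>)) * K"
      using elim \<kappa>[of y] by (intro mult_mono) (auto intro: order_trans[OF abs_ge_zero])
    also have "\<dots> = B * K * exp (- 1 * \<bar>x - y\<bar>)" by simp
    also have "\<dots> \<le> \<bar>B * K * exp (- 1 * \<bar>x - y\<bar>)\<bar>" by (rule abs_ge_self)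
    finally show ?case by (simp add: abs_mult)
  qed
qed simp

text \<open>
  The weight costs a factor \<open>exp (\<theta> * \<bar>x - y\<bar>)\<close>, which the decay \<open>exp (- \<bar>x - y\<bar>)\<close> of the kernel
  absorbs as \<open>\<theta> < 1\<close>, leaving an integrable exponential. The indicator carries the kink of
  \<open>exp_minus_abs_second_difference\<close>.
\<close>

lemma weighted_kernel_bound:
  fixes f \<kappa> w :: "real \<Rightarrow> real"
  assumes [measurable]: "f \<in> borel_measurable lebesgue" "\<kappa> \<in> borel_measurable lebesgue"
    and w: "\<And>y. 0 < w y" "\<And>y. w x \<le> exp (\<theta> * \<bar>x - y\<bar>) * w y" and \<theta>: "\<theta> < 1"
    and f: "AE y in lebesgue. w y * \<bar>f y\<bar> \<le> F"
    and \<kappa>: "\<And>y. \<bar>\<kappa> y\<bar> \<le> (\<alpha> + \<beta> * indicator {x..x + l} y) * exp (- \<bar>x - y\<bar>)"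
    and nonneg: "0 \<le> \<alpha>" "0 \<le> \<beta>" "0 \<le> l" "0 \<le> F"
  shows "w x * \<bar>LINT y|lebesgue. \<kappa> y * f y\<bar> \<le> F * (\<alpha> * (2 / (1 - \<theta>)) + \<beta> * l)"
proof -
  define G where "G y = F * (\<alpha> * exp (- (1 - \<theta>) * \<bar>x - y\<bar>) + \<beta> * indicator {x..x+l} y)" for y
  have "has_bochner_integral lebesgue (indicator {x..x+l} :: real \<Rightarrow> real) (measure lebesgue {x..x+l})"
    by (rule has_bochner_integral_real_indicator) (auto simp: emeasure_lborel_Icc_eq)
  then have "has_bochner_integral lebesgue (indicator {x..x+l} :: real \<Rightarrow> real) l"
    using nonneg by simp
  then have G: "has_bochner_integral lebesgue G (F * (\<alpha> * (2 / (1 - \<theta>)) + \<beta> * l))"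
    unfolding G_def using \<theta>
    by (intro has_bochner_integral_mult_right has_bochner_integral_add has_bochner_integral_exp_abs) auto
  have le: "AE y in lebesgue. \<bar>w x * (\<kappa> y * f y)\<bar> \<le> G y"
    using f
  proof eventually_elim
    case (elim y)
    have "\<bar>w x * (\<kappa> y * f y)\<bar> = w x * \<bar>\<kappa> y\<bar> * \<bar>f y\<bar>" using w(1)[of x] by (simp add: abs_mult)
    also have "\<dots> \<le> (exp (\<theta> * \<bar>x - y\<bar>) * w y) * ((\<alpha> + \<beta> * indicator {x..x + l} y) * exp (- \<bar>x - y\<bar>)) * \<bar>f y\<bar>"
      using w(2)[of y] \<kappa>[of y] w(1) by (intro mult_right_mono mult_mono) (auto simp: less_imp_le)
    also have "\<dots> = (\<alpha> + \<beta> * indicator {x..x + l} y) * (exp (\<theta> * \<bar>x - y\<bar>) * exp (- \<bar>x - y\<bar>)) * (w y * \<bar>f y\<bar>)"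
      by (simp add: ac_simps)
    also have "exp (\<theta> * \<bar>x - y\<bar>) * exp (- \<bar>x - y\<bar>) = exp (- (1 - \<theta>) * \<bar>x - y\<bar>)"
      by (simp add: exp_add[symmetric] algebra_simps)
    also have "(\<alpha> + \<beta> * indicator {x..x + l} y) * exp (- (1 - \<theta>) * \<bar>x - y\<bar>) * (w y * \<bar>f y\<bar>)
        \<le> (\<alpha> + \<beta> * indicator {x..x + l} y) * exp (- (1 - \<theta>) * \<bar>x - y\<bar>) * F"
      using elim nonneg by (intro mult_left_mono) auto
    also have "\<dots> \<le> G y"
    proof -
      have "exp (- (1 - \<theta>) * \<bar>x - y\<bar>) \<le> 1" using \<theta> by (simp add: mult_nonpos_nonneg)
      then have "\<beta> * indicator {x..x + l} y * exp (- (1 - \<theta>) * \<bar>x - y\<bar>) \<le> \<beta> * indicator {x..x + l} y"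
        using nonneg by (intro mult_left_le) auto
      then have "(\<alpha> + \<beta> * indicator {x..x + l} y) * exp (- (1 - \<theta>) * \<bar>x - y\<bar>)
        \<le> \<alpha> * exp (- (1 - \<theta>) * \<bar>x - y\<bar>) + \<beta> * indicator {x..x + l} y" by (simp only: distrib_right)
      then show ?thesis unfolding G_def using nonneg(4) by (subst (2) mult.commute) (rule mult_right_mono)
    qed
    finally show ?case .
  qed
  have i: "integrable lebesgue (\<lambda>y. w x * (\<kappa> y * f y))"
    by (rule Bochner_Integration.integrable_bound[of _ G])
       (use G le in \<open>auto simp: has_bochner_integral_iff elim!: eventually_mono\<close>)
  have "w x * \<bar>LINT y|lebesgue. \<kappa> y * f y\<bar> = \<bar>LINT y|lebesgue. w x * (\<kappa> y * f y)\<bar>"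
    using w(1)[of x] by (simp add: abs_mult)
  also have "\<dots> \<le> (LINT y|lebesgue. \<bar>w x * (\<kappa> y * f y)\<bar>)"
    by (rule integral_abs_bound)
  also have "\<dots> \<le> (LINT y|lebesgue. G y)"
    using i G le by (intro integral_mono_AE integrable_abs) (auto simp: has_bochner_integral_iff)
  finally show ?thesis using G by (simp add: has_bochner_integral_iff)
qed


lemma exp_minus_abs_quotient_bound:
  fixes a s :: real
  assumes "s \<noteq> 0" "\<bar>s\<bar> \<le> S"
  shows "\<bar>(exp (- \<bar>a + s\<bar>) - exp (- \<bar>a\<bar>)) / s\<bar> \<le> exp (2 * S) * exp (- \<bar>a\<bar>)"
proof -
  have "\<bar>exp (- \<bar>a + s\<bar>) - exp (- \<bar>a\<bar>)\<bar> \<le> \<bar>s\<bar> * exp (2 * \<bar>s\<bar>) * exp (- \<bar>a\<bar>)"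
    by (rule exp_minus_abs_shift')
  also have "\<dots> \<le> \<bar>s\<bar> * exp (2 * S) * exp (- \<bar>a\<bar>)"
    using assms by (intro mult_right_mono mult_left_mono) auto
  finally show ?thesis using assms by (simp add: divide_le_eq mult.commute mult.left_commute)
qed

lemma abs_half_le: "\<bar>X\<bar> \<le> B \<Longrightarrow> \<bar>1/2 * X\<bar> \<le> B" for X B :: real
  by linarith

lemma AE_not_equal: "AE y in lebesgue. y \<noteq> (x::real)"
  by (rule AE_I'[of "{x}"]) auto

lemma LIMSEQ_abs_bound:
  fixes s :: "nat \<Rightarrow> real"
  assumes "s \<longlonglongrightarrow> l"
  obtains S where "\<And>n. \<bar>s n - l\<bar> \<le> S"
proof -
  have "Bseq (\<lambda>n. s n - l)"
    by (intro convergent_imp_Bseq convergentI[of _ "l - l"] tendsto_diff assms tendsto_const)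
  then show ?thesis using that by (auto simp: Bseq_def)
qed

context
  fixes f :: "real \<Rightarrow> real" and K :: real
  assumes fm [measurable]: "f \<in> borel_measurable lebesgue"
    and fK: "AE y in lebesgue. \<bar>f y\<bar> \<le> K"
begin

lemma measurable_kernel [measurable]:
  "(\<lambda>y. exp (- \<bar>x - y\<bar>)) \<in> borel_measurable lebesgue" "(\<lambda>y. sgn (x - y)) \<in> borel_measurable lebesgue" for x :: real
  by (intro measurable_completion; measurable)+

lemma integrable_Helmholtz: "integrable lebesgue (\<lambda>y. 1/2 * exp (- \<bar>x - y\<bar>) * f y)"
  by (rule integrable_exp_kernel[OF fm _ fK, where B = "1/2" and x = x])
      (auto intro!: borel_measurable_times measurable_kernel)

lemma inv_Helmholtz_diff:
  "inv_Helmholtz f (x + k) - inv_Helmholtz f x =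
    (LINT y|lebesgue. (1/2 * (exp (- \<bar>x - y + k\<bar>) - exp (- \<bar>x - y\<bar>))) * f y)"
proof -
  have e: "x + k - y = x - y + k" for y by simp
  show ?thesis
    unfolding inv_Helmholtz_def using integrable_Helmholtz[of "x + k"] integrable_Helmholtz[of x]
    by (subst Bochner_Integration.integral_diff[symmetric]) (simp_all add: e algebra_simps)
qed

definition inv_Helmholtz_deriv :: "real \<Rightarrow> real" where
  "inv_Helmholtz_deriv x = (LINT y|lebesgue. (1/2 * (- sgn (x - y) * exp (- \<bar>x - y\<bar>))) * f y)"

text \<open>
  Differentiation under the integral: the difference quotients of the kernel are dominated by a
  multiple of the kernel itself and converge except at the kink \<open>y = x\<close>.
\<close>

lemma inv_Helmholtz_has_derivative:
  "(inv_Helmholtz f has_real_derivative inv_Helmholtz_deriv x) (at x)"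
  unfolding DERIV_def
proof (subst tendsto_at_iff_sequentially, intro allI impI)
  fix s :: "nat \<Rightarrow> real" assume s: "\<forall>n. s n \<in> UNIV - {0}" "s \<longlonglongrightarrow> 0"
  then obtain S where S: "\<And>n. \<bar>s n\<bar> \<le> S" using LIMSEQ_abs_bound[OF s(2)] by auto
  let ?q = "\<lambda>n y. (1/2 * ((exp (- \<bar>x - y + s n\<bar>) - exp (- \<bar>x - y\<bar>)) / s n)) * f y"
  have "(\<lambda>n. LINT y|lebesgue. ?q n y) \<longlonglongrightarrow> inv_Helmholtz_deriv x"
    unfolding inv_Helmholtz_deriv_def
  proof (rule integral_dominated_convergence)
    show "(\<lambda>y. 1/2 * (- sgn (x - y) * exp (- \<bar>x - y\<bar>)) * f y) \<in> borel_measurable lebesgue" by measurable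
    have [measurable]: "(\<lambda>y. exp (- \<bar>x - y + s n\<bar>)) \<in> borel_measurable lebesgue" for n
      by (intro measurable_completion) measurable
    show "?q n \<in> borel_measurable lebesgue" for n by measurable
    show "integrable lebesgue (\<lambda>y. \<bar>(exp (2 * S) * exp (- \<bar>x - y\<bar>)) * f y\<bar>)"
      by (intro integrable_abs integrable_exp_kernel[OF fm _ fK, where B = "exp (2 * S)" and x = x])
      (auto intro!: borel_measurable_times measurable_kernel)
    show "AE y in lebesgue. norm (?q n y) \<le> \<bar>(exp (2 * S) * exp (- \<bar>x - y\<bar>)) * f y\<bar>" for n
    proof (rule AE_I2)
      fix y
      have "\<bar>(exp (- \<bar>x - y + s n\<bar>) - exp (- \<bar>x - y\<bar>)) / s n\<bar> \<le> exp (2 * S) * exp (- \<bar>x - y\<bar>)"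
        using s S by (intro exp_minus_abs_quotient_bound) auto
      then have "\<bar>1/2 * ((exp (- \<bar>x - y + s n\<bar>) - exp (- \<bar>x - y\<bar>)) / s n)\<bar> * \<bar>f y\<bar> \<le> (exp (2 * S) * exp (- \<bar>x - y\<bar>)) * \<bar>f y\<bar>"
        by (intro mult_right_mono abs_half_le) auto
      then show "norm (?q n y) \<le> \<bar>(exp (2 * S) * exp (- \<bar>x - y\<bar>)) * f y\<bar>" by (simp only: real_norm_def abs_mult) simp
    qed
    show "AE y in lebesgue. (\<lambda>n. ?q n y) \<longlonglongrightarrow> 1/2 * (- sgn (x - y) * exp (- \<bar>x - y\<bar>)) * f y"
      using AE_not_equal[of x]
    proof eventually_elim
      case (elim y)
      then have "((\<lambda>h. (exp (- \<bar>x - y + h\<bar>) - exp (- \<bar>x - y\<bar>)) / h) \<longlongrightarrow> - sgn (x - y) * exp (- \<bar>x - y\<bar>)) (at 0)"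
        using exp_minus_abs_has_derivative[of "x - y"] by (simp add: DERIV_def)
      then have "(\<lambda>n. (exp (- \<bar>x - y + s n\<bar>) - exp (- \<bar>x - y\<bar>)) / s n) \<longlonglongrightarrow> - sgn (x - y) * exp (- \<bar>x - y\<bar>)"
        using s unfolding tendsto_at_iff_sequentially comp_def by blast
      then show ?case by (intro tendsto_intros)
    qed
  qed
  moreover have "(inv_Helmholtz f (x + s n) - inv_Helmholtz f x) / s n = (LINT y|lebesgue. ?q n y)" for n
    unfolding inv_Helmholtz_diff
    by (subst integral_divide_zero[symmetric]) (simp add: field_simps)
  ultimately show "((\<lambda>h. (inv_Helmholtz f (x + h) - inv_Helmholtz f x) / h) \<circ> s) \<longlonglongrightarrow> inv_Helmholtz_deriv x"
    by (simp add: comp_def)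
qed

lemma continuous_inv_Helmholtz_deriv: "continuous_on UNIV inv_Helmholtz_deriv"
proof (rule continuous_at_imp_continuous_on, rule ballI, rule continuous_at_sequentiallyI)
  fix x s assume s: "s \<longlonglongrightarrow> (x::real)"
  obtain S where S: "\<And>n. \<bar>s n - x\<bar> \<le> S" using LIMSEQ_abs_bound[OF s] by blast
  show "(\<lambda>n. inv_Helmholtz_deriv (s n)) \<longlonglongrightarrow> inv_Helmholtz_deriv x"
    unfolding inv_Helmholtz_deriv_def
  proof (rule integral_dominated_convergence)
    show "(\<lambda>y. 1/2 * (- sgn (x - y) * exp (- \<bar>x - y\<bar>)) * f y) \<in> borel_measurable lebesgue" for x by measurable
    then show "(\<lambda>y. 1/2 * (- sgn (s n - y) * exp (- \<bar>s n - y\<bar>)) * f y) \<in> borel_measurable lebesgue" for n .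
    show "integrable lebesgue (\<lambda>y. \<bar>(exp S * exp (- \<bar>x - y\<bar>)) * f y\<bar>)"
      by (intro integrable_abs integrable_exp_kernel[OF fm _ fK, where B = "exp S" and x = x])
      (auto intro!: borel_measurable_times measurable_kernel)
    show "AE y in lebesgue. norm (1/2 * (- sgn (s n - y) * exp (- \<bar>s n - y\<bar>)) * f y) \<le> \<bar>(exp S * exp (- \<bar>x - y\<bar>)) * f y\<bar>" for n
    proof (rule AE_I2)
      fix y
      have "exp (- \<bar>s n - y\<bar>) \<le> exp S * exp (- \<bar>x - y\<bar>)"
        using S[of n] by (simp add: exp_add[symmetric])
      then have "\<bar>1/2 * (- sgn (s n - y) * exp (- \<bar>s n - y\<bar>))\<bar> \<le> exp S * exp (- \<bar>x - y\<bar>)"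
        by (intro abs_half_le) (auto simp: abs_mult sgn_if)
      then show "norm (1/2 * (- sgn (s n - y) * exp (- \<bar>s n - y\<bar>)) * f y) \<le> \<bar>(exp S * exp (- \<bar>x - y\<bar>)) * f y\<bar>"
        unfolding real_norm_def abs_mult[of _ "f y"] by (intro mult_right_mono) auto
    qed
    show "AE y in lebesgue. (\<lambda>n. 1/2 * (- sgn (s n - y) * exp (- \<bar>s n - y\<bar>)) * f y)
        \<longlonglongrightarrow> 1/2 * (- sgn (x - y) * exp (- \<bar>x - y\<bar>)) * f y"
      using AE_not_equal[of x] by eventually_elim (intro tendsto_intros s, simp)
  qed
qed

text \<open>
  Existence of some weak derivative is what makes the choice in \<open>weak_deriv (inv_Helmholtz f)\<close>
  meaningful.
\<close>

lemma has_weak_deriv_inv_Helmholtz: "has_weak_deriv (inv_Helmholtz f) inv_Helmholtz_deriv"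
  by (intro has_weak_deriv_of_C1 inv_Helmholtz_has_derivative continuous_inv_Helmholtz_deriv)

text \<open>
  Weighted bounds on a source pass to \<open>P\<close>, in the form of first and mixed second differences. These
  are the finite-difference versions of bounds on \<open>P\<^sub>x\<close> and \<open>P\<^sub>x\<^sub>x\<close>, and they apply although
  \<open>P\<^sub>x\<^sub>x\<close> contains the discontinuous source.
\<close>

lemma weighted_inv_Helmholtz_bounds:
  fixes w :: "real \<Rightarrow> real"
  assumes w: "\<And>y. 0 < w y" "\<And>x y. w x \<le> exp (\<theta> * \<bar>x - y\<bar>) * w y" and \<theta>: "\<theta> < 1"
    and f: "AE y in lebesgue. w y * \<bar>f y\<bar> \<le> F" and F: "0 \<le> F"
    and k: "0 < k" "k \<le> h" "h \<le> 1"
  shows "w x * \<bar>inv_Helmholtz f (x + k) - inv_Helmholtz f x\<bar> \<le> exp 2 * (1 / (1 - \<theta>) + 2) * F * k"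
    and "w x * \<bar>inv_Helmholtz f (x + h + k) - inv_Helmholtz f (x + h) - (inv_Helmholtz f (x + k) - inv_Helmholtz f x)\<bar>
      \<le> exp 2 * (1 / (1 - \<theta>) + 2) * F * h * k"
proof -
  have ek: "exp k \<le> exp (2::real)" using k by simp
  have [measurable]: "(\<lambda>y. exp (- \<bar>x - y + t\<bar>)) \<in> borel_measurable lebesgue" for t
    by (intro measurable_completion) measurable
  have m1: "(\<lambda>y. 1/2 * (exp (- \<bar>x - y + k\<bar>) - exp (- \<bar>x - y\<bar>))) \<in> borel_measurable lebesgue" by measurable
  have "w x * \<bar>LINT y|lebesgue. (1/2 * (exp (- \<bar>x - y + k\<bar>) - exp (- \<bar>x - y\<bar>))) * f y\<bar>
     \<le> F * (k * exp 2 / 2 * (2 / (1 - \<theta>)) + 0 * 0)"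
  proof (rule weighted_kernel_bound[OF fm m1 w \<theta> f])
    fix y
    have "\<bar>exp (- \<bar>x - y + k\<bar>) - exp (- \<bar>x - y\<bar>)\<bar> \<le> k * exp k * exp (- \<bar>x - y\<bar>)"
      using k by (intro exp_minus_abs_shift) auto
    also have "\<dots> \<le> k * exp 2 * exp (- \<bar>x - y\<bar>)"
      using k ek by (intro mult_right_mono mult_left_mono) auto
    finally show "\<bar>1/2 * (exp (- \<bar>x - y + k\<bar>) - exp (- \<bar>x - y\<bar>))\<bar>
        \<le> (k * exp 2 / 2 + 0 * indicator {x..x+0} y) * exp (- \<bar>x - y\<bar>)" by (simp add: abs_mult)
  qed (use k F in auto)
  also have "\<dots> = exp 2 * (1 / (1 - \<theta>)) * F * k" by simp
  also have "\<dots> \<le> exp 2 * (1 / (1 - \<theta>) + 2) * F * k"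
    using k F by (intro mult_right_mono mult_left_mono) auto
  finally show "w x * \<bar>inv_Helmholtz f (x + k) - inv_Helmholtz f x\<bar> \<le> exp 2 * (1 / (1 - \<theta>) + 2) * F * k"
    unfolding inv_Helmholtz_diff .
  let ?D = "\<lambda>y. exp (- \<bar>x - y + h + k\<bar>) - exp (- \<bar>x - y + h\<bar>) - exp (- \<bar>x - y + k\<bar>) + exp (- \<bar>x - y\<bar>)"
  have "(\<lambda>y. exp (- \<bar>x - y + h + k\<bar>)) \<in> borel_measurable lebesgue"
    using \<open>\<And>t. (\<lambda>y. exp (- \<bar>x - y + t\<bar>)) \<in> borel_measurable lebesgue\<close>[of "h + k"] by (simp add: add.assoc)
  then have m2: "(\<lambda>y. 1/2 * ?D y) \<in> borel_measurable lebesgue" by measurable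
  have "inv_Helmholtz f (x + h + k) - inv_Helmholtz f (x + h) - (inv_Helmholtz f (x + k) - inv_Helmholtz f x)
     = (LINT y|lebesgue. (1/2 * ?D y) * f y)"
  proof -
    have e: "x + h + k - y = x - y + h + k" "x + h - y = x - y + h" "x + k - y = x - y + k" for y by simp_all
    note i = integrable_Helmholtz[of "x + h + k"] integrable_Helmholtz[of "x + h"] integrable_Helmholtz[of "x + k"] integrable_Helmholtz[of x]
    have "inv_Helmholtz f (x + h + k) - inv_Helmholtz f (x + h) - (inv_Helmholtz f (x + k) - inv_Helmholtz f x)
      = (LINT y|lebesgue. (1/2 * exp (- \<bar>x + h + k - y\<bar>) * f y - 1/2 * exp (- \<bar>x + h - y\<bar>) * f y)
          - (1/2 * exp (- \<bar>x + k - y\<bar>) * f y - 1/2 * exp (- \<bar>x - y\<bar>) * f y))"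
      unfolding inv_Helmholtz_def using i
      by (simp only: Bochner_Integration.integral_diff Bochner_Integration.integrable_diff)
    also have "\<dots> = (LINT y|lebesgue. (1/2 * ?D y) * f y)"
      by (intro Bochner_Integration.integral_cong refl) (simp add: e algebra_simps)
    finally show ?thesis .
  qed
  moreover have "w x * \<bar>LINT y|lebesgue. (1/2 * ?D y) * f y\<bar>
     \<le> F * (exp 2 * (h * k) / 2 * (2 / (1 - \<theta>)) + exp 2 * k * (2 * h))"
  proof (rule weighted_kernel_bound[OF fm m2 w \<theta> f])
    fix y
    have ind: "indicator {-2*h..0} (x - y) = (indicator {x..x + 2*h} y :: real)" by (auto simp: indicator_def)
    have "\<bar>1/2 * ?D y\<bar> = 1/2 * \<bar>?D y\<bar>" by (simp only: abs_mult) simp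
    also have "\<dots> \<le> 1/2 * (exp 2 * (h * k + 2 * k * indicator {-2*h..0} (x - y)) * exp (- \<bar>x - y\<bar>))"
      by (intro mult_left_mono exp_minus_abs_second_difference k) auto
    also have "\<dots> = (exp 2 * (h * k) / 2 + exp 2 * k * indicator {x..x + 2 * h} y) * exp (- \<bar>x - y\<bar>)"
      unfolding ind by (simp add: algebra_simps)
    finally show "\<bar>1/2 * ?D y\<bar> \<le> (exp 2 * (h * k) / 2 + exp 2 * k * indicator {x..x + 2 * h} y) * exp (- \<bar>x - y\<bar>)" .
  qed (use k F in auto)
  moreover have "F * (exp 2 * (h * k) / 2 * (2 / (1 - \<theta>)) + exp 2 * k * (2 * h)) = exp 2 * (1 / (1 - \<theta>) + 2) * F * h * k"
    using \<theta> by (simp add: divide_simps) (simp add: algebra_simps)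
  ultimately show "w x * \<bar>inv_Helmholtz f (x + h + k) - inv_Helmholtz f (x + h) - (inv_Helmholtz f (x + k) - inv_Helmholtz f x)\<bar>
      \<le> exp 2 * (1 / (1 - \<theta>) + 2) * F * h * k" by (simp only:)
qed

end


section \<open>A weighted maximum principle for transport\<close>

lemma continuous_on_pair_of_Lipschitz:
  fixes v :: "real \<Rightarrow> real \<Rightarrow> real"
  assumes t: "\<And>x. continuous_on A (\<lambda>t. v t x)"
    and x: "\<And>t x y. t \<in> A \<Longrightarrow> \<bar>v t x - v t y\<bar> \<le> L * \<bar>x - y\<bar>"
  shows "continuous_on (A \<times> B) (\<lambda>p. v (fst p) (snd p))"
  unfolding continuous_on_def
proof
  fix p assume p: "p \<in> A \<times> B"
  have "continuous_on (A \<times> B) (\<lambda>q. v (fst q) (snd p))"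
    by (intro continuous_on_compose2[OF t[of "snd p"]] continuous_intros) auto
  then have 1: "((\<lambda>q. v (fst q) (snd p)) \<longlongrightarrow> v (fst p) (snd p)) (at p within A \<times> B)"
    using p unfolding continuous_on_def by blast
  have 2: "((\<lambda>q. v (fst q) (snd q) - v (fst q) (snd p)) \<longlongrightarrow> 0) (at p within A \<times> B)"
  proof (rule Lim_null_comparison)
    show "\<forall>\<^sub>F q in at p within A \<times> B. norm (v (fst q) (snd q) - v (fst q) (snd p)) \<le> L * \<bar>snd q - snd p\<bar>"
    proof -
      have "norm (v (fst q) (snd q) - v (fst q) (snd p)) \<le> L * \<bar>snd q - snd p\<bar>" if "q \<in> A \<times> B" for q
        using x[of "fst q" "snd q" "snd p"] that by (cases q) simp
      then show ?thesis unfolding eventually_at_filter by (intro always_eventually) blast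
    qed
    have "((\<lambda>q. L * \<bar>snd q - snd p\<bar>) \<longlongrightarrow> L * \<bar>snd p - snd p\<bar>) (at p within A \<times> B)"
      by (intro tendsto_intros)
    then show "((\<lambda>q. L * \<bar>snd q - snd p\<bar>) \<longlongrightarrow> 0) (at p within A \<times> B)" by simp
  qed
  show "((\<lambda>q. v (fst q) (snd q)) \<longlongrightarrow> v (fst p) (snd p)) (at p within A \<times> B)"
    using tendsto_add[OF 1 2] by simp
qed

text \<open>
  At a maximum point \<open>(t', x')\<close> of \<open>exp (- \<mu> * t) * w x * \<bar>v t x\<bar>\<close> with \<open>t' > 0\<close>, vanishing of the
  \<open>x\<close>-derivative gives \<open>w v\<^sub>x = - w' v\<close>, and the left-sided \<open>t\<close>-derivative gives
  \<open>\<mu> w \<bar>v\<bar> \<le> \<plusminus> w v\<^sub>t\<close>. Hence \<open>(\<mu> - M * \<theta>)\<close> times the maximum is at most \<open>G\<close>. A maximum exists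
  because \<open>v\<close> is bounded and \<open>w\<close> vanishes at both ends.
\<close>

lemma transport_maximum_principle:
  fixes v vt vx a :: "real \<Rightarrow> real \<Rightarrow> real" and w w' :: "real \<Rightarrow> real"
  assumes t1: "0 \<le> t1" and lam: "M * \<theta> < \<mu>" and M: "0 \<le> M"
    and cont: "\<And>B. continuous_on ({0..t1} \<times> B) (\<lambda>p. v (fst p) (snd p))"
    and vt: "\<And>t x. 0 < t \<Longrightarrow> t \<le> t1 \<Longrightarrow> ((\<lambda>s. v s x) has_real_derivative vt t x) (at t)"
    and vx: "\<And>t x. 0 < t \<Longrightarrow> t \<le> t1 \<Longrightarrow> (v t has_real_derivative vx t x) (at x)"
    and w: "\<And>x. 0 < w x" "\<And>x. (w has_real_derivative w' x) (at x)" "\<And>x. \<bar>w' x\<bar> \<le> \<theta> * w x"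
    and wlim: "(w \<longlongrightarrow> 0) at_top" "(w \<longlongrightarrow> 0) at_bot"
    and bdd: "\<And>t x. 0 \<le> t \<Longrightarrow> t \<le> t1 \<Longrightarrow> \<bar>v t x\<bar> \<le> D"
    and a: "\<And>t x. 0 < t \<Longrightarrow> t \<le> t1 \<Longrightarrow> \<bar>a t x\<bar> \<le> M"
    and G: "\<And>t x. 0 < t \<Longrightarrow> t \<le> t1 \<Longrightarrow> w x * \<bar>vt t x + a t x * vx t x\<bar> \<le> G * exp (\<mu> * t)"
    and init: "\<And>x. w x * \<bar>v 0 x\<bar> \<le> K"
    and t: "0 \<le> t" "t \<le> t1"
  shows "w x * \<bar>v t x\<bar> \<le> max K (G / (\<mu> - M * \<theta>)) * exp (\<mu> * t)"
proof (rule ccontr)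
  define \<Phi> where "\<Phi> t x = exp (- \<mu> * t) * (w x * v t x)" for t x
  define \<beta> where "\<beta> = max K (G / (\<mu> - M * \<theta>))"
  assume "\<not> ?thesis"
  then have "\<beta> * exp (\<mu> * t) < w x * \<bar>v t x\<bar>" by (simp add: \<beta>_def)
  then have "\<beta> < exp (- \<mu> * t) * (w x * \<bar>v t x\<bar>)" by (simp add: exp_minus field_simps)
  then have big: "\<beta> < \<bar>\<Phi> t x\<bar>" using w(1)[of x] by (simp add: \<Phi>_def abs_mult)
  have K0: "0 \<le> K" using init[of 0] w(1)[of 0] by (meson abs_ge_zero less_imp_le mult_nonneg_nonneg order_trans)
  then have \<beta>0: "0 \<le> \<beta>" by (simp add: \<beta>_def)
  define m where "m = \<bar>\<Phi> t x\<bar>"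
  have m0: "0 < m" using big \<beta>0 by (simp add: m_def)
  \<comment> \<open>A crude bound for \<open>exp (- \<mu> * s) * \<bar>v s y\<bar>\<close>, positive so that it can be divided by.\<close>
  define E where "E = exp (\<bar>\<mu>\<bar> * t1) * (\<bar>D\<bar> + 1)"
  have E0: "0 < E" by (simp add: E_def add_nonneg_pos)
  have small: "\<bar>\<Phi> s y\<bar> \<le> w y * E" if "0 \<le> s" "s \<le> t1" for s y
  proof -
    have "exp (- \<mu> * s) \<le> exp (\<bar>\<mu>\<bar> * t1)"
    proof -
      have "- \<mu> * s \<le> \<bar>\<mu>\<bar> * s" using that by (intro mult_right_mono) auto
      also have "\<dots> \<le> \<bar>\<mu>\<bar> * t1" using that by (intro mult_left_mono) auto
      finally show ?thesis by simp
    qed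
    then have "exp (- \<mu> * s) * \<bar>v s y\<bar> \<le> E" unfolding E_def
      using bdd[OF that, of y] by (intro mult_mono) auto
    then have "w y * (exp (- \<mu> * s) * \<bar>v s y\<bar>) \<le> w y * E" using w(1)[of y] by (intro mult_left_mono) auto
    then show ?thesis using w(1)[of y] by (simp add: \<Phi>_def abs_mult ac_simps)
  qed
  obtain R where R: "\<And>y. R \<le> \<bar>y\<bar> \<Longrightarrow> w y * E < m"
  proof -
    have "\<forall>\<^sub>F y in at_top. w y < m / E" "\<forall>\<^sub>F y in at_bot. w y < m / E"
      using wlim m0 E0 by (auto intro!: order_tendstoD)
    then obtain R1 R2 where "\<And>y. R1 \<le> y \<Longrightarrow> w y < m / E" "\<And>y. y \<le> R2 \<Longrightarrow> w y < m / E"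
      unfolding eventually_at_top_linorder eventually_at_bot_linorder by blast
    then have "w y < m / E" if "max R1 (- R2) \<le> \<bar>y\<bar>" for y
      using that by (cases "0 \<le> y") auto
    then show ?thesis using that[of "max R1 (- R2)"] E0 by (simp add: less_divide_eq)
  qed
  define C where "C = {0..t1} \<times> {- \<bar>R\<bar>..\<bar>R\<bar>}"
  have "compact C" unfolding C_def by (intro compact_Times) auto
  have "x \<in> {- \<bar>R\<bar>..\<bar>R\<bar>}"
    using R[of x] small[OF t, of x] by (force simp: m_def)
  then have tx: "(t, x) \<in> C" using t by (simp add: C_def)
  have wc: "continuous_on UNIV w" using w(2) by (meson DERIV_continuous_on has_field_derivative_at_within)
  have "continuous_on C (\<lambda>p. \<bar>\<Phi> (fst p) (snd p)\<bar>)"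
    unfolding \<Phi>_def C_def by (intro continuous_intros cont continuous_on_compose2[OF wc]) auto
  then obtain p where p: "p \<in> C" "\<And>q. q \<in> C \<Longrightarrow> \<bar>\<Phi> (fst q) (snd q)\<bar> \<le> \<bar>\<Phi> (fst p) (snd p)\<bar>"
    using continuous_attains_sup[OF \<open>compact C\<close>] tx by blast
  obtain t' x' where p': "p = (t', x')" by (cases p)
  have t': "0 \<le> t'" "t' \<le> t1" using p(1) by (auto simp: p' C_def)
  have ge: "m \<le> \<bar>\<Phi> t' x'\<bar>" using p(2)[OF tx] by (simp add: p' m_def)
  have glob: "\<bar>\<Phi> s y\<bar> \<le> \<bar>\<Phi> t' x'\<bar>" if "0 \<le> s" "s \<le> t1" for s y
  proof (cases "y \<in> {- \<bar>R\<bar>..\<bar>R\<bar>}")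
    case True
    then show ?thesis using p(2)[of "(s, y)"] that by (simp add: p' C_def)
  next
    case False
    then have "R \<le> \<bar>y\<bar>" by auto
    then show ?thesis using R[of y] small[OF that, of y] ge by linarith
  qed
  have big': "\<beta> < \<bar>\<Phi> t' x'\<bar>" using big ge by (simp add: m_def)
  have "t' \<noteq> 0"
  proof
    assume "t' = 0"
    then have "\<bar>\<Phi> t' x'\<bar> \<le> K" using init[of x'] w(1)[of x'] by (simp add: \<Phi>_def abs_mult)
    then show False using big' by (simp add: \<beta>_def)
  qed
  then have tp: "0 < t'" using t' by simp
  define \<sigma> where "\<sigma> = sgn (\<Phi> t' x')"
  have \<sigma>: "\<bar>\<sigma>\<bar> = 1" using big' \<beta>0 by (auto simp: \<sigma>_def abs_sgn_eq)
  have \<sigma>\<Phi>: "\<sigma> * \<Phi> t' x' = \<bar>\<Phi> t' x'\<bar>" by (simp add: \<sigma>_def abs_sgn mult.commute)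
  have \<sigma>le: "\<sigma> * \<Phi> s y \<le> \<sigma> * \<Phi> t' x'" if "0 \<le> s" "s \<le> t1" for s y
  proof -
    have "\<sigma> * \<Phi> s y \<le> \<bar>\<sigma> * \<Phi> s y\<bar>" by (rule abs_ge_self)
    also have "\<dots> = \<bar>\<Phi> s y\<bar>" unfolding abs_mult \<sigma> by (rule mult_1_left)
    finally show ?thesis using glob[OF that, of y] \<sigma>\<Phi> by linarith
  qed
  have dx: "((\<lambda>y. \<sigma> * \<Phi> t' y) has_real_derivative \<sigma> * (exp (- \<mu> * t') * (w' x' * v t' x' + w x' * vx t' x'))) (at x')"
    unfolding \<Phi>_def
    by (rule DERIV_cong[OF DERIV_cmult[OF DERIV_cmult[OF DERIV_mult[OF w(2) vx[OF tp t'(2)]]]]]) (simp add: algebra_simps)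
  \<comment> \<open>The maximum over the compact box is global, so \<open>x\'\<close> is an interior maximum in \<open>x\<close>.\<close>
  have "\<sigma> * (exp (- \<mu> * t') * (w' x' * v t' x' + w x' * vx t' x')) = 0"
    by (rule DERIV_local_max[OF dx, of 1]) (use \<sigma>le t' in auto)
  then have x0: "w x' * vx t' x' = - (w' x' * v t' x')" using \<sigma> by auto
  have dt: "((\<lambda>s. \<sigma> * \<Phi> s x') has_real_derivative \<sigma> * (exp (- \<mu> * t') * (w x' * (vt t' x' - \<mu> * v t' x')))) (at t')"
    unfolding \<Phi>_def
  proof (rule DERIV_cmult)
    have e: "((\<lambda>s. exp (- \<mu> * s)) has_real_derivative - \<mu> * exp (- \<mu> * t')) (at t')"
      by (auto intro!: derivative_eq_intros)
    show "((\<lambda>s. exp (- \<mu> * s) * (w x' * v s x')) has_real_derivative exp (- \<mu> * t') * (w x' * (vt t' x' - \<mu> * v t' x'))) (at t')"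
      by (rule DERIV_cong[OF DERIV_mult[OF e DERIV_cmult[OF vt[OF tp t'(2)]]]]) (simp add: algebra_simps)
  qed
  have "0 \<le> \<sigma> * (exp (- \<mu> * t') * (w x' * (vt t' x' - \<mu> * v t' x')))"
  proof (rule ccontr)
    assume "\<not> ?thesis"
    then obtain d where d: "d > 0" "\<And>h. 0 < h \<Longrightarrow> h < d \<Longrightarrow> \<sigma> * \<Phi> t' x' < \<sigma> * \<Phi> (t' - h) x'"
      using DERIV_neg_dec_left[OF dt] by (meson not_le)
    define h where "h = min (d/2) t'"
    have "\<sigma> * \<Phi> t' x' < \<sigma> * \<Phi> (t' - h) x'" using d tp by (intro d(2)) (auto simp: h_def)
    moreover have "0 \<le> t' - h" "t' - h \<le> t1" using d t' tp by (auto simp: h_def)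
    ultimately show False using \<sigma>le[of "t' - h" x'] by linarith
  qed
  then have "0 \<le> \<sigma> * (w x' * (vt t' x' - \<mu> * v t' x'))"
    by (simp add: zero_le_mult_iff mult.left_commute[of \<sigma>])
  then have "\<mu> * (\<sigma> * (w x' * v t' x')) \<le> \<sigma> * (w x' * vt t' x')" by (simp add: algebra_simps)
  also have "\<dots> = \<sigma> * (w x' * (vt t' x' + a t' x' * vx t' x')) - \<sigma> * a t' x' * (w x' * vx t' x')"
    by (simp add: algebra_simps)
  also have "\<dots> = \<sigma> * (w x' * (vt t' x' + a t' x' * vx t' x')) + \<sigma> * a t' x' * (w' x' * v t' x')"
    unfolding x0 by simp
  also have "\<dots> \<le> G * exp (\<mu> * t') + M * (\<theta> * (w x' * \<bar>v t' x'\<bar>))"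
  proof (rule add_mono)
    have "\<bar>\<sigma> * (w x' * (vt t' x' + a t' x' * vx t' x'))\<bar> = w x' * \<bar>vt t' x' + a t' x' * vx t' x'\<bar>"
      using \<sigma> w(1)[of x'] by (simp add: abs_mult)
    then show "\<sigma> * (w x' * (vt t' x' + a t' x' * vx t' x')) \<le> G * exp (\<mu> * t')"
      using G[OF tp t'(2), of x'] by linarith
    have "\<bar>\<sigma> * a t' x' * (w' x' * v t' x')\<bar> = \<bar>a t' x'\<bar> * (\<bar>w' x'\<bar> * \<bar>v t' x'\<bar>)"
      using \<sigma> by (simp add: abs_mult)
    also have "\<dots> \<le> M * (\<theta> * w x' * \<bar>v t' x'\<bar>)"
      using a[OF tp t'(2)] w(3)[of x'] M by (intro mult_mono mult_right_mono) auto
    finally show "\<sigma> * a t' x' * (w' x' * v t' x') \<le> M * (\<theta> * (w x' * \<bar>v t' x'\<bar>))"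
      by (simp add: mult.assoc)
  qed
  finally have A: "\<mu> * (\<sigma> * (w x' * v t' x')) \<le> G * exp (\<mu> * t') + M * (\<theta> * (w x' * \<bar>v t' x'\<bar>))" .
  have B: "exp (- \<mu> * t') * (\<sigma> * (w x' * v t' x')) = \<bar>\<Phi> t' x'\<bar>"
    using \<sigma>\<Phi> unfolding \<Phi>_def by (simp add: ac_simps)
  have B': "exp (- \<mu> * t') * (w x' * \<bar>v t' x'\<bar>) = \<bar>\<Phi> t' x'\<bar>"
    using w(1)[of x'] by (simp add: \<Phi>_def abs_mult)
  have "\<mu> * \<bar>\<Phi> t' x'\<bar> = exp (- \<mu> * t') * (\<mu> * (\<sigma> * (w x' * v t' x')))" using B by (simp add: ac_simps)
  also have "\<dots> \<le> exp (- \<mu> * t') * (G * exp (\<mu> * t') + M * (\<theta> * (w x' * \<bar>v t' x'\<bar>)))"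
    using A by (intro mult_left_mono) auto
  also have "\<dots> = G + M * \<theta> * \<bar>\<Phi> t' x'\<bar>"
    unfolding B'[symmetric] by (simp add: exp_minus field_simps)
  finally have "(\<mu> - M * \<theta>) * \<bar>\<Phi> t' x'\<bar> \<le> G" by (simp add: algebra_simps)
  then have "\<bar>\<Phi> t' x'\<bar> \<le> G / (\<mu> - M * \<theta>)" using lam by (simp add: field_simps)
  then show False using big' by (simp add: \<beta>_def)
qed

text \<open>
  A smooth substitute for \<open>exp (\<theta> * x)\<close>, to which it increases as \<open>\<epsilon>\<close> tends to 0. For \<open>\<epsilon> > 0\<close> it
  vanishes at both ends and, like \<open>exp (\<theta> * x)\<close>, its logarithm is \<open>\<theta>\<close>-Lipschitz.
\<close>

definition tempered_weight :: "real \<Rightarrow> real \<Rightarrow> real \<Rightarrow> real" where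
  "tempered_weight \<theta> \<epsilon> x = 1 / (exp (- \<theta> * x) + \<epsilon> * exp (\<theta> * x))"

context
  fixes \<theta> \<epsilon> :: real
  assumes \<theta>: "0 < \<theta>" and \<epsilon>: "0 < \<epsilon>"
begin

lemma tempered_weight_denom_pos: "0 < exp (- \<theta> * x) + \<epsilon> * exp (\<theta> * x)"
  using \<epsilon> by (simp add: add_pos_pos)

lemma tempered_weight_pos: "0 < tempered_weight \<theta> \<epsilon> x"
  unfolding tempered_weight_def using tempered_weight_denom_pos[of x] by simp

lemma tempered_weight_le_exp: "tempered_weight \<theta> \<epsilon> x \<le> exp (\<theta> * x)"
proof -
  have "exp (- \<theta> * x) \<le> exp (- \<theta> * x) + \<epsilon> * exp (\<theta> * x)" using \<epsilon> by simp
  then have "tempered_weight \<theta> \<epsilon> x \<le> 1 / exp (- \<theta> * x)"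
    unfolding tempered_weight_def
    by (intro divide_left_mono mult_pos_pos tempered_weight_denom_pos) auto
  then show ?thesis by (simp add: exp_minus divide_inverse)
qed

lemma tempered_weight_le_exp_minus: "tempered_weight \<theta> \<epsilon> x \<le> exp (- \<theta> * x) / \<epsilon>"
proof -
  have "\<epsilon> * exp (\<theta> * x) \<le> exp (- \<theta> * x) + \<epsilon> * exp (\<theta> * x)" by simp
  then have "tempered_weight \<theta> \<epsilon> x \<le> 1 / (\<epsilon> * exp (\<theta> * x))"
    unfolding tempered_weight_def using \<epsilon>
    by (intro divide_left_mono mult_pos_pos tempered_weight_denom_pos) auto
  then show ?thesis by (simp add: exp_minus field_simps)
qed

lemma tempered_weight_bounded: "tempered_weight \<theta> \<epsilon> x \<le> 1 + 1 / \<epsilon>"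
proof (cases "0 \<le> x")
  case True
  then have "exp (- \<theta> * x) / \<epsilon> \<le> 1 / \<epsilon>" using \<theta> \<epsilon> by (intro divide_right_mono) auto
  then show ?thesis using tempered_weight_le_exp_minus[of x] by linarith
next
  case False
  then have "exp (\<theta> * x) \<le> 1" using \<theta> by (simp add: mult_nonneg_nonpos)
  moreover have "0 \<le> 1 / \<epsilon>" using \<epsilon> by simp
  ultimately show ?thesis using tempered_weight_le_exp[of x] by linarith
qed

lemma tempered_weight_slow: "tempered_weight \<theta> \<epsilon> x \<le> exp (\<theta> * \<bar>x - y\<bar>) * tempered_weight \<theta> \<epsilon> y"
proof -
  let ?d = "\<lambda>x. exp (- \<theta> * x) + \<epsilon> * exp (\<theta> * x)"
  have "- \<theta> * y \<le> \<theta> * \<bar>x - y\<bar> + - \<theta> * x" "\<theta> * y \<le> \<theta> * \<bar>x - y\<bar> + \<theta> * x"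
  proof -
    have "\<theta> * (x - y) \<le> \<theta> * \<bar>x - y\<bar>" "\<theta> * (y - x) \<le> \<theta> * \<bar>x - y\<bar>"
      using \<theta> by (intro mult_left_mono; simp)+
    then show "- \<theta> * y \<le> \<theta> * \<bar>x - y\<bar> + - \<theta> * x" "\<theta> * y \<le> \<theta> * \<bar>x - y\<bar> + \<theta> * x"
      by (simp_all add: right_diff_distrib)
  qed
  then have "exp (- \<theta> * y) \<le> exp (\<theta> * \<bar>x - y\<bar>) * exp (- \<theta> * x)" "exp (\<theta> * y) \<le> exp (\<theta> * \<bar>x - y\<bar>) * exp (\<theta> * x)"
    by (simp_all only: exp_add[symmetric] exp_le_cancel_iff)
  then have "?d y \<le> exp (\<theta> * \<bar>x - y\<bar>) * exp (- \<theta> * x) + \<epsilon> * (exp (\<theta> * \<bar>x - y\<bar>) * exp (\<theta> * x))"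
    using \<epsilon> by (intro add_mono mult_left_mono) auto
  also have "\<dots> = exp (\<theta> * \<bar>x - y\<bar>) * ?d x" by (simp add: algebra_simps)
  finally show ?thesis
    unfolding tempered_weight_def using tempered_weight_denom_pos[of x] tempered_weight_denom_pos[of y]
    by (simp add: field_simps)
qed

lemma tempered_weight_derivative:
  obtains w' where "\<And>x. (tempered_weight \<theta> \<epsilon> has_real_derivative w' x) (at x)"
    "\<And>x. \<bar>w' x\<bar> \<le> \<theta> * tempered_weight \<theta> \<epsilon> x"
proof -
  let ?d = "\<lambda>x. exp (- \<theta> * x) + \<epsilon> * exp (\<theta> * x)"
  define w' where "w' x = - (- \<theta> * exp (- \<theta> * x) + \<epsilon> * (\<theta> * exp (\<theta> * x))) / (?d x)\<^sup>2" for x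
  have "(tempered_weight \<theta> \<epsilon> has_real_derivative w' x) (at x)" for x
  proof -
    have d: "(?d has_real_derivative - \<theta> * exp (- \<theta> * x) + \<epsilon> * (\<theta> * exp (\<theta> * x))) (at x)"
      by (auto intro!: derivative_eq_intros)
    have "((\<lambda>x. inverse (?d x)) has_real_derivative - ((- \<theta> * exp (- \<theta> * x) + \<epsilon> * (\<theta> * exp (\<theta> * x))) * inverse ((?d x) ^ Suc (Suc 0)))) (at x)"
      using DERIV_inverse_fun[OF d] tempered_weight_denom_pos[of x] by simp
    moreover have "tempered_weight \<theta> \<epsilon> = (\<lambda>x. inverse (?d x))"
      by (simp add: tempered_weight_def fun_eq_iff divide_inverse)
    moreover have "- ((- \<theta> * exp (- \<theta> * x) + \<epsilon> * (\<theta> * exp (\<theta> * x))) * inverse ((?d x) ^ Suc (Suc 0))) = w' x"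
      unfolding w'_def numeral_2_eq_2 divide_inverse by (rule mult_minus_left[symmetric])
    ultimately show ?thesis by (simp only:)
  qed
  moreover have "\<bar>w' x\<bar> \<le> \<theta> * tempered_weight \<theta> \<epsilon> x" for x
  proof -
    have p: "0 < ?d x" by (rule tempered_weight_denom_pos)
    have q: "0 \<le> \<theta> * exp (- \<theta> * x)" "0 \<le> \<epsilon> * (\<theta> * exp (\<theta> * x))" using \<theta> \<epsilon> by auto
    have "\<bar>w' x\<bar> = \<bar>- (- \<theta> * exp (- \<theta> * x) + \<epsilon> * (\<theta> * exp (\<theta> * x)))\<bar> / (?d x)\<^sup>2"
      unfolding w'_def abs_divide by simp
    also have "\<dots> \<le> (\<theta> * exp (- \<theta> * x) + \<epsilon> * (\<theta> * exp (\<theta> * x))) / (?d x)\<^sup>2"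
      using q by (intro divide_right_mono) auto
    also have "\<dots> = \<theta> * ?d x / (?d x)\<^sup>2" by (simp add: algebra_simps)
    also have "\<dots> = \<theta> * tempered_weight \<theta> \<epsilon> x"
      unfolding tempered_weight_def using p by (simp add: power2_eq_square)
    finally show ?thesis .
  qed
  ultimately show ?thesis by (rule that)
qed

lemma tempered_weight_limits:
  "(tempered_weight \<theta> \<epsilon> \<longlongrightarrow> 0) at_top" "(tempered_weight \<theta> \<epsilon> \<longlongrightarrow> 0) at_bot"
proof -
  have "filterlim (\<lambda>y. - \<theta> * y) at_bot at_top"
    using \<theta> by (intro filterlim_tendsto_neg_mult_at_bot[OF tendsto_const]) (auto simp: filterlim_ident)
  then have "((\<lambda>y. exp (- \<theta> * y)) \<longlongrightarrow> 0) at_top" by (rule filterlim_compose[OF exp_at_bot])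
  from tendsto_divide[OF this tendsto_const[of \<epsilon>]] have l: "((\<lambda>y. exp (- \<theta> * y) / \<epsilon>) \<longlongrightarrow> 0) at_top"
    using \<epsilon> by simp
  show "(tempered_weight \<theta> \<epsilon> \<longlongrightarrow> 0) at_top"
    by (rule tendsto_sandwich[OF _ _ tendsto_const l])
       (auto intro!: always_eventually tempered_weight_le_exp_minus[simplified] less_imp_le tempered_weight_pos)
  have "filterlim (\<lambda>y. \<theta> * y) at_bot at_bot"
    using \<theta> by (intro filterlim_tendsto_pos_mult_at_bot[OF tendsto_const]) (auto simp: filterlim_ident)
  then have l: "((\<lambda>y. exp (\<theta> * y)) \<longlongrightarrow> 0) at_bot" by (rule filterlim_compose[OF exp_at_bot])
  show "(tempered_weight \<theta> \<epsilon> \<longlongrightarrow> 0) at_bot"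
    by (rule tendsto_sandwich[OF _ _ tendsto_const l])
       (auto intro!: always_eventually tempered_weight_le_exp less_imp_le tempered_weight_pos)
qed

end


section \<open>Persistence of decay for moving averages\<close>

lemma has_derivative_moving_integral:
  fixes f :: "real \<Rightarrow> real"
  assumes f: "continuous_on UNIV f" and k: "0 < k"
  shows "((\<lambda>x. integral {x..x+k} f) has_real_derivative f (x + k) - f x) (at x)"
proof -
  \<comment> \<open>A base point to the left of \<open>x\<close>, so that both end points of the moving interval are interior.\<close>
  define a where "a = x - 1"
  have fi: "f integrable_on {c..d}" for c d
    using f by (intro integrable_continuous_interval) (auto intro: continuous_on_subset)
  have F: "((\<lambda>y. integral {a..y} f) has_real_derivative f y) (at y)" if "a < y" for y
  proof -
    have "((\<lambda>y. integral {a..y} f) has_real_derivative f y) (at y within {a..y+1})"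
      using that by (intro integral_has_real_derivative) (auto intro: continuous_on_subset[OF f])
    moreover have "y \<in> interior {a..y+1}" using that by auto
    ultimately show ?thesis by (metis at_within_interior)
  qed
  have "((\<lambda>y. integral {a..y+k} f - integral {a..y} f) has_real_derivative f (x + k) * 1 - f x) (at x)"
  proof (rule DERIV_diff)
    have "((\<lambda>y. y + k) has_real_derivative 1) (at x)" by (auto intro!: derivative_eq_intros)
    then show "((\<lambda>y. integral {a..y+k} f) has_real_derivative f (x + k) * 1) (at x)"
      using k by (intro DERIV_chain2[OF F]) (auto simp: a_def)
  qed (rule F, simp add: a_def)
  then have "((\<lambda>y. integral {a..y+k} f - integral {a..y} f) has_real_derivative f (x + k) - f x) (at x)" by simp
  then show ?thesis
  proof (rule has_field_derivative_transform_within_open[where S = "{a<..}"])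
    fix y assume "y \<in> {a<..}"
    then have "integral {a..y} f + integral {y..y+k} f = integral {a..y+k} f"
      using k by (intro Henstock_Kurzweil_Integration.integral_combine fi) auto
    then show "integral {a..y+k} f - integral {a..y} f = integral {y..y+k} f" by simp
  qed (auto simp: a_def)
qed

lemma integral_abs_le_length:
  fixes f :: "real \<Rightarrow> real"
  assumes "f integrable_on {x..x+k}" "0 \<le> k" "\<And>y. y \<in> {x..x+k} \<Longrightarrow> \<bar>f y\<bar> \<le> B"
  shows "\<bar>integral {x..x+k} f\<bar> \<le> B * k"
  using integral_norm_bound_integral[OF assms(1) integrable_const_ivl[of B x "x+k"]] assms by (simp add: mult.commute)


text \<open>
  What the persistence argument uses of a solution: Lipschitz bounds, the equation integrated over an
  interval of length \<open>k\<close> with an error of order \<open>k\<^sup>2\<close>, and the transfer of weighted bounds from \<open>u\<close>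
  to the differences of \<open>P\<close>. Here \<open>R t x k\<close> is the time derivative of the integral of \<open>u t\<close> over
  \<open>{x..x+k}\<close>.
\<close>

locale averaged_transport =
  fixes u P :: "real \<Rightarrow> real \<Rightarrow> real" and R :: "real \<Rightarrow> real \<Rightarrow> real \<Rightarrow> real" and M C \<theta> T :: real
  assumes M: "0 \<le> M" and C: "0 \<le> C" and \<theta>: "0 < \<theta>"
    and bdd: "\<And>t x. 0 \<le> t \<Longrightarrow> t < T \<Longrightarrow> \<bar>u t x\<bar> \<le> M"
    and lip: "\<And>t x y. 0 \<le> t \<Longrightarrow> t < T \<Longrightarrow> \<bar>u t x - u t y\<bar> \<le> M * \<bar>x - y\<bar>"
    and deriv: "\<And>t x k. 0 \<le> t \<Longrightarrow> t < T \<Longrightarrow> 0 < k \<Longrightarrow>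
        ((\<lambda>s. integral {x..x+k} (u s)) has_real_derivative R t x k) (at t)"
    and eqn: "\<And>t x k. 0 \<le> t \<Longrightarrow> t < T \<Longrightarrow> 0 < k \<Longrightarrow>
        \<bar>R t x k + u t x * (u t (x + k) - u t x) + (P t (x + k) - P t x)\<bar> \<le> M\<^sup>2 * k\<^sup>2"
    and P_bounds: "\<And>t w S x h k. \<lbrakk>0 \<le> t; t < T; \<And>y. 0 < w y; \<And>x y. w x \<le> exp (\<theta> * \<bar>x - y\<bar>) * w y; 0 \<le> S;
        \<And>y. w y * \<bar>u t y\<bar> \<le> S; \<And>y h. 0 < h \<Longrightarrow> h \<le> 1 \<Longrightarrow> w y * \<bar>u t (y + h) - u t y\<bar> \<le> S * h;
        0 < k; k \<le> h; h \<le> 1\<rbrakk> \<Longrightarrow>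
        w x * \<bar>P t (x + k) - P t x\<bar> \<le> C * S * k \<and>
        w x * \<bar>P t (x + h + k) - P t (x + h) - (P t (x + k) - P t x)\<bar> \<le> C * S * h * k"
begin

text \<open>
  Large enough for the maximum principle to halve bounds: \<open>M * \<theta>\<close> compensates the motion of the
  weight, and the remainder dominates twice the coefficient \<open>M + C\<close> of the forcing.
\<close>

definition growth_rate :: real where "growth_rate = M * \<theta> + 2 * (M + C) + 1"

definition avg :: "real \<Rightarrow> real \<Rightarrow> real \<Rightarrow> real" where
  "avg k t x = integral {x..x+k} (u t) / k"

lemma continuous_u: assumes "0 \<le> t" "t < T" shows "continuous_on A (u t)"
  unfolding continuous_on_def
proof
  fix x assume "x \<in> A"
  have "((\<lambda>y. u t y - u t x) \<longlongrightarrow> 0) (at x within A)"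
  proof (rule Lim_null_comparison)
    show "\<forall>\<^sub>F y in at x within A. norm (u t y - u t x) \<le> M * \<bar>y - x\<bar>"
      using lip[OF assms] by (simp add: always_eventually)
    have "((\<lambda>y. M * \<bar>y - x\<bar>) \<longlongrightarrow> M * \<bar>x - x\<bar>) (at x within A)" by (intro tendsto_intros)
    then show "((\<lambda>y. M * \<bar>y - x\<bar>) \<longlongrightarrow> 0) (at x within A)" by simp
  qed
  then show "(u t \<longlongrightarrow> u t x) (at x within A)" using LIM_zero_iff by blast
qed

lemma integrable_u: "0 \<le> t \<Longrightarrow> t < T \<Longrightarrow> u t integrable_on {a..b}"
  by (intro integrable_continuous_interval continuous_u)

lemma avg_bound:
  assumes t: "0 \<le> t" "t < T" and k: "0 < k" and B: "\<And>y. y \<in> {x..x+k} \<Longrightarrow> \<bar>u t y\<bar> \<le> B"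
  shows "\<bar>avg k t x\<bar> \<le> B"
  using integral_abs_le_length[OF integrable_u[OF t], of k x B] k B
  by (simp add: avg_def pos_divide_le_eq)

lemma avg_near:
  assumes t: "0 \<le> t" "t < T" and k: "0 < k"
  shows "\<bar>avg k t x - u t x\<bar> \<le> M * k"
proof -
  have "integral {x..x+k} (\<lambda>y. u t y - u t x) = integral {x..x+k} (u t) - u t x * k"
    using integrable_u[OF t] k by (subst Henstock_Kurzweil_Integration.integral_diff) (auto simp: mult.commute)
  moreover have "\<bar>integral {x..x+k} (\<lambda>y. u t y - u t x)\<bar> \<le> (M * k) * k"
  proof (rule integral_abs_le_length)
    fix y assume y: "y \<in> {x..x+k}"
    have "\<bar>u t y - u t x\<bar> \<le> M * \<bar>y - x\<bar>" by (rule lip[OF t])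
    also have "\<dots> \<le> M * k" using y M by (intro mult_left_mono) auto
    finally show "\<bar>u t y - u t x\<bar> \<le> M * k" .
  qed (use integrable_u[OF t] k in \<open>auto intro!: Henstock_Kurzweil_Integration.integrable_diff\<close>)
  moreover have "avg k t x - u t x = (integral {x..x+k} (u t) - u t x * k) / k"
    using k by (simp add: avg_def field_simps)
  ultimately show ?thesis using k by (simp add: pos_divide_le_eq)
qed

lemma avg_difference:
  assumes t: "0 \<le> t" "t < T" and k: "0 < k" and B: "\<And>y. y \<in> {x..x+k} \<Longrightarrow> \<bar>u t (y + h) - u t y\<bar> \<le> B"
  shows "\<bar>avg k t (x + h) - avg k t x\<bar> \<le> B"
proof -
  have i: "(\<lambda>y. u t (y + h)) integrable_on {x..x+k}"
    by (intro integrable_continuous_interval continuous_on_compose2[OF continuous_u[OF t, of UNIV]] continuous_intros) auto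
  have "((\<lambda>y. u t (y + h)) has_integral integral {x+h..x+h+k} (u t)) {x..x+k}"
  proof -
    have "((u t) has_integral integral {x+h..x+h+k} (u t)) {x+h..x+h+k}"
      by (intro integrable_integral integrable_u[OF t])
    from has_integral_affinity[of "u t" _ "x+h" "x+h+k" 1 h, unfolded cbox_interval, OF this]
    show ?thesis by (simp add: add.commute algebra_simps)
  qed
  then have "integral {x..x+k} (\<lambda>y. u t (y + h) - u t y) = integral {x+h..x+h+k} (u t) - integral {x..x+k} (u t)"
    using integrable_u[OF t] i by (subst Henstock_Kurzweil_Integration.integral_diff) (auto simp: integral_unique)
  moreover have "\<bar>integral {x..x+k} (\<lambda>y. u t (y + h) - u t y)\<bar> \<le> B * k"
    using integrable_u[OF t] i k B
    by (intro integral_abs_le_length) (auto intro!: Henstock_Kurzweil_Integration.integrable_diff)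
  moreover have "avg k t (x + h) - avg k t x = (integral {x+h..x+h+k} (u t) - integral {x..x+k} (u t)) / k"
    by (simp add: avg_def diff_divide_distrib)
  ultimately show ?thesis using k by (simp add: pos_divide_le_eq)
qed

lemma avg_Lipschitz:
  assumes t: "0 \<le> t" "t < T" and k: "0 < k"
  shows "\<bar>avg k t x - avg k t y\<bar> \<le> M * \<bar>x - y\<bar>"
proof -
  have "\<bar>u t (z + (x - y)) - u t z\<bar> \<le> M * \<bar>x - y\<bar>" for z
    using lip[OF t, of "z + (x - y)" z] by simp
  then show ?thesis using avg_difference[OF t k, of y "x - y" "M * \<bar>x - y\<bar>"] by simp
qed

lemma avg_dx:
  assumes t: "0 \<le> t" "t < T" and k: "0 < k"
  shows "(avg k t has_real_derivative (u t (x + k) - u t x) / k) (at x)"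
  unfolding avg_def[abs_def] by (intro DERIV_cdivide has_derivative_moving_integral continuous_u t k)

lemma avg_dt:
  assumes t: "0 \<le> t" "t < T" and k: "0 < k"
  shows "((\<lambda>s. avg k s x) has_real_derivative R t x k / k) (at t)"
  unfolding avg_def by (intro DERIV_cdivide deriv t k)

lemma avg_continuous:
  assumes "t1 < T" and k: "0 < k"
  shows "continuous_on ({0..t1} \<times> B) (\<lambda>p. avg k (fst p) (snd p))"
proof (rule continuous_on_pair_of_Lipschitz)
  show "continuous_on {0..t1} (\<lambda>t. avg k t x)" for x
  proof (intro continuous_at_imp_continuous_on ballI)
    fix t assume "t \<in> {0..t1}"
    then show "isCont (\<lambda>t. avg k t x) t" using assms(1) by (intro DERIV_isCont[OF avg_dt[OF _ _ k]]) auto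
  qed
  show "\<bar>avg k t x - avg k t y\<bar> \<le> M * \<bar>x - y\<bar>" if "t \<in> {0..t1}" for t x y
    using that assms by (intro avg_Lipschitz) auto
qed


lemma growth_rate: "0 < growth_rate - M * \<theta>" "M * \<theta> < growth_rate" "2 * (M + C) \<le> growth_rate - M * \<theta>"
  using M C by (simp_all add: growth_rate_def)

text \<open>
  The time interval and the weight are parameters rather than fixed in the context, since the bound
  is used for all \<open>\<epsilon>\<close> at once in the end.
\<close>

definition weighted_bound :: "real \<Rightarrow> real \<Rightarrow> real \<Rightarrow> bool" where
  "weighted_bound \<epsilon> t1 S \<longleftrightarrow> (\<forall>t\<in>{0..t1}. \<forall>x.
     tempered_weight \<theta> \<epsilon> x * \<bar>u t x\<bar> \<le> S * exp (growth_rate * t) \<and>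
     (\<forall>h. 0 < h \<and> h \<le> 1 \<longrightarrow>
       tempered_weight \<theta> \<epsilon> x * \<bar>u t (x + h) - u t x\<bar> \<le> S * exp (growth_rate * t) * h))"

context
  fixes K \<epsilon> t1 :: real
  assumes K: "0 \<le> K" and \<epsilon>: "0 < \<epsilon>" and t1: "0 \<le> t1" "t1 < T"
    and init: "\<And>x. \<bar>u 0 x\<bar> \<le> K * exp (- \<theta> * x)"
    and init': "\<And>x h. 0 < h \<Longrightarrow> h \<le> 1 \<Longrightarrow> \<bar>u 0 (x + h) - u 0 x\<bar> \<le> K * exp (- \<theta> * x) * h"
begin

abbreviation "wt \<equiv> tempered_weight \<theta> \<epsilon>"
abbreviation "wmax \<equiv> 1 + 1 / \<epsilon>"

abbreviation "wbound \<equiv> weighted_bound \<epsilon> t1"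

lemma weight_facts:
  "0 < wt x" "wt x \<le> wmax" "wt x \<le> exp (\<theta> * \<bar>x - y\<bar>) * wt y" "0 < wmax" "wt x \<le> exp (\<theta> * x)"
  using tempered_weight_pos[OF \<theta> \<epsilon>] tempered_weight_bounded[OF \<theta> \<epsilon>] tempered_weight_slow[OF \<theta> \<epsilon>]
    tempered_weight_le_exp[OF \<theta> \<epsilon>] \<epsilon> by (auto simp: add_pos_pos)

lemma weighted_init:
  assumes "\<bar>X\<bar> \<le> B * exp (- \<theta> * x)" "0 \<le> B"
  shows "wt x * \<bar>X\<bar> \<le> B"
proof -
  have "wt x * \<bar>X\<bar> \<le> exp (\<theta> * x) * (B * exp (- \<theta> * x))"
    using assms weight_facts(1,5)[of x] by (intro mult_mono) auto
  also have "\<dots> = B" by (simp add: exp_minus)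
  finally show ?thesis .
qed

lemma max_step_le:
  assumes "0 \<le> S" "0 \<le> A" "A \<le> M + C"
  shows "max K (A * S / (growth_rate - M * \<theta>)) \<le> max K (S / 2)"
proof -
  have "A * S \<le> (growth_rate - M * \<theta>) / 2 * S"
    using growth_rate(3) assms by (intro mult_right_mono) auto
  then have "A * S / (growth_rate - M * \<theta>) \<le> S / 2"
    using growth_rate(1) by (simp add: field_simps)
  then show ?thesis by linarith
qed

lemma P_weighted:
  assumes "wbound S" "0 \<le> S" "t \<in> {0..t1}" "0 < k" "k \<le> h" "h \<le> 1"
  shows "wt x * \<bar>P t (x + k) - P t x\<bar> \<le> C * (S * exp (growth_rate * t)) * k"
    and "wt x * \<bar>P t (x + h + k) - P t (x + h) - (P t (x + k) - P t x)\<bar> \<le> C * (S * exp (growth_rate * t)) * h * k"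
  using P_bounds[of t wt "S * exp (growth_rate * t)" k h x] assms t1 weight_facts
  unfolding weighted_bound_def by auto

lemma exp_growth_ge_1: "0 \<le> t \<Longrightarrow> 1 \<le> exp (growth_rate * t)"
  using growth_rate(2) mult_nonneg_nonneg[OF M less_imp_le[OF \<theta>]] by simp

text \<open>
  The maximum principle for \<open>u\<^sup>k\<close>. The forcing is \<open>(P (x + k) - P x) / k\<close>, plus the commutator
  error \<open>M\<^sup>2 * k\<close>.
\<close>

lemma value_bound_avg:
  assumes S: "wbound S" "0 \<le> S" and t: "t \<in> {0..t1}" and k: "0 < k" "k \<le> 1"
  shows "wt x * \<bar>avg k t x\<bar> \<le>
    max K ((C * S + M\<^sup>2 * k * wmax) / (growth_rate - M * \<theta>)) * exp (growth_rate * t)"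
proof -
  obtain w' where w': "\<And>x. (wt has_real_derivative w' x) (at x)" "\<And>x. \<bar>w' x\<bar> \<le> \<theta> * wt x"
    using tempered_weight_derivative[OF \<theta> \<epsilon>] by blast
  show ?thesis
  proof (rule transport_maximum_principle[where v = "avg k" and vt = "\<lambda>t x. R t x k / k"
        and vx = "\<lambda>t x. (u t (x + k) - u t x) / k" and a = u and D = M and w' = w',
        OF t1(1) growth_rate(2) M avg_continuous[OF t1(2) k(1)] _ _ weight_facts(1) w' tempered_weight_limits[OF \<theta> \<epsilon>]])
    fix t x assume t: "0 < t" "t \<le> t1"
    then have t': "0 \<le> t" "t < T" "t \<in> {0..t1}" using t1 by auto
    show "((\<lambda>s. avg k s x) has_real_derivative R t x k / k) (at t)" by (rule avg_dt[OF t'(1,2) k(1)])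
    show "(avg k t has_real_derivative (u t (x + k) - u t x) / k) (at x)" by (rule avg_dx[OF t'(1,2) k(1)])
    show "\<bar>u t x\<bar> \<le> M" by (rule bdd[OF t'(1,2)])
    have "\<bar>R t x k / k + u t x * ((u t (x + k) - u t x) / k)\<bar> = \<bar>R t x k + u t x * (u t (x + k) - u t x)\<bar> / k"
      using k by (simp add: add_divide_distrib[symmetric])
    also have "\<dots> \<le> (\<bar>P t (x + k) - P t x\<bar> + M\<^sup>2 * k\<^sup>2) / k"
      using eqn[OF t'(1,2) k(1), of x] k by (intro divide_right_mono) linarith+
    finally have "wt x * \<bar>R t x k / k + u t x * ((u t (x + k) - u t x) / k)\<bar>
       \<le> wt x * ((\<bar>P t (x + k) - P t x\<bar> + M\<^sup>2 * k\<^sup>2) / k)"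
      using weight_facts(1)[of x] by (intro mult_left_mono) auto
    also have "\<dots> = (wt x * \<bar>P t (x + k) - P t x\<bar> + wt x * (M\<^sup>2 * k\<^sup>2)) / k" by (simp add: distrib_left)
    also have "\<dots> \<le> (C * (S * exp (growth_rate * t)) * k + wmax * (M\<^sup>2 * k\<^sup>2)) / k"
      using P_weighted(1)[OF S t'(3) k(1) order_refl k(2), of x] weight_facts(2)[of x] k
      by (intro divide_right_mono add_mono mult_right_mono) auto
    also have "\<dots> = C * S * exp (growth_rate * t) + M\<^sup>2 * k * wmax * 1"
      using k by (simp add: power2_eq_square add_divide_distrib)
    also have "\<dots> \<le> C * S * exp (growth_rate * t) + M\<^sup>2 * k * wmax * exp (growth_rate * t)"
      using k weight_facts(4) t' exp_growth_ge_1[of t] by (intro add_left_mono mult_left_mono) auto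
    finally show "wt x * \<bar>R t x k / k + u t x * ((u t (x + k) - u t x) / k)\<bar> \<le> (C * S + M\<^sup>2 * k * wmax) * exp (growth_rate * t)"
      by (simp add: distrib_right)
  next
    fix t x assume "0 \<le> t" "t \<le> t1"
    then show "\<bar>avg k t x\<bar> \<le> M" using t1 k bdd by (intro avg_bound) auto
  next
    fix x
    have "\<bar>avg k 0 x\<bar> \<le> K * exp (- \<theta> * x)"
    proof (rule avg_bound)
      fix y assume "y \<in> {x..x+k}"
      then have "K * exp (- \<theta> * y) \<le> K * exp (- \<theta> * x)" using K \<theta> by (intro mult_left_mono) auto
      then show "\<bar>u 0 y\<bar> \<le> K * exp (- \<theta> * x)" using init[of y] by linarith
    qed (use t1 k in auto)
    then show "wt x * \<bar>avg k 0 x\<bar> \<le> K" using K by (rule weighted_init)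
  qed (use t in auto)
qed

text \<open>
  The maximum principle for \<open>(u\<^sup>k(x + h) - u\<^sup>k(x)) / h\<close>, transported with velocity \<open>u (x + h)\<close>. By the
  discrete product rule the forcing is the second difference of \<open>P\<close> over \<open>h * k\<close>, plus
  \<open>(u (x + h) - u x) / h * (u (x + k) - u x) / k\<close>, the counterpart of \<open>u\<^sub>x\<^sup>2\<close>, whose second
  factor is at most \<open>M\<close>. The commutator error is divided by \<open>h\<close>, which is harmless as \<open>k\<close> tends to 0 first.
\<close>

lemma difference_bound_avg:
  assumes S: "wbound S" "0 \<le> S" and t: "t \<in> {0..t1}" and k: "0 < k" "k \<le> h" "h \<le> 1"
  shows "wt x * \<bar>(avg k t (x + h) - avg k t x) / h\<bar> \<le>
    max K (((M + C) * S + 2 * M\<^sup>2 * k * wmax / h) / (growth_rate - M * \<theta>)) * exp (growth_rate * t)"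
proof -
  have h: "0 < h" using k by simp
  obtain w' where w': "\<And>x. (wt has_real_derivative w' x) (at x)" "\<And>x. \<bar>w' x\<bar> \<le> \<theta> * wt x"
    using tempered_weight_derivative[OF \<theta> \<epsilon>] by blast
  let ?v = "\<lambda>t x. (avg k t (x + h) - avg k t x) / h"
  have cont: "continuous_on ({0..t1} \<times> B) (\<lambda>p. ?v (fst p) (snd p))" for B
  proof -
    have "continuous_on ({0..t1} \<times> B) (\<lambda>p. avg k (fst p) (snd p + h))"
    proof -
      have "continuous_on ({0..t1} \<times> B) (\<lambda>p. (fst p, snd p + h))" by (intro continuous_intros)
      moreover have "(\<lambda>p. (fst p, snd p + h)) ` ({0..t1} \<times> B) \<subseteq> {0..t1} \<times> UNIV" by auto
      ultimately show ?thesis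
        using continuous_on_compose2[OF avg_continuous[OF t1(2) k(1), of UNIV], of "{0..t1} \<times> B" "\<lambda>p. (fst p, snd p + h)"]
        by simp
    qed
    then show ?thesis using h by (intro continuous_intros avg_continuous t1 k) auto
  qed
  show ?thesis
  proof (rule transport_maximum_principle[where v = ?v and vt = "\<lambda>t x. (R t (x + h) k / k - R t x k / k) / h"
        and vx = "\<lambda>t x. ((u t (x + h + k) - u t (x + h)) / k - (u t (x + k) - u t x) / k) / h"
        and a = "\<lambda>t x. u t (x + h)" and D = M and w' = w',
        OF t1(1) growth_rate(2) M cont _ _ weight_facts(1) w' tempered_weight_limits[OF \<theta> \<epsilon>]])
    fix t x assume t: "0 < t" "t \<le> t1"
    then have t': "0 \<le> t" "t < T" "t \<in> {0..t1}" using t1 by auto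
    show "((\<lambda>s. ?v s x) has_real_derivative (R t (x + h) k / k - R t x k / k) / h) (at t)"
      by (intro DERIV_cdivide DERIV_diff avg_dt[OF t'(1,2) k(1)])
    have sh: "((\<lambda>x. x + h) has_real_derivative 1) (at x)" by (auto intro!: derivative_eq_intros)
    show "(?v t has_real_derivative ((u t (x + h + k) - u t (x + h)) / k - (u t (x + k) - u t x) / k) / h) (at x)"
      using DERIV_chain2[OF avg_dx[OF t'(1,2) k(1)] sh] by (intro DERIV_cdivide DERIV_diff avg_dx[OF t'(1,2) k(1)]) simp
    show "\<bar>u t (x + h)\<bar> \<le> M" by (rule bdd[OF t'(1,2)])
    define E where "E = exp (growth_rate * t)"
    define d where "d = u t (x + h) - u t x"
    define dk where "dk = u t (x + k) - u t x"
    define DP where "DP = P t (x + h + k) - P t (x + h) - (P t (x + k) - P t x)"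
    let ?Q = "(R t (x + h) k / k - R t x k / k) / h + u t (x + h) * (((u t (x + h + k) - u t (x + h)) / k - (u t (x + k) - u t x) / k) / h)"
    have "?Q = (R t (x + h) k - R t x k + u t (x + h) * (u t (x + h + k) - u t (x + h) - dk)) / (k * h)"
      using k h by (simp add: dk_def field_simps)
    also have "\<bar>\<dots>\<bar> = \<bar>R t (x + h) k - R t x k + u t (x + h) * (u t (x + h + k) - u t (x + h) - dk)\<bar> / (k * h)"
      using k h by (simp add: abs_mult)
    also have "\<dots> \<le> (\<bar>d * dk\<bar> + \<bar>DP\<bar> + 2 * (M\<^sup>2 * k\<^sup>2)) / (k * h)"
    proof (rule divide_right_mono)
      \<comment> \<open>The averaged equation at \<open>x + h\<close> minus the one at \<open>x\<close>; the velocities differ by \<open>d\<close>.\<close>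
      have "R t (x + h) k - R t x k + u t (x + h) * (u t (x + h + k) - u t (x + h) - dk)
        = (R t (x + h) k + u t (x + h) * (u t (x + h + k) - u t (x + h)) + (P t (x + h + k) - P t (x + h)))
          - (R t x k + u t x * dk + (P t (x + k) - P t x)) - DP - d * dk"
        by (simp add: DP_def d_def algebra_simps)
      then show "\<bar>R t (x + h) k - R t x k + u t (x + h) * (u t (x + h + k) - u t (x + h) - dk)\<bar> \<le> \<bar>d * dk\<bar> + \<bar>DP\<bar> + 2 * (M\<^sup>2 * k\<^sup>2)"
        using eqn[OF t'(1,2) k(1), of "x + h"] eqn[OF t'(1,2) k(1), of x] unfolding dk_def by linarith
    qed (use k h in auto)
    finally have "wt x * \<bar>?Q\<bar> \<le> wt x * ((\<bar>d * dk\<bar> + \<bar>DP\<bar> + 2 * (M\<^sup>2 * k\<^sup>2)) / (k * h))"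
      using weight_facts(1)[of x] by (intro mult_left_mono) auto
    also have "\<dots> = (wt x * \<bar>d\<bar> * \<bar>dk\<bar> + wt x * \<bar>DP\<bar> + wt x * (2 * (M\<^sup>2 * k\<^sup>2))) / (k * h)"
      by (simp add: abs_mult distrib_left mult.assoc)
    also have "\<dots> \<le> (S * E * h * (M * k) + C * (S * E) * h * k + wmax * (2 * (M\<^sup>2 * k\<^sup>2))) / (k * h)"
    proof (intro divide_right_mono add_mono)
      have "wt x * \<bar>d\<bar> \<le> S * E * h"
        using S(1) t'(3) h k unfolding weighted_bound_def d_def E_def by blast
      moreover have "\<bar>dk\<bar> \<le> M * k" using lip[OF t'(1,2), of "x + k" x] k by (simp add: dk_def)
      ultimately show "wt x * \<bar>d\<bar> * \<bar>dk\<bar> \<le> S * E * h * (M * k)"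
        by (rule mult_mono) (use S(2) h in \<open>auto simp: E_def\<close>)
      show "wt x * \<bar>DP\<bar> \<le> C * (S * E) * h * k"
        unfolding DP_def E_def by (rule P_weighted(2)[OF S t'(3) k])
      show "wt x * (2 * (M\<^sup>2 * k\<^sup>2)) \<le> wmax * (2 * (M\<^sup>2 * k\<^sup>2))"
        using weight_facts(2) by (intro mult_right_mono) auto
    qed (use k h in auto)
    also have "\<dots> = (M + C) * S * E + 2 * M\<^sup>2 * k * wmax / h * 1"
      using k h by (simp add: divide_simps power2_eq_square) (simp add: algebra_simps)
    also have "\<dots> \<le> (M + C) * S * E + 2 * M\<^sup>2 * k * wmax / h * E"
      using k h weight_facts(4) t' exp_growth_ge_1[of t] unfolding E_def
      by (intro add_left_mono mult_left_mono) auto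
    also have "\<dots> = ((M + C) * S + 2 * M\<^sup>2 * k * wmax / h) * E" by (simp only: distrib_right)
    finally show "wt x * \<bar>?Q\<bar> \<le> ((M + C) * S + 2 * M\<^sup>2 * k * wmax / h) * exp (growth_rate * t)"
      unfolding E_def .
  next
    fix t x assume t: "0 \<le> t" "t \<le> t1"
    then have "\<bar>avg k t (x + h) - avg k t x\<bar> \<le> M * \<bar>x + h - x\<bar>" using t1 k by (intro avg_Lipschitz) auto
    then show "\<bar>?v t x\<bar> \<le> M" using h by (simp add: pos_divide_le_eq)
  next
    fix x
    have "\<bar>avg k 0 (x + h) - avg k 0 x\<bar> \<le> K * exp (- \<theta> * x) * h"
    proof (rule avg_difference)
      fix y assume "y \<in> {x..x+k}"
      then have "K * exp (- \<theta> * y) * h \<le> K * exp (- \<theta> * x) * h" using K \<theta> h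
        by (intro mult_right_mono mult_left_mono) auto
      then show "\<bar>u 0 (y + h) - u 0 y\<bar> \<le> K * exp (- \<theta> * x) * h" using init'[OF h k(3), of y] by linarith
    qed (use t1 k in auto)
    then have "\<bar>?v 0 x\<bar> \<le> K * exp (- \<theta> * x)" using h by (simp add: pos_divide_le_eq)
    then show "wt x * \<bar>?v 0 x\<bar> \<le> K" using K by (rule weighted_init)
  qed (use t in auto)
qed

text \<open>
  Let \<open>k\<close> tend to 0 in the bounds for the averages.
\<close>

lemma weighted_bound_improve:
  assumes S: "wbound S" "0 \<le> S"
  shows "wbound (max K (S / 2))"
  unfolding weighted_bound_def
proof (intro ballI allI conjI impI)
  fix t x assume t: "t \<in> {0..t1}"
  then have t': "0 \<le> t" "t < T" using t1 by auto
  let ?E = "exp (growth_rate * t)" and ?c = "growth_rate - M * \<theta>"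
  have c: "?c \<noteq> 0" using growth_rate(1) by simp
  have "((\<lambda>k. max K ((C * S + M\<^sup>2 * k * wmax) / ?c) * ?E + wmax * (M * k))
      \<longlongrightarrow> max K ((C * S + M\<^sup>2 * 0 * wmax) / ?c) * ?E + wmax * (M * 0)) (at_right 0)"
    using c by (intro tendsto_intros tendsto_max) auto
  moreover have "\<forall>\<^sub>F k in at_right 0. wt x * \<bar>u t x\<bar> \<le> max K ((C * S + M\<^sup>2 * k * wmax) / ?c) * ?E + wmax * (M * k)"
    unfolding eventually_at_right_field
  proof (intro exI[of _ 1] conjI allI impI)
    fix k :: real assume k: "0 < k" "k < 1"
    have "wt x * \<bar>u t x\<bar> \<le> wt x * \<bar>avg k t x\<bar> + wt x * (M * k)"
      using avg_near[OF t' k(1), of x] weight_facts(1)[of x]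
      unfolding distrib_left[symmetric] by (intro mult_left_mono) auto
    also have "\<dots> \<le> max K ((C * S + M\<^sup>2 * k * wmax) / ?c) * ?E + wmax * (M * k)"
      using value_bound_avg[OF S t, of k x] k weight_facts(2)[of x] M by (intro add_mono mult_right_mono) auto
    finally show "wt x * \<bar>u t x\<bar> \<le> max K ((C * S + M\<^sup>2 * k * wmax) / ?c) * ?E + wmax * (M * k)" .
  qed simp
  ultimately have "wt x * \<bar>u t x\<bar> \<le> max K ((C * S + M\<^sup>2 * 0 * wmax) / ?c) * ?E + wmax * (M * 0)"
    by (rule tendsto_lowerbound) simp
  also have "\<dots> = max K (C * S / ?c) * ?E" by simp
  also have "\<dots> \<le> max K (S / 2) * ?E"
    using max_step_le[OF S(2) C] M by (intro mult_right_mono) auto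
  finally show "wt x * \<bar>u t x\<bar> \<le> max K (S / 2) * ?E" .
next
  fix t x h :: real assume t: "t \<in> {0..t1}" and h: "0 < h \<and> h \<le> 1"
  then have t': "0 \<le> t" "t < T" using t1 by auto
  let ?E = "exp (growth_rate * t)" and ?c = "growth_rate - M * \<theta>"
  have c: "?c \<noteq> 0" using growth_rate(1) by simp
  have "((\<lambda>k. max K (((M + C) * S + 2 * M\<^sup>2 * k * wmax / h) / ?c) * ?E + wmax * (2 * M * k / h))
      \<longlongrightarrow> max K (((M + C) * S + 2 * M\<^sup>2 * 0 * wmax / h) / ?c) * ?E + wmax * (2 * M * 0 / h)) (at_right 0)"
    using c h by (intro tendsto_intros tendsto_max) auto
  moreover have "\<forall>\<^sub>F k in at_right 0. wt x * \<bar>(u t (x + h) - u t x) / h\<bar>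
      \<le> max K (((M + C) * S + 2 * M\<^sup>2 * k * wmax / h) / ?c) * ?E + wmax * (2 * M * k / h)"
    unfolding eventually_at_right_field
  proof (intro exI[of _ h] conjI allI impI)
    fix k :: real assume k: "0 < k" "k < h"
    have "\<bar>u t (x + h) - u t x\<bar> \<le> \<bar>avg k t (x + h) - avg k t x\<bar> + 2 * M * k"
      using avg_near[OF t' k(1), of x] avg_near[OF t' k(1), of "x + h"] by linarith
    then have "\<bar>(u t (x + h) - u t x) / h\<bar> \<le> \<bar>(avg k t (x + h) - avg k t x) / h\<bar> + 2 * M * k / h"
      using h by (simp add: divide_simps)
    then have "wt x * \<bar>(u t (x + h) - u t x) / h\<bar> \<le> wt x * \<bar>(avg k t (x + h) - avg k t x) / h\<bar> + wt x * (2 * M * k / h)"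
      unfolding distrib_left[symmetric] using weight_facts(1)[of x] by (intro mult_left_mono) auto
    also have "\<dots> \<le> max K (((M + C) * S + 2 * M\<^sup>2 * k * wmax / h) / ?c) * ?E + wmax * (2 * M * k / h)"
      using difference_bound_avg[OF S t, of k h x] k h weight_facts(2)[of x] M
      by (intro add_mono mult_right_mono) auto
    finally show "wt x * \<bar>(u t (x + h) - u t x) / h\<bar>
      \<le> max K (((M + C) * S + 2 * M\<^sup>2 * k * wmax / h) / ?c) * ?E + wmax * (2 * M * k / h)" .
  qed (use h in simp)
  ultimately have "wt x * \<bar>(u t (x + h) - u t x) / h\<bar> \<le> max K (((M + C) * S + 2 * M\<^sup>2 * 0 * wmax / h) / ?c) * ?E + wmax * (2 * M * 0 / h)"
    by (rule tendsto_lowerbound) simp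
  also have "\<dots> = max K ((M + C) * S / ?c) * ?E" by simp
  also have "\<dots> \<le> max K (S / 2) * ?E"
    using max_step_le[OF S(2), of "M + C"] M C by (intro mult_right_mono) auto
  finally show "wt x * \<bar>u t (x + h) - u t x\<bar> \<le> max K (S / 2) * ?E * h"
    using h by (simp add: pos_divide_le_eq)
qed

text \<open>
  Some finite bound to start the iteration; it may depend badly on \<open>\<epsilon>\<close>.
\<close>

lemma weighted_bound_initial: "wbound (wmax * M)"
  unfolding weighted_bound_def
proof (intro ballI allI conjI impI)
  fix t x assume t: "t \<in> {0..t1}"
  then have t': "0 \<le> t" "t < T" using t1 by auto
  have E: "wmax * M * 1 \<le> wmax * M * exp (growth_rate * t)"
    using exp_growth_ge_1[OF t'(1)] M weight_facts(4) by (intro mult_left_mono) auto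
  have "wt x * \<bar>u t x\<bar> \<le> wmax * M"
    using bdd[OF t', of x] weight_facts(1,2)[of x] weight_facts(4) by (intro mult_mono) auto
  then show "wt x * \<bar>u t x\<bar> \<le> wmax * M * exp (growth_rate * t)" using E by linarith
  fix h :: real assume h: "0 < h \<and> h \<le> 1"
  have "\<bar>u t (x + h) - u t x\<bar> \<le> M * h" using lip[OF t', of "x + h" x] h by simp
  then have "wt x * \<bar>u t (x + h) - u t x\<bar> \<le> wmax * (M * h)"
    using weight_facts(1,2)[of x] weight_facts(4) by (intro mult_mono) auto
  also have "\<dots> \<le> wmax * M * exp (growth_rate * t) * h"
    using mult_right_mono[OF E, of h] h by simp
  finally show "wt x * \<bar>u t (x + h) - u t x\<bar> \<le> wmax * M * exp (growth_rate * t) * h" .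
qed

text \<open>
  Iterating the improvement from any bound \<open>S\<close> gives \<open>max K (S / 2^n)\<close> for all \<open>n\<close>.
\<close>

lemma weighted_bound_final: "wbound K"
proof -
  have M0: "0 \<le> wmax * M" using M weight_facts(4) by (intro mult_nonneg_nonneg) auto
  have b: "wbound (max K (wmax * M / 2 ^ n))" for n
  proof (induction n)
    case 0
    have "S * exp (growth_rate * t) \<le> max K S * exp (growth_rate * t)" for S t by (intro mult_right_mono) auto
    then show ?case using weighted_bound_initial unfolding weighted_bound_def
      by (simp only: power_0 div_by_1) (meson mult_right_mono less_imp_le order_trans)
  next
    case (Suc n)
    have "max K (max K X / 2) = max K (X / 2)" for X using K by (auto simp: max_def)
    from this[of "wmax * M / 2 ^ n"] have "max K (max K (wmax * M / 2 ^ n) / 2) = max K (wmax * M / 2 ^ Suc n)"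
      by (simp add: mult.commute)
    then show ?case using weighted_bound_improve[OF Suc] K by (simp add: max.coboundedI1)
  qed
  have l: "(\<lambda>n. max K (wmax * M / 2 ^ n)) \<longlonglongrightarrow> K"
  proof -
    have "(\<lambda>n. wmax * M * (1 / 2) ^ n) \<longlonglongrightarrow> wmax * M * 0"
      by (intro tendsto_intros LIMSEQ_power_zero) auto
    then have "(\<lambda>n. max K (wmax * M * (1 / 2) ^ n)) \<longlonglongrightarrow> max K (wmax * M * 0)"
      by (rule tendsto_max[OF tendsto_const])
    moreover have "X / 2 ^ n = X * (1 / 2) ^ n" for X :: real and n :: nat
      by (simp add: power_one_over)
    ultimately show ?thesis using K by (simp only: mult_zero_right max_absorb1)
  qed
  show ?thesis unfolding weighted_bound_def
  proof (intro ballI allI conjI impI)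
    fix t x assume t: "t \<in> {0..t1}"
    show "wt x * \<bar>u t x\<bar> \<le> K * exp (growth_rate * t)"
      by (rule LIMSEQ_le_const[OF tendsto_mult[OF l tendsto_const]])
         (use b t in \<open>auto simp: weighted_bound_def\<close>)
    fix h :: real assume h: "0 < h \<and> h \<le> 1"
    show "wt x * \<bar>u t (x + h) - u t x\<bar> \<le> K * exp (growth_rate * t) * h"
      by (rule LIMSEQ_le_const[OF tendsto_mult[OF tendsto_mult[OF l tendsto_const] tendsto_const]])
         (use b t h in \<open>auto simp: weighted_bound_def\<close>)
  qed
qed

end

lemma le_of_tempered_weight_bounds:
  assumes "\<And>\<epsilon>. 0 < \<epsilon> \<Longrightarrow> tempered_weight \<theta> \<epsilon> x * X \<le> B"
  shows "X \<le> B * exp (- \<theta> * x)"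
proof (rule tendsto_lowerbound)
  show "((\<lambda>\<epsilon>. B * (exp (- \<theta> * x) + \<epsilon> * exp (\<theta> * x))) \<longlongrightarrow> B * exp (- \<theta> * x)) (at_right 0)"
    by (rule tendsto_eq_intros refl | simp)+
  show "\<forall>\<^sub>F \<epsilon> in at_right 0. X \<le> B * (exp (- \<theta> * x) + \<epsilon> * exp (\<theta> * x))"
    unfolding eventually_at_right_field
  proof (intro exI[of _ 1] conjI allI impI)
    fix \<epsilon> :: real assume e: "0 < \<epsilon>" "\<epsilon> < 1"
    show "X \<le> B * (exp (- \<theta> * x) + \<epsilon> * exp (\<theta> * x))"
      using assms[OF e(1)] tempered_weight_denom_pos[OF \<theta> e(1), of x]
      by (simp add: tempered_weight_def pos_divide_le_eq)
  qed simp
qed simp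

theorem decay_persists:
  assumes "0 \<le> K" "\<And>x. \<bar>u 0 x\<bar> \<le> K * exp (- \<theta> * x)"
    and "\<And>x h. 0 < h \<Longrightarrow> h \<le> 1 \<Longrightarrow> \<bar>u 0 (x + h) - u 0 x\<bar> \<le> K * exp (- \<theta> * x) * h"
    and t: "0 \<le> t" "t < T"
  shows "\<bar>u t x\<bar> \<le> K * exp (growth_rate * t) * exp (- \<theta> * x)"
    and "0 < h \<Longrightarrow> h \<le> 1 \<Longrightarrow> \<bar>u t (x + h) - u t x\<bar> \<le> K * exp (growth_rate * t) * exp (- \<theta> * x) * h"
proof -
  have b: "weighted_bound \<epsilon> t K" if "0 < \<epsilon>" for \<epsilon>
    using weighted_bound_final[OF assms(1) that t assms(2,3)] .
  show "\<bar>u t x\<bar> \<le> K * exp (growth_rate * t) * exp (- \<theta> * x)"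
  proof (rule le_of_tempered_weight_bounds)
    fix \<epsilon> :: real assume "0 < \<epsilon>"
    from b[OF this] show "tempered_weight \<theta> \<epsilon> x * \<bar>u t x\<bar> \<le> K * exp (growth_rate * t)"
      unfolding weighted_bound_def using t by (meson atLeastAtMost_iff order_refl)
  qed
  assume h: "0 < h" "h \<le> 1"
  have "\<bar>u t (x + h) - u t x\<bar> \<le> K * exp (growth_rate * t) * h * exp (- \<theta> * x)"
  proof (rule le_of_tempered_weight_bounds)
    fix \<epsilon> :: real assume "0 < \<epsilon>"
    from b[OF this] show "tempered_weight \<theta> \<epsilon> x * \<bar>u t (x + h) - u t x\<bar> \<le> K * exp (growth_rate * t) * h"
      unfolding weighted_bound_def using t h by (meson atLeastAtMost_iff order_refl)
  qed
  then show "\<bar>u t (x + h) - u t x\<bar> \<le> K * exp (growth_rate * t) * exp (- \<theta> * x) * h"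
    by (simp add: ac_simps)
qed

end


section \<open>Averages of square-integrable functions\<close>

lemma L2_lincomb:
  assumes "f \<in> L2" "g \<in> L2"
  shows "(\<lambda>x. a * f x + b * g x) \<in> L2"
proof -
  have m[measurable]: "f \<in> borel_measurable lebesgue" "g \<in> borel_measurable lebesgue"
    and i: "integrable lebesgue (\<lambda>x. (f x)\<^sup>2)" "integrable lebesgue (\<lambda>x. (g x)\<^sup>2)"
    using assms by (auto simp: L2_def)
  have "integrable lebesgue (\<lambda>x. (a * f x + b * g x)\<^sup>2)"
  proof (rule Bochner_Integration.integrable_bound)
    show "integrable lebesgue (\<lambda>x. 2 * a\<^sup>2 * (f x)\<^sup>2 + 2 * b\<^sup>2 * (g x)\<^sup>2)"
      by (intro Bochner_Integration.integrable_add integrable_mult_right i)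
    have "(p + q)\<^sup>2 \<le> 2 * p\<^sup>2 + 2 * q\<^sup>2" for p q :: real
      using sum_squares_bound[of p q] by (simp add: power2_sum)
    from this[of "a * f _" "b * g _"]
    show "AE x in lebesgue. norm ((a * f x + b * g x)\<^sup>2) \<le> norm (2 * a\<^sup>2 * (f x)\<^sup>2 + 2 * b\<^sup>2 * (g x)\<^sup>2)"
      by (intro AE_I2) (simp add: power_mult_distrib mult.assoc)
  qed measurable
  then show ?thesis by (simp add: L2_def)
qed

lemma L2_absolutely_integrable:
  assumes "q \<in> L2"
  shows "q absolutely_integrable_on {a..b}" "(\<lambda>x. (q x)\<^sup>2) absolutely_integrable_on {a..b}"
    "integral {a..b} (\<lambda>x. (q x)\<^sup>2) \<le> (L2_norm q)\<^sup>2"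
proof -
  have m: "q \<in> borel_measurable lebesgue" and i: "integrable lebesgue (\<lambda>x. (q x)\<^sup>2)"
    using assms by (auto simp: L2_def)
  show sq: "(\<lambda>x. (q x)\<^sup>2) absolutely_integrable_on {a..b}"
    unfolding set_integrable_def by (intro integrable_mult_indicator i) simp
  show "q absolutely_integrable_on {a..b}"
  proof (rule measurable_bounded_by_integrable_imp_absolutely_integrable)
    show "q \<in> borel_measurable (lebesgue_on {a..b})" using m by (rule measurable_restrict_space1)
    show "(\<lambda>x. 1 + (q x)\<^sup>2) integrable_on {a..b}"
      using set_lebesgue_integral_eq_integral(1)[OF sq] by (intro Henstock_Kurzweil_Integration.integrable_add) auto
    show "norm (q x) \<le> 1 + (q x)\<^sup>2" for x
      using sum_squares_bound[of "\<bar>q x\<bar>" 1] zero_le_power2[of "q x"] by simp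
  qed simp
  have "integral {a..b} (\<lambda>x. (q x)\<^sup>2) = (LINT x:{a..b}|lebesgue. (q x)\<^sup>2)"
    using set_lebesgue_integral_eq_integral(2)[OF sq] by simp
  also have "\<dots> \<le> (LINT x|lebesgue. (q x)\<^sup>2)"
    unfolding set_lebesgue_integral_def
    using sq i by (intro integral_mono) (auto simp: set_integrable_def indicator_def)
  also have "\<dots> = (L2_norm q)\<^sup>2"
    by (simp add: L2_norm_def)
  finally show "integral {a..b} (\<lambda>x. (q x)\<^sup>2) \<le> (L2_norm q)\<^sup>2" .
qed

lemma L2_norm_nonneg: "0 \<le> L2_norm q" by (simp add: L2_norm_def)

text \<open>
  The Cauchy--Schwarz inequality against the constant 1, obtained from the nonnegative integral of
  \<open>(q - m)\<^sup>2\<close>, where \<open>m\<close> is the mean of \<open>q\<close>.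
\<close>

lemma L2_integral_bound:
  assumes q: "q \<in> L2" and k: "0 < k"
  shows "\<bar>integral {x..x+k} q\<bar> \<le> sqrt k * L2_norm q"
proof -
  define J where "J = integral {x..x+k} q"
  define m where "m = J / k"
  have i: "q integrable_on {x..x+k}" "(\<lambda>y. (q y)\<^sup>2) integrable_on {x..x+k}"
    using L2_absolutely_integrable[OF q] set_lebesgue_integral_eq_integral(1) by blast+
  have h: "((\<lambda>y. (q y)\<^sup>2 - 2 * m * q y + m\<^sup>2) has_integral
      (integral {x..x+k} (\<lambda>y. (q y)\<^sup>2) - 2 * m * J + m\<^sup>2 * k)) {x..x+k}"
    unfolding J_def using k has_integral_const_real[of "m\<^sup>2" x "x+k"]
    by (intro has_integral_add has_integral_diff has_integral_mult_right integrable_integral i) (simp_all add: mult.commute)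
  have "0 \<le> integral {x..x+k} (\<lambda>y. (q y)\<^sup>2) - 2 * m * J + m\<^sup>2 * k"
  proof (rule has_integral_nonneg[OF h])
    fix y
    have "(q y)\<^sup>2 - 2 * m * q y + m\<^sup>2 = (q y - m)\<^sup>2" by (simp add: power2_diff)
    then show "0 \<le> (q y)\<^sup>2 - 2 * m * q y + m\<^sup>2" by simp
  qed
  also have "integral {x..x+k} (\<lambda>y. (q y)\<^sup>2) - 2 * m * J + m\<^sup>2 * k = integral {x..x+k} (\<lambda>y. (q y)\<^sup>2) - J\<^sup>2 / k"
    using k by (simp add: m_def power2_eq_square field_simps)
  finally have "J\<^sup>2 \<le> k * (L2_norm q)\<^sup>2"
    using L2_absolutely_integrable(3)[OF q, of x "x+k"] k
    by (smt (verit) mult.commute pos_divide_le_eq)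
  also have "\<dots> = (sqrt k * L2_norm q)\<^sup>2" using k by (simp add: power_mult_distrib)
  finally have "\<bar>J\<bar> \<le> \<bar>sqrt k * L2_norm q\<bar>" by (simp only: abs_le_square_iff)
  then show ?thesis using L2_norm_nonneg[of q] k by (simp add: J_def abs_mult)
qed

lemma L2_integrable: "q \<in> L2 \<Longrightarrow> q integrable_on {a..b}"
  using L2_absolutely_integrable(1) set_lebesgue_integral_eq_integral(1) by blast

lemma L2_norm_le_H1_norm: "L2_norm f \<le> H1_norm f"
  unfolding H1_norm_def by (intro real_le_rsqrt) simp

lemma integral_tendsto_of_C_H1:
  assumes u: "C_H1 S u" and t: "t \<in> S" and k: "0 < k"
  shows "((\<lambda>s. integral {x..x+k} (u s)) \<longlongrightarrow> integral {x..x+k} (u t)) (at t within S)"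
proof -
  have L2: "u s \<in> L2" if "s \<in> S" for s using u that by (auto simp: C_H1_def H1_def)
  have "((\<lambda>s. sqrt k * H1_norm (\<lambda>x. u s x - u t x)) \<longlongrightarrow> sqrt k * 0) (at t within S)"
    using u t by (intro tendsto_intros) (auto simp: C_H1_def)
  then have lim: "((\<lambda>s. sqrt k * H1_norm (\<lambda>x. u s x - u t x)) \<longlongrightarrow> 0) (at t within S)" by simp
  have "((\<lambda>s. integral {x..x+k} (u s) - integral {x..x+k} (u t)) \<longlongrightarrow> 0) (at t within S)"
  proof (rule Lim_null_comparison[OF _ lim])
    have "norm (integral {x..x+k} (u s) - integral {x..x+k} (u t)) \<le> sqrt k * H1_norm (\<lambda>x. u s x - u t x)"
      if "s \<in> S" for s
    proof -
      have d: "(\<lambda>x. u s x - u t x) \<in> L2" using L2_lincomb[OF L2[OF that] L2[OF t], of 1 "-1"] by simp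
      have "integral {x..x+k} (u s) - integral {x..x+k} (u t) = integral {x..x+k} (\<lambda>x. u s x - u t x)"
        by (intro Henstock_Kurzweil_Integration.integral_diff[symmetric] L2_integrable L2 that t)
      also have "\<bar>\<dots>\<bar> \<le> sqrt k * L2_norm (\<lambda>x. u s x - u t x)" by (rule L2_integral_bound[OF d k])
      also have "\<dots> \<le> sqrt k * H1_norm (\<lambda>x. u s x - u t x)"
        using k L2_norm_le_H1_norm by (intro mult_left_mono) auto
      finally show ?thesis by simp
    qed
    then show "\<forall>\<^sub>F s in at t within S. norm (integral {x..x+k} (u s) - integral {x..x+k} (u t)) \<le> sqrt k * H1_norm (\<lambda>x. u s x - u t x)"
      unfolding eventually_at_filter by (intro always_eventually) blast
  qed
  then show ?thesis by (rule LIM_zero_cancel)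
qed

text \<open>
  Integration over an interval is a continuous linear functional on \<open>L2\<close>, so it maps a derivative in
  \<open>L2\<close> to a classical derivative.
\<close>

lemma integral_has_derivative_of_C1_L2:
  assumes u: "C1_L2 S u v" and S: "open S" and t: "t \<in> S" and k: "0 < k"
  shows "((\<lambda>s. integral {x..x+k} (u s)) has_real_derivative integral {x..x+k} (v t)) (at t)"
proof -
  have L2: "u s \<in> L2" "v s \<in> L2" if "s \<in> S" for s using u that by (auto simp: C1_L2_def C_L2_def)
  define q where "q h = (\<lambda>x. (u (t + h) x - u t x) / h - v t x)" for h
  have "((\<lambda>h. sqrt k * L2_norm (q h)) \<longlongrightarrow> sqrt k * 0) (at 0)"
    using u t unfolding q_def by (intro tendsto_intros) (auto simp: C1_L2_def)
  then have lim: "((\<lambda>h. sqrt k * L2_norm (q h)) \<longlongrightarrow> 0) (at 0)" by simp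
  have "((\<lambda>h. (integral {x..x+k} (u (t + h)) - integral {x..x+k} (u t)) / h - integral {x..x+k} (v t)) \<longlongrightarrow> 0) (at 0)"
  proof (rule Lim_null_comparison[OF _ lim])
    have "norm ((integral {x..x+k} (u (t + h)) - integral {x..x+k} (u t)) / h - integral {x..x+k} (v t)) \<le> sqrt k * L2_norm (q h)"
      if h: "t + h \<in> S" for h
    proof -
      have q1: "q h = (\<lambda>x. 1 * (1/h * u (t + h) x + (- 1/h) * u t x) + (-1) * v t x)"
        by (simp add: q_def diff_divide_distrib fun_eq_iff)
      have d: "q h \<in> L2" unfolding q1 by (intro L2_lincomb L2 h t)
      have "(integral {x..x+k} (u (t + h)) - integral {x..x+k} (u t)) / h - integral {x..x+k} (v t) = integral {x..x+k} (q h)"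
        unfolding q_def
        by (subst Henstock_Kurzweil_Integration.integral_diff)
           (auto simp: Henstock_Kurzweil_Integration.integral_diff L2_integrable L2 h t
             intro!: integrable_on_divide Henstock_Kurzweil_Integration.integrable_diff)
      also have "\<bar>\<dots>\<bar> \<le> sqrt k * L2_norm (q h)" by (rule L2_integral_bound[OF d k])
      finally show ?thesis by simp
    qed
    moreover have "\<forall>\<^sub>F h in at 0. t + h \<in> S"
    proof -
      have "((\<lambda>h. t + h) \<longlongrightarrow> t + 0) (at 0)" by (intro tendsto_intros)
      then show ?thesis using topological_tendstoD[OF _ S] t by auto
    qed
    ultimately show "\<forall>\<^sub>F h in at 0. norm ((integral {x..x+k} (u (t + h)) - integral {x..x+k} (u t)) / h - integral {x..x+k} (v t)) \<le> sqrt k * L2_norm (q h)"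
      by (auto elim!: eventually_mono)
  qed
  then show ?thesis unfolding DERIV_def by (rule LIM_zero_cancel)
qed

lemma integral_mean_tendsto:
  fixes f :: "real \<Rightarrow> real"
  assumes f: "continuous_on UNIV f"
  shows "((\<lambda>k. integral {x..x+k} f / k) \<longlongrightarrow> f x) (at_right 0)"
proof (rule tendstoI)
  fix e :: real assume e: "0 < e"
  then have "0 < e / 2" by simp
  with f obtain d where "d > 0" and d: "\<forall>y. dist y x < d \<longrightarrow> dist (f y) (f x) < e / 2"
    unfolding continuous_on_iff by (meson UNIV_I)
  have "dist (integral {x..x+k} f / k) (f x) < e" if k: "0 < k" "k < d" for k
  proof -
    have fi: "f integrable_on {x..x+k}" by (intro integrable_continuous_interval continuous_on_subset[OF f]) auto
    have "\<bar>integral {x..x+k} (\<lambda>y. f y - f x)\<bar> \<le> e / 2 * k"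
    proof (rule integral_abs_le_length)
      fix y assume "y \<in> {x..x+k}"
      then have "dist y x < d" using k by (auto simp: dist_real_def)
      then show "\<bar>f y - f x\<bar> \<le> e / 2" using d by (auto simp: dist_real_def intro: less_imp_le)
    qed (use fi k in \<open>auto intro!: Henstock_Kurzweil_Integration.integrable_diff\<close>)
    moreover have "integral {x..x+k} (\<lambda>y. f y - f x) = integral {x..x+k} f - f x * k"
      using fi k by (subst Henstock_Kurzweil_Integration.integral_diff) (auto simp: mult.commute)
    moreover have "integral {x..x+k} f / k - f x = (integral {x..x+k} f - f x * k) / k"
      using k by (simp add: field_simps)
    ultimately have "\<bar>integral {x..x+k} f / k - f x\<bar> \<le> e / 2" using k by (simp add: pos_divide_le_eq)
    then show ?thesis using e by (simp add: dist_real_def)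
  qed
  then show "\<forall>\<^sub>F k in at_right 0. dist (integral {x..x+k} f / k) (f x) < e"
    using \<open>d > 0\<close> unfolding eventually_at_right_field by blast
qed

lemma limit_le_of_frequently:
  fixes f :: "'a \<Rightarrow> real"
  assumes "(f \<longlongrightarrow> l) F" "\<exists>\<^sub>F s in F. f s \<le> b"
  shows "l \<le> b"
proof (rule ccontr)
  assume "\<not> l \<le> b"
  then have "\<forall>\<^sub>F s in F. b < f s" using assms(1) by (intro order_tendstoD) auto
  then have "\<forall>\<^sub>F s in F. \<not> f s \<le> b" by (rule eventually_mono) auto
  then show False using assms(2) by (simp add: frequently_def)
qed

text \<open>
  Convergence of integrals over intervals suffices to pass a uniform bound to a continuous limit. The
  bound need only hold frequently along the filter, which covers bounds known for almost every time.
\<close>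

lemma pointwise_bound_of_integral_limits:
  fixes v :: "'a \<Rightarrow> real \<Rightarrow> real"
  assumes lim: "\<And>k. 0 < k \<Longrightarrow> ((\<lambda>s. integral {x..x+k} (v s)) \<longlongrightarrow> integral {x..x+k} f) F"
    and f: "continuous_on UNIV f"
    and freq: "\<exists>\<^sub>F s in F. continuous_on UNIV (v s) \<and> (\<forall>y\<in>{x..x+1}. \<bar>v s y\<bar> \<le> b)"
  shows "\<bar>f x\<bar> \<le> b"
proof (rule tendsto_upperbound)
  show "((\<lambda>k. \<bar>integral {x..x+k} f / k\<bar>) \<longlongrightarrow> \<bar>f x\<bar>) (at_right 0)"
    by (intro tendsto_rabs integral_mean_tendsto f)
  show "\<forall>\<^sub>F k in at_right 0. \<bar>integral {x..x+k} f / k\<bar> \<le> b"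
    unfolding eventually_at_right_field
  proof (intro exI[of _ 1] conjI allI impI)
    fix k :: real assume k: "0 < k" "k < 1"
    have "\<bar>integral {x..x+k} f\<bar> \<le> b * k"
    proof (rule limit_le_of_frequently)
      show "((\<lambda>s. \<bar>integral {x..x+k} (v s)\<bar>) \<longlongrightarrow> \<bar>integral {x..x+k} f\<bar>) F"
        by (intro tendsto_rabs lim k)
      show "\<exists>\<^sub>F s in F. \<bar>integral {x..x+k} (v s)\<bar> \<le> b * k"
        using freq
      proof (rule frequently_elim1)
        fix s assume "continuous_on UNIV (v s) \<and> (\<forall>y\<in>{x..x+1}. \<bar>v s y\<bar> \<le> b)"
        then show "\<bar>integral {x..x+k} (v s)\<bar> \<le> b * k"
          using k by (intro integral_abs_le_length integrable_continuous_interval) (auto intro: continuous_on_subset)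
      qed
    qed
    then show "\<bar>integral {x..x+k} f / k\<bar> \<le> b" using k by (simp add: pos_divide_le_eq)
  qed simp
qed simp

lemma integral_shift_real:
  fixes f :: "real \<Rightarrow> real"
  assumes "f integrable_on {a+h..b+h}"
  shows "integral {a..b} (\<lambda>y. f (y + h)) = integral {a+h..b+h} f" "(\<lambda>y. f (y + h)) integrable_on {a..b}"
proof -
  have "((f has_integral integral {a+h..b+h} f) {a+h..b+h})" using assms by (rule integrable_integral)
  from has_integral_affinity[of f _ "a+h" "b+h" 1 h, unfolded cbox_interval, OF this]
  have "((\<lambda>y. f (y + h)) has_integral integral {a+h..b+h} f) {a..b}" by simp
  then show "integral {a..b} (\<lambda>y. f (y + h)) = integral {a+h..b+h} f" "(\<lambda>y. f (y + h)) integrable_on {a..b}"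
    by (auto simp: integral_unique)
qed

lemma integral_abs_le_length_AE:
  fixes f :: "real \<Rightarrow> real"
  assumes f: "f integrable_on {x..x+k}" and k: "0 \<le> k" and B: "AE y in lebesgue. y \<in> {x..x+k} \<longrightarrow> \<bar>f y\<bar> \<le> B" "0 \<le> B"
  shows "\<bar>integral {x..x+k} f\<bar> \<le> B * k"
proof -
  obtain N where N: "N \<in> null_sets lebesgue" "\<And>y. y \<notin> N \<Longrightarrow> y \<in> {x..x+k} \<Longrightarrow> \<bar>f y\<bar> \<le> B"
    using AE_E3[OF B(1)] by auto
  define g where "g y = (if y \<in> N then 0 else f y)" for y
  have N': "negligible N" using N(1) by (simp add: negligible_iff_null_sets)
  have eq: "g y = f y" if "y \<in> {x..x+k} - N" for y using that by (simp add: g_def)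
  have "integral {x..x+k} f = integral {x..x+k} g"
    by (rule integral_spike[OF N']) (simp add: eq)
  moreover have "g integrable_on {x..x+k}"
    by (rule integrable_spike[OF f N']) (simp add: eq)
  ultimately show ?thesis
    using integral_abs_le_length[of g x k B] k N(2) B(2) by (auto simp: g_def)
qed

lemma borel_measurable_of_locally_integrable:
  assumes "locally_integrable f"
  shows "f \<in> borel_measurable lebesgue"
proof (rule borel_measurable_LIMSEQ_real)
  fix n :: nat
  have "set_integrable lebesgue {- real n..real n} f"
    using assms by (simp add: locally_integrable_def)
  then show "(\<lambda>x. indicator {- real n..real n} x * f x) \<in> borel_measurable lebesgue"
    by (auto simp: set_integrable_def dest: borel_measurable_integrable)
next
  fix x :: real
  obtain N :: nat where "\<bar>x\<bar> \<le> real N" using real_arch_simple by blast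
  then have "\<forall>\<^sub>F n in sequentially. indicator {- real n..real n} x * f x = f x"
    by (intro eventually_sequentiallyI[of N]) (auto simp: indicator_def)
  then show "(\<lambda>n. indicator {- real n..real n} x * f x) \<longlonglongrightarrow> f x" by (rule tendsto_eventually)
qed


section \<open>Solutions of the reduced Camassa--Holm equation\<close>

lemma AE_lebesgue_ex_interval:
  assumes "AE x in lebesgue. Q x" "a < (b :: real)"
  shows "\<exists>x\<in>{a<..<b}. Q x"
proof (rule ccontr)
  assume none: "\<not> ?thesis"
  obtain N where N: "N \<in> null_sets lebesgue" "\<And>x. x \<notin> N \<Longrightarrow> Q x"
    using AE_E3[OF assms(1)] by auto
  have "box a b \<subseteq> N" using none N(2) by (auto simp: box_real)
  then have "negligible (box a b)" using N(1) by (meson negligible_iff_null_sets negligible_subset)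
  then have "box a b = {}" unfolding negligible_interval .
  then show False using assms(2) by (simp add: box_real)
qed

text \<open>
  A null set contains no interval, so the exceptional times cannot fill a one-sided neighbourhood
  of \<open>t\<close> in \<open>{a..b}\<close>.
\<close>

lemma AE_frequently_at_within:
  assumes ae: "AE s in lebesgue. s \<in> {a..b} \<longrightarrow> Q s" and t: "t \<in> {a..b}" and ab: "a < (b :: real)"
  shows "\<exists>\<^sub>F s in at t within {a..b}. s \<in> {a..b} \<and> Q s"
  unfolding frequently_def
proof
  assume "\<forall>\<^sub>F s in at t within {a..b}. \<not> (s \<in> {a..b} \<and> Q s)"
  then obtain d where d: "d > 0" "\<And>s. s \<in> {a..b} \<Longrightarrow> s \<noteq> t \<Longrightarrow> dist s t < d \<Longrightarrow> \<not> Q s"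
    unfolding eventually_at by blast
  obtain l r where lr: "l < r" "{l<..<r} \<subseteq> {a..b}" "t \<notin> {l<..<r}" "\<And>s. s \<in> {l<..<r} \<Longrightarrow> dist s t < d"
  proof (cases "t < b")
    case True
    show ?thesis
      by (rule that[of t "min b (t + d)"]) (use True t d(1) in \<open>auto simp: dist_real_def\<close>)
  next
    case False
    show ?thesis
      by (rule that[of "max a (t - d)" t]) (use False t d(1) ab in \<open>auto simp: dist_real_def\<close>)
  qed
  obtain s where "s \<in> {l<..<r}" "s \<in> {a..b} \<longrightarrow> Q s"
    using AE_lebesgue_ex_interval[OF ae lr(1)] by blast
  then show False using d(2)[of s] lr by blast
qed

lemma Linf_norm_nonneg: "0 \<le> Linf_norm f"
proof -
  have "AE x in lebesgue. ereal \<bar>f x\<bar> \<le> Linf_norm f" unfolding Linf_norm_def by (rule esssup_AE)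
  from AE_lebesgue_ex_interval[OF this, of 0 1] obtain x where "ereal \<bar>f x\<bar> \<le> Linf_norm f" by auto
  then show ?thesis by (rule order_trans[rotated]) simp
qed

lemma AE_abs_le_of_Linf_norm:
  assumes "Linf_norm f \<le> ereal M"
  shows "AE x in lebesgue. \<bar>f x\<bar> \<le> M"
proof -
  have "AE x in lebesgue. ereal \<bar>f x\<bar> \<le> Linf_norm f" unfolding Linf_norm_def by (rule esssup_AE)
  then show ?thesis
  proof eventually_elim
    case (elim x)
    then have "ereal \<bar>f x\<bar> \<le> ereal M" using assms by (rule order_trans)
    then show ?case by simp
  qed
qed

lemma continuous_abs_le_of_AE:
  fixes f :: "real \<Rightarrow> real"
  assumes f: "continuous_on UNIV f" and ae: "AE x in lebesgue. \<bar>f x\<bar> \<le> M" and M: "0 \<le> M"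
  shows "\<bar>f x\<bar> \<le> M"
proof (rule tendsto_upperbound)
  show "((\<lambda>k. \<bar>integral {x..x+k} f / k\<bar>) \<longlongrightarrow> \<bar>f x\<bar>) (at_right 0)"
    by (intro tendsto_rabs integral_mean_tendsto f)
  show "\<forall>\<^sub>F k in at_right 0. \<bar>integral {x..x+k} f / k\<bar> \<le> M"
    unfolding eventually_at_right_field
  proof (intro exI[of _ 1] conjI allI impI)
    fix k :: real assume k: "0 < k" "k < 1"
    have "\<bar>integral {x..x+k} f\<bar> \<le> M * k"
      using k M ae
      by (intro integral_abs_le_length_AE integrable_continuous_interval continuous_on_subset[OF f]) auto
    then show "\<bar>integral {x..x+k} f / k\<bar> \<le> M" using k by (simp add: pos_divide_le_eq)
  qed simp
qed simp

lemma has_weak_deriv_weak_deriv: "has_weak_deriv f g \<Longrightarrow> has_weak_deriv f (weak_deriv f)"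
  unfolding weak_deriv_def by (rule someI[of "has_weak_deriv f"])

lemma difference_bound_of_weak_deriv:
  assumes w: "has_weak_deriv f g" and f: "continuous_on UNIV f" and h: "0 \<le> h"
    and B: "AE y in lebesgue. y \<in> {x..x+h} \<longrightarrow> \<bar>g y\<bar> \<le> B" "0 \<le> B"
  shows "\<bar>f (x + h) - f x\<bar> \<le> B * h"
proof -
  have i: "(g has_integral (f (x + h) - f x)) {x..x+h}"
    using h by (intro weak_deriv_has_integral[OF w f]) auto
  show ?thesis
    using integral_abs_le_length_AE[OF has_integral_integrable[OF i] h B] integral_unique[OF i] by simp
qed

text \<open>
  The converse of \<open>difference_bound_of_weak_deriv\<close>; short steps suffice, as only the limit of the
  quotients matters.
\<close>

lemma AE_weak_deriv_bound:
  assumes w: "has_weak_deriv f g" and f: "continuous_on UNIV f"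
    and le: "\<And>x h. 0 < h \<Longrightarrow> h \<le> 1 \<Longrightarrow> \<bar>f (x + h) - f x\<bar> \<le> h * c x"
  shows "AE x in lebesgue. \<bar>g x\<bar> \<le> c x"
proof (rule AE_bound_of_interval_means)
  fix a b :: real
  show "g integrable_on {a..b}"
    by (cases "a \<le> b") (use weak_deriv_has_integral[OF w f] in \<open>auto intro: has_integral_integrable\<close>)
next
  fix x h :: real assume h: "0 < h" "h \<le> 1"
  have "(g has_integral (f (x + h) - f x)) {x..x+h}"
    using h by (intro weak_deriv_has_integral[OF w f]) auto
  then show "\<bar>integral {x..x+h} g\<bar> \<le> h * c x" using le[OF h] by (simp add: integral_unique)
qed

text \<open>
  Means over short intervals obey the essential bounds and converge to the values of a continuous
  representative; the weak derivative controls differences through the fundamental theorem.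
\<close>

lemma W1inf_bounds:
  assumes f: "continuous_on UNIV f" and W: "f \<in> W1inf" "W1inf_norm f \<le> ereal M"
  shows "\<bar>f x\<bar> \<le> M" "\<bar>f x - f y\<bar> \<le> M * \<bar>x - y\<bar>" "0 \<le> M"
proof -
  have w: "has_weak_deriv f (weak_deriv f)"
    using W(1) has_weak_deriv_weak_deriv unfolding W1inf_def by blast
  have n: "Linf_norm f \<le> ereal M" "Linf_norm (weak_deriv f) \<le> ereal M"
    using W(2) Linf_norm_nonneg[of f] Linf_norm_nonneg[of "weak_deriv f"] unfolding W1inf_norm_def
    by (metis add.right_neutral add_left_mono order_trans, metis add.left_neutral add_right_mono order_trans)
  have "ereal 0 \<le> ereal M" using order_trans[OF Linf_norm_nonneg n(1)] by (simp add: zero_ereal_def)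
  then show M: "0 \<le> M" by simp
  show "\<bar>f x\<bar> \<le> M" by (rule continuous_abs_le_of_AE[OF f AE_abs_le_of_Linf_norm[OF n(1)] M])
  have "\<bar>f (z + h) - f z\<bar> \<le> M * h" if "0 \<le> h" for z h
    by (rule difference_bound_of_weak_deriv[OF w f that _ M])
       (use AE_abs_le_of_Linf_norm[OF n(2)] in \<open>auto elim: eventually_mono\<close>)
  from this[of "x - y" y] this[of "y - x" x] show "\<bar>f x - f y\<bar> \<le> M * \<bar>x - y\<bar>"
    by (cases "y \<le> x") (auto simp: abs_minus_commute)
qed

locale Camassa_Holm_solution =
  fixes u ut :: "real \<Rightarrow> real \<Rightarrow> real" and T :: real
  assumes T: "0 < T"
    and cont: "\<And>t. t \<in> {-T..T} \<Longrightarrow> continuous_on UNIV (u t)"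
    and H1: "C_H1 {-T..T} u"
    and W1: "Linf_W1inf {-T..T} u"
    and C1: "C1_L2 {-T<..<T} u ut"
    and CH: "Camassa_Holm {-T<..<T} u ut"
begin

lemma wd: "t \<in> {-T..T} \<Longrightarrow> has_weak_deriv (u t) (weak_deriv (u t))"
  using H1 has_weak_deriv_weak_deriv unfolding C_H1_def H1_def by blast

lemma pass_to_limit:
  assumes t: "t \<in> {-T..T}"
    and freq: "\<exists>\<^sub>F s in at t within {-T..T}. s \<in> {-T..T} \<and> (\<forall>y\<in>{x..x+1}. \<bar>u s y\<bar> \<le> b)"
  shows "\<bar>u t x\<bar> \<le> b"
proof (rule pointwise_bound_of_integral_limits[OF integral_tendsto_of_C_H1[OF H1 t] cont[OF t]])
  show "\<exists>\<^sub>F s in at t within {-T..T}. continuous_on UNIV (u s) \<and> (\<forall>y\<in>{x..x+1}. \<bar>u s y\<bar> \<le> b)"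
    using freq by (rule frequently_elim1) (use cont in blast)
qed

lemma pass_to_limit_difference:
  assumes t: "t \<in> {-T..T}"
    and freq: "\<exists>\<^sub>F s in at t within {-T..T}. s \<in> {-T..T} \<and> (\<forall>y\<in>{x..x+1}. \<bar>u s (y + h) - u s y\<bar> \<le> b)"
  shows "\<bar>u t (x + h) - u t x\<bar> \<le> b"
proof (rule pointwise_bound_of_integral_limits[where v = "\<lambda>s y. u s (y + h) - u s y" and f = "\<lambda>y. u t (y + h) - u t y"])
  have shift: "continuous_on UNIV (\<lambda>y. u s (y + h))" if "s \<in> {-T..T}" for s
    by (intro continuous_on_compose2[OF cont[OF that]] continuous_intros) auto
  have c: "continuous_on UNIV (\<lambda>y. u s (y + h) - u s y)" if "s \<in> {-T..T}" for s
    by (intro continuous_on_diff shift cont that)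
  then show "continuous_on UNIV (\<lambda>y. u t (y + h) - u t y)" using t by blast
  show "\<exists>\<^sub>F s in at t within {-T..T}. continuous_on UNIV (\<lambda>y. u s (y + h) - u s y) \<and> (\<forall>y\<in>{x..x+1}. \<bar>u s (y + h) - u s y\<bar> \<le> b)"
    using freq by (rule frequently_elim1) (use c in blast)
  fix k :: real assume k: "0 < k"
  have i: "u s integrable_on {a..b}" if "s \<in> {-T..T}" for s a b
    by (intro integrable_continuous_interval continuous_on_subset[OF cont[OF that]]) auto
  have eq: "integral {x..x+k} (\<lambda>y. u s (y + h) - u s y) = integral {x+h..(x+h)+k} (u s) - integral {x..x+k} (u s)"
    if "s \<in> {-T..T}" for s
    using integral_shift_real[where f = "u s" and a = x and b = "x + k" and h = h, OF i[OF that]] i[OF that]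
    by (subst Henstock_Kurzweil_Integration.integral_diff) (simp_all add: add.assoc add.commute[of k h])
  have "((\<lambda>s. integral {x+h..(x+h)+k} (u s) - integral {x..x+k} (u s)) \<longlongrightarrow> integral {x+h..(x+h)+k} (u t) - integral {x..x+k} (u t)) (at t within {-T..T})"
    by (intro tendsto_diff integral_tendsto_of_C_H1[OF H1 t] k)
  moreover have "\<forall>\<^sub>F s in at t within {-T..T}. integral {x+h..(x+h)+k} (u s) - integral {x..x+k} (u s) = integral {x..x+k} (\<lambda>y. u s (y + h) - u s y)"
    unfolding eventually_at_filter by (intro always_eventually) (auto simp: eq)
  ultimately show "((\<lambda>s. integral {x..x+k} (\<lambda>y. u s (y + h) - u s y)) \<longlongrightarrow> integral {x..x+k} (\<lambda>y. u t (y + h) - u t y)) (at t within {-T..T})"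
    unfolding eq[OF t] by (rule Lim_transform_eventually)
qed

text \<open>
  The bounds in \<open>W1inf\<close> are known for almost every time only; continuity in time with values in
  \<open>L2\<close> extends them to all times.
\<close>

lemma uniform_bounds:
  obtains M where "0 \<le> M" "\<And>t x. t \<in> {-T..T} \<Longrightarrow> \<bar>u t x\<bar> \<le> M"
    "\<And>t x y. t \<in> {-T..T} \<Longrightarrow> \<bar>u t x - u t y\<bar> \<le> M * \<bar>x - y\<bar>"
proof -
  obtain M0 where M0: "AE t in lebesgue. t \<in> {-T..T} \<longrightarrow> u t \<in> W1inf \<and> W1inf_norm (u t) \<le> ereal M0"
    using W1 unfolding Linf_W1inf_def by blast
  define M where "M = max M0 0"
  have good: "\<bar>u s x\<bar> \<le> M" "\<bar>u s x - u s y\<bar> \<le> M * \<bar>x - y\<bar>"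
    if "s \<in> {-T..T}" "u s \<in> W1inf \<and> W1inf_norm (u s) \<le> ereal M0" for s x y
    using W1inf_bounds[OF cont[OF that(1)] conjunct1[OF that(2)] conjunct2[OF that(2)]] by (simp_all add: M_def)
  have fr: "\<exists>\<^sub>F s in at t within {-T..T}. s \<in> {-T..T} \<and> (u s \<in> W1inf \<and> W1inf_norm (u s) \<le> ereal M0)"
    if "t \<in> {-T..T}" for t
    using AE_frequently_at_within[OF M0 that] T by simp
  show ?thesis
  proof (rule that[of M])
    show "0 \<le> M" by (simp add: M_def)
    fix t x y assume t: "t \<in> {-T..T}"
    show "\<bar>u t x\<bar> \<le> M"
      by (rule pass_to_limit[OF t], rule frequently_elim1[OF fr[OF t]]) (use good in blast)
    have "\<bar>u t (y + (x - y)) - u t y\<bar> \<le> M * \<bar>x - y\<bar>"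
    proof (rule pass_to_limit_difference[OF t], rule frequently_elim1[OF fr[OF t]])
      fix s assume "s \<in> {-T..T} \<and> (u s \<in> W1inf \<and> W1inf_norm (u s) \<le> ereal M0)"
      then show "s \<in> {-T..T} \<and> (\<forall>z\<in>{y..y+1}. \<bar>u s (z + (x - y)) - u s z\<bar> \<le> M * \<bar>x - y\<bar>)"
        using good(2)[of s "_ + (x - y)"] by (metis add_diff_cancel_left')
    qed
    then show "\<bar>u t x - u t y\<bar> \<le> M * \<bar>x - y\<bar>" by simp
  qed
qed

definition source :: "real \<Rightarrow> real \<Rightarrow> real" where
  "source t y = (u t y)\<^sup>2 + (1/2) * (weak_deriv (u t) y)\<^sup>2"

context
  fixes M :: real
  assumes M: "0 \<le> M"
    and bdd: "\<And>t x. t \<in> {-T..T} \<Longrightarrow> \<bar>u t x\<bar> \<le> M"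
    and lip: "\<And>t x y. t \<in> {-T..T} \<Longrightarrow> \<bar>u t x - u t y\<bar> \<le> M * \<bar>x - y\<bar>"
begin

lemma wd_bound: "t \<in> {-T..T} \<Longrightarrow> AE y in lebesgue. \<bar>weak_deriv (u t) y\<bar> \<le> M"
proof (rule AE_weak_deriv_bound[OF wd cont])
  fix y h :: real assume "t \<in> {-T..T}" "0 < h"
  then show "\<bar>u t (y + h) - u t y\<bar> \<le> h * M" using lip[of t "y + h" y] by (simp add: mult.commute)
qed

lemma source_measurable: assumes "t \<in> {-T..T}" shows "source t \<in> borel_measurable lebesgue"
proof -
  have [measurable]: "weak_deriv (u t) \<in> borel_measurable lebesgue" "u t \<in> borel_measurable lebesgue"
    using wd[OF assms] borel_measurable_of_locally_integrable unfolding has_weak_deriv_def by blast+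
  show ?thesis unfolding source_def[abs_def] by measurable
qed

text \<open>
  One factor of each square is bounded by \<open>M\<close>, the other by its weighted bound.
\<close>

lemma source_weighted_bound:
  assumes t: "t \<in> {-T..T}" and S: "AE y in lebesgue. w y * \<bar>weak_deriv (u t) y\<bar> \<le> S"
    "\<And>y. w y * \<bar>u t y\<bar> \<le> S" and w: "\<And>y. 0 < w y"
  shows "AE y in lebesgue. w y * \<bar>source t y\<bar> \<le> 3/2 * M * S"
  using S(1) wd_bound[OF t]
proof eventually_elim
  case (elim y)
  let ?g = "weak_deriv (u t) y"
  have "w y * \<bar>source t y\<bar> = (w y * \<bar>u t y\<bar>) * \<bar>u t y\<bar> + 1/2 * ((w y * \<bar>?g\<bar>) * \<bar>?g\<bar>)"
    by (simp add: source_def power2_eq_square algebra_simps)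
  also have "\<dots> \<le> S * M + 1/2 * (S * M)"
    using elim S(2)[of y] bdd[OF t, of y] w[of y] M
    by (intro add_mono mult_left_mono mult_mono) (auto intro: order_trans[OF _ S(2)[of y]])
  finally show ?case by (simp add: algebra_simps)
qed

lemma source_bound: "t \<in> {-T..T} \<Longrightarrow> AE y in lebesgue. \<bar>source t y\<bar> \<le> 3/2 * M * M"
  using source_weighted_bound[of t "\<lambda>_. 1" M] wd_bound bdd by simp

text \<open>
  The commutator estimate: replacing \<open>u y\<close> by \<open>u x\<close> in the integral of \<open>u * u\<^sub>x\<close> over \<open>{x..x+k}\<close>
  costs at most \<open>(M * k) * M * k\<close>, since \<open>\<bar>u y - u x\<bar> \<le> M * k\<close> and \<open>\<bar>u\<^sub>x\<bar> \<le> M\<close>. What remains of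
  the transport term is \<open>u x * (u (x + k) - u x)\<close>.
\<close>

lemma averaged_equation:
  assumes t: "t \<in> {-T<..<T}" and k: "0 < k"
  shows "\<bar>integral {x..x+k} (ut t) + u t x * (u t (x + k) - u t x)
     + (inv_Helmholtz (source t) (x + k) - inv_Helmholtz (source t) x)\<bar> \<le> M\<^sup>2 * k\<^sup>2"
proof -
  have t': "t \<in> {-T..T}" using t by auto
  let ?g = "weak_deriv (u t)" and ?P = "inv_Helmholtz (source t)"
  note hs = source_measurable[OF t'] source_bound[OF t']
  have wP: "has_weak_deriv ?P (weak_deriv ?P)"
    by (rule has_weak_deriv_weak_deriv[OF has_weak_deriv_inv_Helmholtz[OF hs]])
  have cP: "continuous_on UNIV ?P"
    using inv_Helmholtz_has_derivative[OF hs] by (meson DERIV_continuous_on has_field_derivative_at_within)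
  have iP: "(weak_deriv ?P has_integral (?P (x + k) - ?P x)) {x..x+k}"
    using k by (intro weak_deriv_has_integral[OF wP cP]) auto
  have ig: "(?g has_integral (u t (x + k) - u t x)) {x..x+k}"
    using k by (intro weak_deriv_has_integral[OF wd[OF t'] cont[OF t']]) auto
  have ga: "?g absolutely_integrable_on {x..x+k}"
    using wd[OF t'] unfolding has_weak_deriv_def locally_integrable_def by auto
  have r: "(\<lambda>y. (u t y - u t x) * ?g y) integrable_on {x..x+k}"
  proof (rule set_lebesgue_integral_eq_integral(1), rule absolutely_integrable_bounded_measurable_product_real[OF _ _ _ ga])
    show "(\<lambda>y. u t y - u t x) \<in> borel_measurable (lebesgue_on {x..x+k})"
      by (intro measurable_restrict_space1 borel_measurable_lebesgue_of_continuous continuous_on_diff cont[OF t'] continuous_on_const)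
    have "norm (u t y - u t x) \<le> 2 * M" for y using bdd[OF t', of x] bdd[OF t', of y] by simp
    then show "bounded ((\<lambda>y. u t y - u t x) ` {x..x+k})" unfolding bounded_iff by blast
  qed simp
  have rb: "\<bar>integral {x..x+k} (\<lambda>y. (u t y - u t x) * ?g y)\<bar> \<le> (M * k * M) * k"
  proof (rule integral_abs_le_length_AE[OF r])
    show "AE y in lebesgue. y \<in> {x..x+k} \<longrightarrow> \<bar>(u t y - u t x) * ?g y\<bar> \<le> M * k * M"
      using wd_bound[OF t']
    proof eventually_elim
      case (elim y)
      show ?case
      proof
        assume y: "y \<in> {x..x+k}"
        have "\<bar>u t y - u t x\<bar> \<le> M * \<bar>y - x\<bar>" by (rule lip[OF t'])
        also have "\<dots> \<le> M * k" using y M by (intro mult_left_mono) auto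
        finally show "\<bar>(u t y - u t x) * ?g y\<bar> \<le> M * k * M"
          unfolding abs_mult using elim M k by (intro mult_mono) auto
      qed
    qed
  qed (use k M in auto)
  have "AE y in lebesgue. ut t y + u t y * ?g y = - weak_deriv ?P y"
    using CH t unfolding Camassa_Holm_def source_def[abs_def] by blast
  from AE_E3[OF this] obtain N where N: "N \<in> null_sets lebesgue" "\<And>y. y \<notin> N \<Longrightarrow> ut t y + u t y * ?g y = - weak_deriv ?P y"
    by auto
  have "integral {x..x+k} (ut t) = integral {x..x+k} (\<lambda>y. - ((u t y - u t x) * ?g y) - u t x * ?g y - weak_deriv ?P y)"
  proof (rule integral_spike[of N])
    show "negligible N" using N(1) by (simp add: negligible_iff_null_sets)
    show "- ((u t y - u t x) * ?g y) - u t x * ?g y - weak_deriv ?P y = ut t y" if "y \<in> {x..x+k} - N" for y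
      using N(2)[of y] that by (simp add: algebra_simps)
  qed
  also have "\<dots> = - integral {x..x+k} (\<lambda>y. (u t y - u t x) * ?g y) - u t x * (u t (x + k) - u t x) - (?P (x + k) - ?P x)"
    by (intro integral_unique has_integral_diff has_integral_neg has_integral_mult_right integrable_integral r ig iP)
  finally show ?thesis using rb by (simp add: power2_eq_square ac_simps)
qed

lemma averaged_transport_solution:
  assumes \<theta>: "0 < \<theta>" "\<theta> < 1"
  shows "averaged_transport u (\<lambda>t. inv_Helmholtz (source t)) (\<lambda>t x k. integral {x..x+k} (ut t)) M
     (exp 2 * (1 / (1 - \<theta>) + 2) * (3/2 * M)) \<theta> T"
proof unfold_locales
  show "0 \<le> M" by (rule M)
  show "0 \<le> exp 2 * (1 / (1 - \<theta>) + 2) * (3/2 * M)" using M \<theta> by simp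
  show "0 < \<theta>" by (rule \<theta>)
next
  fix t x y :: real assume "0 \<le> t" "t < T"
  then have t: "t \<in> {-T..T}" by auto
  show "\<bar>u t x\<bar> \<le> M" "\<bar>u t x - u t y\<bar> \<le> M * \<bar>x - y\<bar>" using bdd lip t by auto
next
  fix t x k :: real assume "0 \<le> t" "t < T" and k: "0 < k"
  then have t: "t \<in> {-T<..<T}" by auto
  show "((\<lambda>s. integral {x..x+k} (u s)) has_real_derivative integral {x..x+k} (ut t)) (at t)"
    by (rule integral_has_derivative_of_C1_L2[OF C1 _ t k]) simp
  show "\<bar>integral {x..x+k} (ut t) + u t x * (u t (x + k) - u t x)
     + (inv_Helmholtz (source t) (x + k) - inv_Helmholtz (source t) x)\<bar> \<le> M\<^sup>2 * k\<^sup>2"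
    by (rule averaged_equation[OF t k])
next
  fix t w S x h k
  assume "0 \<le> t" "t < T" and w: "\<And>y. 0 < w y" "\<And>x y. w x \<le> exp (\<theta> * \<bar>x - y\<bar>) * w y" and S: "0 \<le> S"
    and b: "\<And>y. w y * \<bar>u t y\<bar> \<le> S" "\<And>y h. 0 < h \<Longrightarrow> h \<le> 1 \<Longrightarrow> w y * \<bar>u t (y + h) - u t y\<bar> \<le> S * h"
    and k: "0 < k" "k \<le> h" "h \<le> (1::real)"
  then have t: "t \<in> {-T..T}" by auto
  \<comment> \<open>The weighted bound on differences becomes a weighted bound on the weak derivative.\<close>
  have "AE y in lebesgue. \<bar>weak_deriv (u t) y\<bar> \<le> S / w y"
  proof (rule AE_weak_deriv_bound[OF wd[OF t] cont[OF t]])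
    fix y h :: real assume "0 < h" "h \<le> 1"
    from b(2)[OF this, of y] show "\<bar>u t (y + h) - u t y\<bar> \<le> h * (S / w y)"
      using w(1)[of y] by (simp add: field_simps)
  qed
  then have "AE y in lebesgue. w y * \<bar>weak_deriv (u t) y\<bar> \<le> S"
    by (rule eventually_mono) (use w(1) in \<open>simp add: field_simps\<close>)
  then have f: "AE y in lebesgue. w y * \<bar>source t y\<bar> \<le> 3/2 * M * S"
    by (rule source_weighted_bound[OF t _ b(1) w(1)])
  have F: "0 \<le> 3/2 * M * S" using M S by simp
  from weighted_inv_Helmholtz_bounds[OF source_measurable[OF t] source_bound[OF t] w \<theta>(2) f F k, of x]
  show "w x * \<bar>inv_Helmholtz (source t) (x + k) - inv_Helmholtz (source t) x\<bar> \<le> exp 2 * (1 / (1 - \<theta>) + 2) * (3/2 * M) * S * k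
    \<and> w x * \<bar>inv_Helmholtz (source t) (x + h + k) - inv_Helmholtz (source t) (x + h) - (inv_Helmholtz (source t) (x + k) - inv_Helmholtz (source t) x)\<bar>
      \<le> exp 2 * (1 / (1 - \<theta>) + 2) * (3/2 * M) * S * h * k"
    by (simp only: mult.assoc)
qed

end

text \<open>
  The persistence result covers times before \<open>T\<close>, where the equation holds; the bounds extend to \<open>T\<close>
  by continuity in time, as the constant does not depend on \<open>t\<close>.
\<close>

theorem uniform_decay:
  assumes \<theta>: "0 < \<theta>" "\<theta> < 1" and K: "0 \<le> K" "\<And>x. \<bar>u 0 x\<bar> \<le> K * exp (- \<theta> * x)"
    "\<And>x h. 0 < h \<Longrightarrow> h \<le> 1 \<Longrightarrow> \<bar>u 0 (x + h) - u 0 x\<bar> \<le> K * exp (- \<theta> * x) * h"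
  obtains L where "\<And>t x. t \<in> {0..T} \<Longrightarrow> \<bar>u t x\<bar> \<le> L * exp (- \<theta> * x)"
    "\<And>t. t \<in> {0..T} \<Longrightarrow> AE x in lebesgue. \<bar>weak_deriv (u t) x\<bar> \<le> L * exp (- \<theta> * x)"
proof -
  obtain M where M: "0 \<le> M" "\<And>t x. t \<in> {-T..T} \<Longrightarrow> \<bar>u t x\<bar> \<le> M"
    "\<And>t x y. t \<in> {-T..T} \<Longrightarrow> \<bar>u t x - u t y\<bar> \<le> M * \<bar>x - y\<bar>"
    using uniform_bounds by blast
  interpret averaged_transport u "\<lambda>t. inv_Helmholtz (source t)" "\<lambda>t x k. integral {x..x+k} (ut t)" M
     "exp 2 * (1 / (1 - \<theta>) + 2) * (3/2 * M)" \<theta> T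
    by (rule averaged_transport_solution[OF M \<theta>])
  define L where "L = K * exp (growth_rate * T)"
  have gr: "0 \<le> growth_rate"
    using growth_rate(2) mult_nonneg_nonneg[OF M(1) less_imp_le[OF \<theta>(1)]] by linarith
  have L0: "0 \<le> L" using K(1) by (simp add: L_def)
  have le: "K * exp (growth_rate * t) \<le> L" if "t \<le> T" for t
    unfolding L_def using that gr K(1) by (intro mult_left_mono) (auto intro: mult_left_mono)
  have early: "\<bar>u t x\<bar> \<le> L * exp (- \<theta> * x)" "0 < h \<Longrightarrow> h \<le> 1 \<Longrightarrow> \<bar>u t (x + h) - u t x\<bar> \<le> L * exp (- \<theta> * x) * h"
    if t: "0 \<le> t" "t < T" for t x h
  proof -
    have l: "K * exp (growth_rate * t) * exp (- \<theta> * x) \<le> L * exp (- \<theta> * x)"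
      using le[of t] t by (intro mult_right_mono) auto
    show "\<bar>u t x\<bar> \<le> L * exp (- \<theta> * x)"
      using decay_persists(1)[OF K t, of x] l by linarith
    assume h: "0 < h" "h \<le> 1"
    show "\<bar>u t (x + h) - u t x\<bar> \<le> L * exp (- \<theta> * x) * h"
      using decay_persists(2)[OF K t h, of x] mult_right_mono[OF l, of h] h by linarith
  qed
  have mono: "L * exp (- \<theta> * y) \<le> L * exp (- \<theta> * x)" if "x \<le> y" for x y
    using that L0 \<theta> by (intro mult_left_mono) auto
  have fr: "\<exists>\<^sub>F s in at T within {-T..T}. s \<in> {-T..T} \<and> (0 \<le> s \<and> s < T)"
  proof -
    have "AE s in lebesgue. s \<in> {-T..T} \<longrightarrow> s \<noteq> T"
      using AE_not_equal[of T] by (rule eventually_mono) simp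
    then have "\<exists>\<^sub>F s in at T within {-T..T}. s \<in> {-T..T} \<and> s \<noteq> T"
      by (rule AE_frequently_at_within) (use T in auto)
    moreover have "\<forall>\<^sub>F s in at T within {-T..T}. 0 < s"
      using order_tendstoD(1)[OF tendsto_ident_at T] .
    ultimately have "\<exists>\<^sub>F s in at T within {-T..T}. (s \<in> {-T..T} \<and> s \<noteq> T) \<and> 0 < s"
      by (rule frequently_eventually_frequently)
    then show ?thesis by (rule frequently_elim1) auto
  qed
  have TT: "T \<in> {-T..T}" using T by auto
  have value_bound: "\<bar>u t x\<bar> \<le> L * exp (- \<theta> * x)" if t: "t \<in> {0..T}" for t x
  proof (cases "t < T")
    case False
    then have "t = T" using t by auto
    moreover have "\<bar>u T x\<bar> \<le> L * exp (- \<theta> * x)"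
    proof (rule pass_to_limit[OF TT], rule frequently_elim1[OF fr])
      fix s assume s: "s \<in> {-T..T} \<and> (0 \<le> s \<and> s < T)"
      then show "s \<in> {-T..T} \<and> (\<forall>y\<in>{x..x+1}. \<bar>u s y\<bar> \<le> L * exp (- \<theta> * x))"
        using early(1)[of s] mono[of x] by (meson atLeastAtMost_iff order_trans)
    qed
    ultimately show ?thesis by simp
  qed (use early t in auto)
  have difference: "\<bar>u t (x + h) - u t x\<bar> \<le> L * exp (- \<theta> * x) * h" if t: "t \<in> {0..T}" and h: "0 < h" "h \<le> 1" for t x h
  proof (cases "t < T")
    case False
    then have "t = T" using t by auto
    moreover have "\<bar>u T (x + h) - u T x\<bar> \<le> L * exp (- \<theta> * x) * h"
    proof (rule pass_to_limit_difference[OF TT], rule frequently_elim1[OF fr])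
      fix s assume s: "s \<in> {-T..T} \<and> (0 \<le> s \<and> s < T)"
      have "L * exp (- \<theta> * y) * h \<le> L * exp (- \<theta> * x) * h" if "x \<le> y" for y
        using mono[OF that] h by (intro mult_right_mono) auto
      then show "s \<in> {-T..T} \<and> (\<forall>y\<in>{x..x+1}. \<bar>u s (y + h) - u s y\<bar> \<le> L * exp (- \<theta> * x) * h)"
        using early(2)[of s, OF _ _ h] s by (meson atLeastAtMost_iff order_trans)
    qed
    ultimately show ?thesis by simp
  qed (use early t h in auto)
  show ?thesis
  proof (rule that[of L])
    fix t assume t: "t \<in> {0..T}"
    then have t': "t \<in> {-T..T}" using T by auto
    show "\<bar>u t x\<bar> \<le> L * exp (- \<theta> * x)" for x by (rule value_bound[OF t])
    show "AE x in lebesgue. \<bar>weak_deriv (u t) x\<bar> \<le> L * exp (- \<theta> * x)"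
      by (rule AE_weak_deriv_bound[OF wd[OF t'] cont[OF t']]) (use difference[OF t] in \<open>simp add: mult.commute\<close>)
  qed
qed

end

theorem theorem1p13:
  fixes u ut :: "real \<Rightarrow> real \<Rightarrow> real" and u0 :: "real \<Rightarrow> real" and T \<theta> :: real
  assumes "T > 0"
    and "\<forall>t\<in>{-T..T}. continuous_on UNIV (u t)"
    and "C_H1 {-T..T} u"
    and "Linf_W1inf {-T..T} u"
    and "C1_L2 {-T<..<T} u ut"
    and "Camassa_Holm {-T<..<T} u ut"
    and "u0 \<in> H1 \<inter> W1inf"
    and "\<forall>x. u 0 x = u0 x"
    and "0 < \<theta>" "\<theta> < 1"
    and "u0 \<in> O[at_top](\<lambda>x. exp (- \<theta> * x))"
    and "\<exists>C X. AE x in lebesgue. x \<ge> X \<longrightarrow> \<bar>weak_deriv u0 x\<bar> \<le> C * exp (- \<theta> * x)"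
  shows "\<exists>C X. \<forall>t\<in>{0..T}.
           (\<forall>x\<ge>X. \<bar>u t x\<bar> \<le> C * exp (- \<theta> * x)) \<and>
           (AE x in lebesgue. x \<ge> X \<longrightarrow> \<bar>weak_deriv (u t) x\<bar> \<le> C * exp (- \<theta> * x))"
proof -
  interpret Camassa_Holm_solution u ut T
    by unfold_locales (use assms in auto)
  have u0: "u 0 = u0" using assms(8) by (simp add: fun_eq_iff)
  have t0: "0 \<in> {-T..T}" using assms(1) by simp
  obtain M where M: "0 \<le> M" "\<And>t x. t \<in> {-T..T} \<Longrightarrow> \<bar>u t x\<bar> \<le> M"
    "\<And>t x y. t \<in> {-T..T} \<Longrightarrow> \<bar>u t x - u t y\<bar> \<le> M * \<bar>x - y\<bar>"
    using uniform_bounds by blast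
  obtain c1 where c1: "c1 > 0" "\<forall>\<^sub>F x in at_top. norm (u0 x) \<le> c1 * norm (exp (- \<theta> * x))"
    using assms(11) by (rule landau_o.bigE)
  obtain X1 where X1: "\<And>x. X1 \<le> x \<Longrightarrow> \<bar>u0 x\<bar> \<le> c1 * exp (- \<theta> * x)"
    using c1(2) unfolding eventually_at_top_linorder by auto
  obtain c2 X2 where X2: "AE x in lebesgue. x \<ge> X2 \<longrightarrow> \<bar>weak_deriv u0 x\<bar> \<le> c2 * exp (- \<theta> * x)"
    using assms(12) by blast
  \<comment> \<open>Left of \<open>X1\<close> and \<open>X2\<close>, where no decay is assumed, the bound \<open>M\<close> is at most a multiple of \<open>exp (- \<theta> * x)\<close>.\<close>
  define K where "K = c1 + \<bar>c2\<bar> + M * exp (\<theta> * \<bar>X1\<bar>) + M * exp (\<theta> * \<bar>X2\<bar>)"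
  have parts: "0 \<le> c1" "0 \<le> \<bar>c2\<bar>" "0 \<le> M * exp (\<theta> * \<bar>X1\<bar>)" "0 \<le> M * exp (\<theta> * \<bar>X2\<bar>)" using c1 M by auto
  have left: "M \<le> K * exp (- \<theta> * x)" if "x \<le> X" "X = X1 \<or> X = X2" for x X
  proof -
    have "M * 1 \<le> M * (exp (\<theta> * \<bar>X\<bar>) * exp (- \<theta> * x))"
      using that(1) assms(9) M(1) by (intro mult_left_mono) (auto simp: exp_add[symmetric] intro: mult_left_mono)
    also have "\<dots> = (M * exp (\<theta> * \<bar>X\<bar>)) * exp (- \<theta> * x)" by simp
    also have "\<dots> \<le> K * exp (- \<theta> * x)"
      using that(2) parts unfolding K_def by (intro mult_right_mono) auto
    finally show ?thesis by simp
  qed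
  show ?thesis
  proof (rule uniform_decay[OF assms(9,10), of K])
    show "0 \<le> K" using parts by (simp add: K_def)
    show "\<bar>u 0 x\<bar> \<le> K * exp (- \<theta> * x)" for x
    proof (cases "X1 \<le> x")
      case True
      have "c1 * exp (- \<theta> * x) \<le> K * exp (- \<theta> * x)" using parts unfolding K_def by (intro mult_right_mono) auto
      then show ?thesis using X1[OF True] unfolding u0 by linarith
    next
      case False
      then show ?thesis using left[of x X1] M(2)[OF t0, of x] by simp
    qed
    show "\<bar>u 0 (x + h) - u 0 x\<bar> \<le> K * exp (- \<theta> * x) * h" if h: "0 < h" "h \<le> 1" for x h
    proof (cases "X2 \<le> x")
      case True
      have "\<bar>u 0 (x + h) - u 0 x\<bar> \<le> (\<bar>c2\<bar> * exp (- \<theta> * x)) * h"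
      proof (rule difference_bound_of_weak_deriv[OF wd[OF t0] cont[OF t0]])
        show "AE y in lebesgue. y \<in> {x..x+h} \<longrightarrow> \<bar>weak_deriv (u 0) y\<bar> \<le> \<bar>c2\<bar> * exp (- \<theta> * x)"
          using X2 unfolding u0
        proof eventually_elim
          case (elim y)
          show ?case
          proof
            assume y: "y \<in> {x..x+h}"
            then have "\<bar>weak_deriv u0 y\<bar> \<le> c2 * exp (- \<theta> * y)" using elim True by simp
            also have "\<dots> \<le> \<bar>c2\<bar> * exp (- \<theta> * x)" using y assms(9) by (intro mult_mono) auto
            finally show "\<bar>weak_deriv u0 y\<bar> \<le> \<bar>c2\<bar> * exp (- \<theta> * x)" .
          qed
        qed
      qed (use h in auto)
      also have "\<dots> \<le> K * exp (- \<theta> * x) * h"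
        using parts h unfolding K_def by (intro mult_right_mono) auto
      finally show ?thesis .
    next
      case False
      have "\<bar>u 0 (x + h) - u 0 x\<bar> \<le> M * h" using M(3)[OF t0, of "x + h" x] h by simp
      also have "\<dots> \<le> K * exp (- \<theta> * x) * h" using left[of x X2] False h by (intro mult_right_mono) auto
      finally show ?thesis .
    qed
    fix L assume L: "\<And>t x. t \<in> {0..T} \<Longrightarrow> \<bar>u t x\<bar> \<le> L * exp (- \<theta> * x)"
      "\<And>t. t \<in> {0..T} \<Longrightarrow> AE x in lebesgue. \<bar>weak_deriv (u t) x\<bar> \<le> L * exp (- \<theta> * x)"
    have ae: "AE x in lebesgue. x \<ge> 0 \<longrightarrow> \<bar>weak_deriv (u t) x\<bar> \<le> L * exp (- \<theta> * x)" if "t \<in> {0..T}" for t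
      using L(2)[OF that] by (rule eventually_mono) simp
    show ?thesis
      by (rule exI[of _ L], rule exI[of _ 0]) (use L(1) ae in blast)
  qed
qed

end
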